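(* Let $A$ be a Dedekind domain or a field. Let $\Lambda$ be an $A$-algebra which is free of finite rank over $A$, and let $P$ be a (left) $\Lambda$-module which is free of finite rank over $A$. (i) Suppose that for every maximal ideal $\mathfrak m$ of $A$ there exists a ring homomorphism from $A$ to a field $F$ with kernel $\mathfrak m$ such that the natural map $F\otimes_A \mathrm{Ann}_\Lambda(P)\to \mathrm{Ann}_{\Lambda_F}(P_F)$ is surjective. Then for any $A$-algebra $B$ the natural map $$\Phi_B: B\otimes_A \mathrm{Ann}_\Lambda(P)\to \mathrm{Ann}_{\Lambda_B}(P_B)$$ is an isomorphism. (ii) Suppose that for every maximal ideal $\mathfrak m$ of $A$ there exists a ring homomorphism from $A$ to a field $F$ with kernel $\mathfrak m$ such that the natural map $F\otimes_A \mathrm{End}_\Lambda(P)\to \mathrm{End}_{\Lambda_F}(P_F)$ is surjective. Then for any $A$-algebra $B$ the natural map $$\Psi_B: B^{\mathrm{op}}\otimes_A \mathrm{End}_\Lambda(P)\to \mathrm{End}_{\Lambda_B}(P_B)$$ is an isomorphism.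
   Context: All modules are left modules. $A$-algebras are associative, unital and not necessarily commutative. For an $A$-algebra $B$ put $\Lambda_B=B\otimes_A\Lambda$ and $P_B=B\otimes_A P$, a $\Lambda_B$-module. $\mathrm{Ann}_\Lambda(P)=\{x\in\Lambda : xp=0 \text{ for all } p\in P\}$. $B^{\mathrm{op}}$ is the opposite algebra. The map $\Phi_B$ is induced by the inclusion $\mathrm{Ann}_\Lambda(P)\subseteq\Lambda$, i.e. $b\otimes x\mapsto b\otimes x\in\Lambda_B$. The map $\Psi_B$ is given by $\Psi_B(b\otimes\alpha)(b'\otimes p)=b'b\otimes\alpha(p)$ for $b,b'\in B$, $\alpha\in\mathrm{End}_\Lambda(P)$, $p\in P$. The maps over $F$ are $\Phi_F$ and $\Psi_F$. *)

theory Defs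
  imports "HOL-Algebra.Algebra"
begin

section \<open>Dedekind domains\<close>

text \<open>
  Integral closedness in the field of fractions: that \<open>a / b\<close> is a root of the monic polynomial
  \<open>X\<^sup>n + \<Sum>i<n. c i X\<^sup>i\<close> is expressed by the equation multiplied by \<open>b\<^sup>n\<close>, and that \<open>a / b\<close>
  lies in the ring by \<open>a = d b\<close>.  Fields satisfy this definition.
\<close>

locale dedekind_domain = noetherian_domain +
  assumes integrally_closed:
    "\<lbrakk> a \<in> carrier R; b \<in> carrier R; b \<noteq> \<zero>; c \<in> {..<n} \<rightarrow> carrier R;
       a [^] (n::nat) \<oplus> (\<Oplus>i\<in>{..<n}. c i \<otimes> a [^] i \<otimes> b [^] (n - i)) = \<zero> \<rbrakk>
     \<Longrightarrow> \<exists>d\<in>carrier R. a = d \<otimes> b"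
    and nonzero_prime_maximal: "\<lbrakk> primeideal I R; I \<noteq> {\<zero>} \<rbrakk> \<Longrightarrow> maximalideal I R"


section \<open>Algebras and modules over non-commutative rings\<close>

text \<open>The library's locale \<open>algebra\<close> is about commutative algebras only, and its locale \<open>module\<close>
  about modules over commutative rings only.\<close>

locale assoc_algebra = module R M + M?: ring M for R (structure) and M (structure) +
  assumes smult_mult_left:
    "\<lbrakk> a \<in> carrier R; x \<in> carrier M; y \<in> carrier M \<rbrakk>
     \<Longrightarrow> (a \<odot>\<^bsub>M\<^esub> x) \<otimes>\<^bsub>M\<^esub> y = a \<odot>\<^bsub>M\<^esub> (x \<otimes>\<^bsub>M\<^esub> y)"
    and smult_mult_right:
    "\<lbrakk> a \<in> carrier R; x \<in> carrier M; y \<in> carrier M \<rbrakk>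
     \<Longrightarrow> x \<otimes>\<^bsub>M\<^esub> (a \<odot>\<^bsub>M\<^esub> y) = a \<odot>\<^bsub>M\<^esub> (x \<otimes>\<^bsub>M\<^esub> y)"

locale left_module = R?: ring R + M?: abelian_group M
  for R :: "('r, 'x) ring_scheme" (structure) and M :: "('r, 'm, 'y) module_scheme" (structure) +
  assumes smult_closed:
    "\<lbrakk> r \<in> carrier R; x \<in> carrier M \<rbrakk> \<Longrightarrow> r \<odot>\<^bsub>M\<^esub> x \<in> carrier M"
    and smult_l_distr:
    "\<lbrakk> r \<in> carrier R; s \<in> carrier R; x \<in> carrier M \<rbrakk>
     \<Longrightarrow> (r \<oplus> s) \<odot>\<^bsub>M\<^esub> x = r \<odot>\<^bsub>M\<^esub> x \<oplus>\<^bsub>M\<^esub> s \<odot>\<^bsub>M\<^esub> x"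
    and smult_r_distr:
    "\<lbrakk> r \<in> carrier R; x \<in> carrier M; y \<in> carrier M \<rbrakk>
     \<Longrightarrow> r \<odot>\<^bsub>M\<^esub> (x \<oplus>\<^bsub>M\<^esub> y) = r \<odot>\<^bsub>M\<^esub> x \<oplus>\<^bsub>M\<^esub> r \<odot>\<^bsub>M\<^esub> y"
    and smult_assoc:
    "\<lbrakk> r \<in> carrier R; s \<in> carrier R; x \<in> carrier M \<rbrakk>
     \<Longrightarrow> (r \<otimes> s) \<odot>\<^bsub>M\<^esub> x = r \<odot>\<^bsub>M\<^esub> (s \<odot>\<^bsub>M\<^esub> x)"
    and smult_one: "x \<in> carrier M \<Longrightarrow> \<one> \<odot>\<^bsub>M\<^esub> x = x"

definition free_of_finite_rank :: "('a, 'x) ring_scheme \<Rightarrow> ('a, 'm, 'y) module_scheme \<Rightarrow> bool"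
  where "free_of_finite_rank A M \<longleftrightarrow>
    (\<exists>E \<subseteq> carrier M. finite E \<and>
       (\<forall>x\<in>carrier M. \<exists>!c. c \<in> E \<rightarrow>\<^sub>E carrier A \<and> x = (\<Oplus>\<^bsub>M\<^esub>e\<in>E. c e \<odot>\<^bsub>M\<^esub> e)))"

text \<open>
  \<open>M\<close> with its scalar multiplication (if any) replaced by \<open>s\<close>; the ring of scalars may change.
  Modules are records that extend rings, so a module carries fields \<open>mult\<close> and \<open>one\<close>; these have
  no meaning unless the module is an algebra.
\<close>

definition with_smult :: "('m, 'x) ring_scheme \<Rightarrow> ('r \<Rightarrow> 'm \<Rightarrow> 'm) \<Rightarrow> ('r, 'm) module"
  where "with_smult M s =
    \<lparr>carrier = carrier M, monoid.mult = monoid.mult M, monoid.one = monoid.one M,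
     ring.zero = ring.zero M, ring.add = ring.add M, smult = s\<rparr>"

text \<open>The \<open>A\<close>-module underlying a module \<open>P\<close> over an \<open>A\<close>-algebra \<open>\<Lambda>\<close>.\<close>

definition restrict_scalars ::
  "('a, 'l, 'x) module_scheme \<Rightarrow> ('l, 'p, 'y) module_scheme \<Rightarrow> ('a, 'p) module"
  where "restrict_scalars \<Lambda> P = with_smult P (\<lambda>a p. (a \<odot>\<^bsub>\<Lambda>\<^esub> \<one>\<^bsub>\<Lambda>\<^esub>) \<odot>\<^bsub>P\<^esub> p)"

text \<open>The algebra structure on a ring \<open>F\<close> given by a ring homomorphism \<open>h\<close> into its centre.\<close>

definition algebra_via :: "('a \<Rightarrow> 'f) \<Rightarrow> ('f, 'x) ring_scheme \<Rightarrow> ('a, 'f) module"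
  where "algebra_via h F = with_smult F (\<lambda>a x. h a \<otimes>\<^bsub>F\<^esub> x)"

definition opposite :: "('a, 'b) module \<Rightarrow> ('a, 'b) module"
  where "opposite B = B\<lparr>monoid.mult := (\<lambda>x y. y \<otimes>\<^bsub>B\<^esub> x)\<rparr>"

definition annihilator :: "('l, 'x) ring_scheme \<Rightarrow> ('l, 'p, 'y) module_scheme \<Rightarrow> 'l set"
  where "annihilator \<Lambda> P = {x \<in> carrier \<Lambda>. \<forall>p\<in>carrier P. x \<odot>\<^bsub>P\<^esub> p = \<zero>\<^bsub>P\<^esub>}"

text \<open>
  \<open>End\<^sub>\<Lambda>(P)\<close> as an \<open>A\<close>-algebra, for a module \<open>P\<close> over an \<open>A\<close>-algebra \<open>\<Lambda>\<close>.  Endomorphisms are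
  extensional functions, so that they are determined by their values on \<open>carrier P\<close>.
\<close>

definition End_algebra ::
  "('a, 'l, 'x) module_scheme \<Rightarrow> ('l, 'p, 'y) module_scheme \<Rightarrow> ('a, 'p \<Rightarrow> 'p) module"
  where "End_algebra \<Lambda> P =
    \<lparr>carrier = {f \<in> carrier P \<rightarrow>\<^sub>E carrier P.
        (\<forall>p\<in>carrier P. \<forall>q\<in>carrier P. f (p \<oplus>\<^bsub>P\<^esub> q) = f p \<oplus>\<^bsub>P\<^esub> f q) \<and>
        (\<forall>x\<in>carrier \<Lambda>. \<forall>p\<in>carrier P. f (x \<odot>\<^bsub>P\<^esub> p) = x \<odot>\<^bsub>P\<^esub> f p)},
     monoid.mult = (\<lambda>f g. compose (carrier P) f g),
     monoid.one = (\<lambda>p\<in>carrier P. p),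
     ring.zero = (\<lambda>p\<in>carrier P. \<zero>\<^bsub>P\<^esub>),
     ring.add = (\<lambda>f g. \<lambda>p\<in>carrier P. f p \<oplus>\<^bsub>P\<^esub> g p),
     smult = (\<lambda>a f. \<lambda>p\<in>carrier P. (a \<odot>\<^bsub>\<Lambda>\<^esub> \<one>\<^bsub>\<Lambda>\<^esub>) \<odot>\<^bsub>P\<^esub> f p)\<rparr>"

definition left_module_iso ::
  "('r, 'x) ring_scheme \<Rightarrow> ('r, 'm, 'y) module_scheme \<Rightarrow> ('r, 'n, 'z) module_scheme \<Rightarrow> ('m \<Rightarrow> 'n) set"
  where "left_module_iso R M N =
    {h \<in> iso (add_monoid M) (add_monoid N).
       \<forall>r\<in>carrier R. \<forall>x\<in>carrier M. h (r \<odot>\<^bsub>M\<^esub> x) = r \<odot>\<^bsub>N\<^esub> h x}"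

definition algebra_iso ::
  "('a, 'x) ring_scheme \<Rightarrow> ('a, 'm, 'y) module_scheme \<Rightarrow> ('a, 'n, 'z) module_scheme \<Rightarrow> ('m \<Rightarrow> 'n) set"
  where "algebra_iso A M N =
    {h \<in> ring_iso M N. \<forall>a\<in>carrier A. \<forall>x\<in>carrier M. h (a \<odot>\<^bsub>M\<^esub> x) = a \<odot>\<^bsub>N\<^esub> h x}"


section \<open>Tensor products\<close>

text \<open>
  The abelian group underlying \<open>M \<otimes>\<^sub>A N\<close> is the quotient of the free abelian group on
  \<open>carrier M \<times> carrier N\<close> by the usual relations.  It is written multiplicatively, as the
  library's free abelian groups and quotient groups are.
\<close>

type_synonym ('m, 'n) tensor = "('m \<times> 'n \<Rightarrow>\<^sub>0 int) set"

definition tensor_relations ::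
  "('a, 'x) ring_scheme \<Rightarrow> ('a, 'm, 'y) module_scheme \<Rightarrow> ('a, 'n, 'z) module_scheme
   \<Rightarrow> ('m \<times> 'n \<Rightarrow>\<^sub>0 int) set"
  where "tensor_relations A M N =
    {frag_of (x \<oplus>\<^bsub>M\<^esub> x', y) - frag_of (x, y) - frag_of (x', y) | x x' y.
       x \<in> carrier M \<and> x' \<in> carrier M \<and> y \<in> carrier N} \<union>
    {frag_of (x, y \<oplus>\<^bsub>N\<^esub> y') - frag_of (x, y) - frag_of (x, y') | x y y'.
       x \<in> carrier M \<and> y \<in> carrier N \<and> y' \<in> carrier N} \<union>
    {frag_of (a \<odot>\<^bsub>M\<^esub> x, y) - frag_of (x, a \<odot>\<^bsub>N\<^esub> y) | a x y.
       a \<in> carrier A \<and> x \<in> carrier M \<and> y \<in> carrier N}"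

definition tensor_kernel ::
  "('a, 'x) ring_scheme \<Rightarrow> ('a, 'm, 'y) module_scheme \<Rightarrow> ('a, 'n, 'z) module_scheme
   \<Rightarrow> ('m \<times> 'n \<Rightarrow>\<^sub>0 int) set"
  where "tensor_kernel A M N =
    generate (free_Abelian_group (carrier M \<times> carrier N)) (tensor_relations A M N)"

definition tensor_group ::
  "('a, 'x) ring_scheme \<Rightarrow> ('a, 'm, 'y) module_scheme \<Rightarrow> ('a, 'n, 'z) module_scheme
   \<Rightarrow> ('m, 'n) tensor monoid"
  where "tensor_group A M N =
    free_Abelian_group (carrier M \<times> carrier N) Mod tensor_kernel A M N"

definition pure_tensor ::
  "('a, 'x) ring_scheme \<Rightarrow> ('a, 'm, 'y) module_scheme \<Rightarrow> ('a, 'n, 'z) module_scheme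
   \<Rightarrow> 'm \<Rightarrow> 'n \<Rightarrow> ('m, 'n) tensor"
  where "pure_tensor A M N x y =
    tensor_kernel A M N #>\<^bsub>free_Abelian_group (carrier M \<times> carrier N)\<^esub> frag_of (x, y)"

text \<open>
  For an abelian group \<open>G\<close> (written multiplicatively) and an \<open>A\<close>-balanced biadditive map
  \<open>\<phi>\<close> from \<open>carrier M \<times> carrier N\<close> to \<open>G\<close>, \<open>tensor_lift G \<phi>\<close> is the homomorphism from
  \<open>tensor_group A M N\<close> to \<open>G\<close> that sends \<open>x \<otimes> y\<close> to \<open>\<phi> (x, y)\<close> (lemma
  \<open>tensor_lift_pure_tensor\<close> below): all representatives of a tensor then have the same image
  under the extension of \<open>\<phi>\<close> to formal sums.
\<close>

definition tensor_lift :: "('g, 'x) monoid_scheme \<Rightarrow> ('m \<times> 'n \<Rightarrow> 'g) \<Rightarrow> ('m, 'n) tensor \<Rightarrow> 'g"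
  where "tensor_lift G \<phi> T =
    the_elem ((\<lambda>c. finprod G (\<lambda>z. \<phi> z [^]\<^bsub>G\<^esub> Poly_Mapping.lookup c z) (Poly_Mapping.keys c)) ` T)"

lemma tensor_lift_props:
  fixes A :: "('a, 'x) ring_scheme" and M :: "('a, 'm, 'y) module_scheme"
    and N :: "('a, 'n, 'z) module_scheme" and G :: "('g, 'w) monoid_scheme"
  assumes M: "module A M" and N: "module A N" and G: "comm_group G"
    and closed: "\<And>x y. \<lbrakk> x \<in> carrier M; y \<in> carrier N \<rbrakk> \<Longrightarrow> \<phi> (x, y) \<in> carrier G"
    and add_left: "\<And>x x' y. \<lbrakk> x \<in> carrier M; x' \<in> carrier M; y \<in> carrier N \<rbrakk>
      \<Longrightarrow> \<phi> (x \<oplus>\<^bsub>M\<^esub> x', y) = \<phi> (x, y) \<otimes>\<^bsub>G\<^esub> \<phi> (x', y)"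
    and add_right: "\<And>x y y'. \<lbrakk> x \<in> carrier M; y \<in> carrier N; y' \<in> carrier N \<rbrakk>
      \<Longrightarrow> \<phi> (x, y \<oplus>\<^bsub>N\<^esub> y') = \<phi> (x, y) \<otimes>\<^bsub>G\<^esub> \<phi> (x, y')"
    and balanced: "\<And>a x y. \<lbrakk> a \<in> carrier A; x \<in> carrier M; y \<in> carrier N \<rbrakk>
      \<Longrightarrow> \<phi> (a \<odot>\<^bsub>M\<^esub> x, y) = \<phi> (x, a \<odot>\<^bsub>N\<^esub> y)"
  shows tensor_lift_hom: "tensor_lift G \<phi> \<in> hom (tensor_group A M N) G"
    and tensor_lift_pure_tensor:
      "\<lbrakk> x \<in> carrier M; y \<in> carrier N \<rbrakk> \<Longrightarrow> tensor_lift G \<phi> (pure_tensor A M N x y) = \<phi> (x, y)"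
proof -
  let ?S = "carrier M \<times> carrier N"
  let ?F = "free_Abelian_group ?S"
  let ?K = "tensor_kernel A M N"
  interpret M: module A M by fact
  interpret N: module A N by fact
  interpret G: comm_group G by fact
  interpret F: comm_group ?F by (rule abelian_free_Abelian_group)
  define h where "h c = finprod G (\<lambda>z. \<phi> z [^]\<^bsub>G\<^esub> Poly_Mapping.lookup c z) (Poly_Mapping.keys c)"
    for c :: "'m \<times> 'n \<Rightarrow>\<^sub>0 int"
  have img: "\<phi> ` ?S \<subseteq> carrier G" using closed by auto
  then have imgD: "\<phi> z \<in> carrier G" if "z \<in> ?S" for z using that by blast
  have h_eq: "h c = finprod G (\<lambda>z. \<phi> z [^]\<^bsub>G\<^esub> Poly_Mapping.lookup c z) T"
    if "Poly_Mapping.keys c \<subseteq> T" "finite T" "T \<subseteq> ?S" for c T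
    unfolding h_def
  proof (rule G.finprod_mono_neutral_cong_left)
    show "finite T" "Poly_Mapping.keys c \<subseteq> T" by fact+
    show "\<phi> i [^]\<^bsub>G\<^esub> Poly_Mapping.lookup c i = \<one>\<^bsub>G\<^esub>" if "i \<in> T - Poly_Mapping.keys c" for i
      using that by (simp add: in_keys_iff)
    show "(\<lambda>z. \<phi> z [^]\<^bsub>G\<^esub> Poly_Mapping.lookup c z) \<in> T \<rightarrow> carrier G"
      using img \<open>T \<subseteq> ?S\<close> by (auto intro!: G.int_pow_closed)
  qed simp
  have h_closed: "h c \<in> carrier G" if "Poly_Mapping.keys c \<subseteq> ?S" for c
    unfolding h_def using that img by (intro G.finprod_closed) (auto intro!: G.int_pow_closed)
  have h_add: "h (c + d) = h c \<otimes>\<^bsub>G\<^esub> h d"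
    if c: "Poly_Mapping.keys c \<subseteq> ?S" and d: "Poly_Mapping.keys d \<subseteq> ?S" for c d
  proof -
    let ?T = "Poly_Mapping.keys c \<union> Poly_Mapping.keys d"
    have T: "finite ?T" "?T \<subseteq> ?S" using c d by auto
    have cd: "Poly_Mapping.keys (c + d) \<subseteq> ?T" by (rule Poly_Mapping.keys_add)
    have phi: "\<phi> z \<in> carrier G" if "z \<in> ?T" for z using that T img by blast
    have "h (c + d) = finprod G (\<lambda>z. \<phi> z [^]\<^bsub>G\<^esub> Poly_Mapping.lookup c z
        \<otimes>\<^bsub>G\<^esub> \<phi> z [^]\<^bsub>G\<^esub> Poly_Mapping.lookup d z) ?T"
      unfolding h_eq[OF cd T]
      by (intro G.finprod_cong') (use phi in \<open>auto simp: lookup_add G.int_pow_mult\<close>)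
    also have "\<dots> = h c \<otimes>\<^bsub>G\<^esub> h d"
      unfolding h_eq[OF Un_upper1 T] h_eq[OF Un_upper2 T]
      by (intro G.finprod_multf) (use phi in \<open>auto intro!: G.int_pow_closed\<close>)
    finally show ?thesis .
  qed
  have h_hom: "h \<in> hom ?F G"
    by (rule homI) (auto simp: h_closed h_add)
  interpret h: group_hom ?F G h
    by unfold_locales (rule h_hom)
  have h_of: "h (frag_of z) = \<phi> z" if "z \<in> ?S" for z
  proof -
    have z: "\<phi> z \<in> carrier G" using that img by blast
    have "h (frag_of z) = finprod G (\<lambda>u. \<phi> u [^]\<^bsub>G\<^esub> Poly_Mapping.lookup (frag_of z) u) (insert z {})"
      by (simp add: h_def)
    also have "\<dots> = \<phi> z"
      by (subst G.finprod_insert) (use z in simp_all)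
    finally show ?thesis .
  qed
  have h_minus: "h (c - d) = h c \<otimes>\<^bsub>G\<^esub> inv\<^bsub>G\<^esub> h d"
    if "Poly_Mapping.keys c \<subseteq> ?S" "Poly_Mapping.keys d \<subseteq> ?S" for c d
    using h_add[of c "- d"] h.hom_inv[of d] that by simp
  have rel_in: "tensor_relations A M N \<subseteq> carrier ?F"
    by (auto simp: tensor_relations_def dest!: subsetD[OF keys_diff])
  have rel_ker: "h r = \<one>\<^bsub>G\<^esub>" if "r \<in> tensor_relations A M N" for r
  proof -
    have keys: "Poly_Mapping.keys (frag_of u - frag_of v) \<subseteq> ?S" if "u \<in> ?S" "v \<in> ?S" for u v :: "'m \<times> 'n"
      using that by (auto dest!: subsetD[OF keys_diff])
    have cancel: "g \<otimes>\<^bsub>G\<^esub> g' \<otimes>\<^bsub>G\<^esub> inv\<^bsub>G\<^esub> g \<otimes>\<^bsub>G\<^esub> inv\<^bsub>G\<^esub> g' = \<one>\<^bsub>G\<^esub>"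
      if "g \<in> carrier G" "g' \<in> carrier G" for g g'
      using that by (metis G.inv_closed G.inv_mult G.m_assoc G.m_closed G.r_inv)
    have rel3: "h (frag_of u - frag_of v - frag_of w) = \<one>\<^bsub>G\<^esub>"
      if "u \<in> ?S" "v \<in> ?S" "w \<in> ?S" "\<phi> u = \<phi> v \<otimes>\<^bsub>G\<^esub> \<phi> w" for u v w
    proof -
      have "h (frag_of u - frag_of v - frag_of w) = \<phi> u \<otimes>\<^bsub>G\<^esub> inv\<^bsub>G\<^esub> \<phi> v \<otimes>\<^bsub>G\<^esub> inv\<^bsub>G\<^esub> \<phi> w"
        using that keys by (simp add: h_minus h_of del: mem_Sigma_iff)
      then show ?thesis using that(4) cancel[OF imgD[OF that(2)] imgD[OF that(3)]] by simp
    qed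
    have rel2: "h (frag_of u - frag_of v) = \<one>\<^bsub>G\<^esub>"
      if "u \<in> ?S" "v \<in> ?S" "\<phi> u = \<phi> v" for u v
      using that imgD[OF that(2)] by (simp add: h_minus h_of del: mem_Sigma_iff)
    from that show ?thesis
      unfolding tensor_relations_def
      by (auto intro!: rel3 rel2 simp: add_left add_right balanced)
  qed
  have "?K \<subseteq> kernel ?F G h"
    unfolding tensor_kernel_def
    by (rule F.generate_subgroup_incl[OF _ h.subgroup_kernel]) (unfold kernel_def, use rel_in rel_ker in blast)
  then have K: "h k = \<one>\<^bsub>G\<^esub>" "k \<in> carrier ?F" if "k \<in> ?K" for k
    using that by (auto simp: kernel_def)
  have subK: "subgroup ?K ?F"
    unfolding tensor_kernel_def by (rule F.generate_is_subgroup[OF rel_in])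
  then have normal: "?K \<lhd> ?F" by (rule F.subgroup_imp_normal)
  have lift: "tensor_lift G \<phi> (?K #>\<^bsub>?F\<^esub> c) = h c" if c: "c \<in> carrier ?F" for c
  proof -
    have "h ` (?K #>\<^bsub>?F\<^esub> c) = {h c}"
    proof -
      have "h (k + c) = h c" if "k \<in> ?K" for k
        using K[OF that] c by (simp add: h_add h_closed)
      moreover have "0 \<in> ?K" using subgroup.one_closed[OF subK] by simp
      ultimately show ?thesis by (force simp: r_coset_def)
    qed
    then show ?thesis by (simp add: tensor_lift_def h_def[abs_def])
  qed
  show "tensor_lift G \<phi> (pure_tensor A M N x y) = \<phi> (x, y)" if "x \<in> carrier M" "y \<in> carrier N"
    using that by (simp add: pure_tensor_def lift h_of)
  show "tensor_lift G \<phi> \<in> hom (tensor_group A M N) G"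
  proof (rule homI)
    fix T U assume "T \<in> carrier (tensor_group A M N)" "U \<in> carrier (tensor_group A M N)"
    then obtain c d where cd: "c \<in> carrier ?F" "d \<in> carrier ?F" "T = ?K #>\<^bsub>?F\<^esub> c" "U = ?K #>\<^bsub>?F\<^esub> d"
      by (auto simp: tensor_group_def FactGroup_def RCOSETS_def)
    then show "tensor_lift G \<phi> T \<in> carrier G" by (simp add: lift h_closed)
    have "T \<otimes>\<^bsub>tensor_group A M N\<^esub> U = ?K #>\<^bsub>?F\<^esub> (c \<otimes>\<^bsub>?F\<^esub> d)"
      using normal.rcos_sum[OF normal cd(1,2)] cd by (simp add: tensor_group_def FactGroup_def)
    also have "tensor_lift G \<phi> \<dots> = h (c \<otimes>\<^bsub>?F\<^esub> d)"
      by (rule lift) (use cd in \<open>simp only: F.m_closed\<close>)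
    finally show "tensor_lift G \<phi> (T \<otimes>\<^bsub>tensor_group A M N\<^esub> U)
        = tensor_lift G \<phi> T \<otimes>\<^bsub>G\<^esub> tensor_lift G \<phi> U"
      using cd by (simp add: lift h_add)
  qed
qed

text \<open>
  \<open>M \<otimes>\<^sub>A N\<close> as an \<open>A\<close>-module; if \<open>M\<close> and \<open>N\<close> are \<open>A\<close>-algebras (not necessarily unital), also as
  an \<open>A\<close>-algebra, with product \<open>(x \<otimes> y) (x' \<otimes> y') = x x' \<otimes> y y'\<close>.
\<close>

definition tensor_product ::
  "('a, 'x) ring_scheme \<Rightarrow> ('a, 'm, 'y) module_scheme \<Rightarrow> ('a, 'n, 'z) module_scheme
   \<Rightarrow> ('a, ('m, 'n) tensor) module"
  where "tensor_product A M N = (let G = tensor_group A M N; t = pure_tensor A M N in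
    \<lparr>carrier = carrier G,
     monoid.mult = (\<lambda>S T. tensor_lift G (\<lambda>(x, y).
              tensor_lift G (\<lambda>(x', y'). t (x \<otimes>\<^bsub>M\<^esub> x') (y \<otimes>\<^bsub>N\<^esub> y')) T) S),
     monoid.one = t \<one>\<^bsub>M\<^esub> \<one>\<^bsub>N\<^esub>,
     ring.zero = \<one>\<^bsub>G\<^esub>,
     ring.add = monoid.mult G,
     smult = (\<lambda>a. tensor_lift G (\<lambda>(x, y). t (a \<odot>\<^bsub>M\<^esub> x) y))\<rparr>)"

text \<open>\<open>B \<otimes>\<^sub>A M\<close> as a left \<open>B\<close>-module, for an \<open>A\<close>-algebra \<open>B\<close> and an \<open>A\<close>-module \<open>M\<close>.\<close>

definition base_change ::
  "('a, 'x) ring_scheme \<Rightarrow> ('a, 'b, 'y) module_scheme \<Rightarrow> ('a, 'm, 'z) module_scheme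
   \<Rightarrow> ('b, ('b, 'm) tensor) module"
  where "base_change A B M = with_smult (tensor_product A B M)
    (\<lambda>b. tensor_lift (tensor_group A B M) (\<lambda>(b', x). pure_tensor A B M (b \<otimes>\<^bsub>B\<^esub> b') x))"

text \<open>
  \<open>P\<^sub>B = B \<otimes>\<^sub>A P\<close> as a module over \<open>\<Lambda>\<^sub>B = B \<otimes>\<^sub>A \<Lambda>\<close>, the latter being \<open>tensor_product A B \<Lambda>\<close>:
  \<open>(b \<otimes> x) (b' \<otimes> p) = b b' \<otimes> x p\<close>.
\<close>

definition extend_module ::
  "('a, 'x) ring_scheme \<Rightarrow> ('a, 'b, 'y) module_scheme \<Rightarrow> ('a, 'l, 'z) module_scheme
   \<Rightarrow> ('l, 'p, 'w) module_scheme \<Rightarrow> (('b, 'l) tensor, ('b, 'p) tensor) module"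
  where "extend_module A B \<Lambda> P =
    (let P0 = restrict_scalars \<Lambda> P; G = tensor_group A B P0; t = pure_tensor A B P0 in
      with_smult (tensor_product A B P0)
        (\<lambda>S T. tensor_lift G (\<lambda>(b, x).
           tensor_lift G (\<lambda>(b', p). t (b \<otimes>\<^bsub>B\<^esub> b') (x \<odot>\<^bsub>P\<^esub> p)) T) S))"


section \<open>The comparison maps\<close>

definition Ann_module :: "('a, 'l) module \<Rightarrow> ('l, 'p, 'y) module_scheme \<Rightarrow> ('a, 'l) module"
  where "Ann_module \<Lambda> P = \<Lambda>\<lparr>carrier := annihilator \<Lambda> P\<rparr>"

definition Phi ::
  "('a, 'x) ring_scheme \<Rightarrow> ('a, 'b, 'y) module_scheme \<Rightarrow> ('a, 'l) module
   \<Rightarrow> ('b, 'l) tensor \<Rightarrow> ('b, 'l) tensor"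
  where "Phi A B \<Lambda> = tensor_lift (tensor_group A B \<Lambda>) (\<lambda>(b, x). pure_tensor A B \<Lambda> b x)"

definition Psi ::
  "('a, 'x) ring_scheme \<Rightarrow> ('a, 'b, 'y) module_scheme \<Rightarrow> ('a, 'l) module \<Rightarrow> ('l, 'p) module
   \<Rightarrow> ('b, 'p \<Rightarrow> 'p) tensor \<Rightarrow> ('b, 'p) tensor \<Rightarrow> ('b, 'p) tensor"
  where "Psi A B \<Lambda> P =
    (let P0 = restrict_scalars \<Lambda> P; PB = extend_module A B \<Lambda> P in
      tensor_lift (add_monoid (End_algebra (tensor_product A B \<Lambda>) PB))
        (\<lambda>(b, \<alpha>). \<lambda>T\<in>carrier PB.
           tensor_lift (tensor_group A B P0) (\<lambda>(b', p). pure_tensor A B P0 (b' \<otimes>\<^bsub>B\<^esub> b) (\<alpha> p)) T))"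

end

theory Submission
  imports Defs
begin

text \<open>
  Both \<open>Ann\<^sub>\<Lambda>(P)\<close> and \<open>End\<^sub>\<Lambda>(P)\<close> are the common kernel \<open>K\<close> of a set \<open>R\<close> of functionals on a module \<open>M\<close> that
  is free of finite rank over \<open>A\<close>, namely \<open>\<Lambda>\<close> and \<open>End\<^sub>A(P)\<close>, and for every \<open>B\<close> the codomain of the
  comparison map is the corresponding solution set in \<open>B \<otimes>\<^sub>A M\<close>.  It suffices to find an endomorphism
  \<open>\<gamma>\<close> of \<open>M\<close> that is a sum of maps \<open>x \<mapsto> \<phi>(x) m\<close> with \<open>\<phi> \<in> R\<close> and satisfies \<open>\<phi> \<circ> \<gamma> = \<phi>\<close> for all
  \<open>\<phi> \<in> R\<close>: then \<open>id - \<gamma>\<close> is a projection of \<open>M\<close> onto \<open>K\<close>, and it stays one after any base change.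
  The scalars \<open>a\<close> for which \<open>\<phi> \<circ> \<gamma> = a \<phi>\<close> can be solved form an ideal, so it is enough to find, for every
  maximal ideal, such an \<open>a\<close> outside of it.  This is done by Gaussian elimination, where the surjectivity over
  the field \<open>F\<close> provides the pivots.
\<close>

section \<open>Linear and balanced maps\<close>

text \<open>It is essential that \<open>\<gamma>\<close> is built from members of \<open>R\<close>
  and does not merely vanish on \<open>K\<close>: a rank one map given by \<phi> in \<open>R\<close>
  kills every common zero of \<open>R\<close> in B \<otimes> M, even one not known to come from B
  \<otimes> K. Nothing is known about generators of \<open>K\<close>, and the injectivity of B
  \<otimes> K \<rightarrow> B \<otimes> M is obtained only at the end. The hypothesis over
  \<open>F\<close> is therefore used in the form that every solution in F \<otimes> M lies in the
  image of F \<otimes> K, and the elimination carries this form along. \<open>R\<close> may be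
  infinite; what is finite is the basis of \<open>M\<close>, and the elimination runs over the basis
  elements at which some member of \<open>R\<close> is nonzero. No localization is formed: the
  factor \<open>a\<close> is a cleared denominator. For annihilators, \<open>R\<close> consists of
  the coordinates of x \<mapsto> x p; for endomorphisms, of the coordinates of \<alpha> \<mapsto>
  \<alpha>(x p) - x \<alpha>(p). The codomain of \<open>Psi\<close> is a set of maps and not a
  subset of a tensor product, so it is identified with the solutions by evaluation at the elements 1
  \<otimes> p.\<close>

definition lin :: "('a, 'x) ring_scheme \<Rightarrow> ('a, 'm, 'y) module_scheme \<Rightarrow> ('a, 'n, 'z) module_scheme
    \<Rightarrow> ('m \<Rightarrow> 'n) \<Rightarrow> bool"
  where "lin A M N f \<longleftrightarrow> f \<in> carrier M \<rightarrow> carrier N \<and>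
    (\<forall>x\<in>carrier M. \<forall>y\<in>carrier M. f (x \<oplus>\<^bsub>M\<^esub> y) = f x \<oplus>\<^bsub>N\<^esub> f y) \<and>
    (\<forall>a\<in>carrier A. \<forall>x\<in>carrier M. f (a \<odot>\<^bsub>M\<^esub> x) = a \<odot>\<^bsub>N\<^esub> f x)"

definition bilinear :: "('a, 'x) ring_scheme \<Rightarrow> ('a, 'm, 'y) module_scheme \<Rightarrow> ('a, 'n, 'z) module_scheme
    \<Rightarrow> ('a, 'l, 'w) module_scheme \<Rightarrow> ('m \<Rightarrow> 'n \<Rightarrow> 'l) \<Rightarrow> bool"
  where "bilinear A M N L \<beta> \<longleftrightarrow> (\<forall>x\<in>carrier M. lin A N L (\<beta> x)) \<and>
    (\<forall>y\<in>carrier N. lin A M L (\<lambda>x. \<beta> x y))"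

text \<open>The target only has to carry an addition, because \<open>Psi\<close> takes its values in
  an endomorphism algebra that is treated as an abelian group.\<close>

definition balanced :: "('a, 'x) ring_scheme \<Rightarrow> ('a, 'm, 'y) module_scheme \<Rightarrow> ('a, 'n, 'z) module_scheme
    \<Rightarrow> ('l, 'w) ring_scheme \<Rightarrow> ('m \<Rightarrow> 'n \<Rightarrow> 'l) \<Rightarrow> bool"
  where "balanced A M N Y \<phi> \<longleftrightarrow>
    (\<forall>x\<in>carrier M. \<forall>y\<in>carrier N. \<phi> x y \<in> carrier Y) \<and>
    (\<forall>x\<in>carrier M. \<forall>x'\<in>carrier M. \<forall>y\<in>carrier N. \<phi> (x \<oplus>\<^bsub>M\<^esub> x') y = \<phi> x y \<oplus>\<^bsub>Y\<^esub> \<phi> x' y) \<and>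
    (\<forall>x\<in>carrier M. \<forall>y\<in>carrier N. \<forall>y'\<in>carrier N. \<phi> x (y \<oplus>\<^bsub>N\<^esub> y') = \<phi> x y \<oplus>\<^bsub>Y\<^esub> \<phi> x y') \<and>
    (\<forall>a\<in>carrier A. \<forall>x\<in>carrier M. \<forall>y\<in>carrier N. \<phi> (a \<odot>\<^bsub>M\<^esub> x) y = \<phi> x (a \<odot>\<^bsub>N\<^esub> y))"

text \<open>Lets a functional on \<open>M\<close> be an instance of \<open>lin\<close>, so that
  functionals need no lemmas of their own.\<close>

definition self_module :: "('a, 'x) ring_scheme \<Rightarrow> ('a, 'a) module"
  where "self_module A = with_smult A (monoid.mult A)"

lemma self_module_simps [simp]:
  "carrier (self_module A) = carrier A" "ring.zero (self_module A) = ring.zero A"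
  "ring.add (self_module A) = ring.add A" "smult (self_module A) = monoid.mult A"
  "monoid.mult (self_module A) = monoid.mult A" "monoid.one (self_module A) = monoid.one A"
  by (simp_all add: self_module_def with_smult_def)

lemma linI:
  assumes "\<And>x. x \<in> carrier M \<Longrightarrow> f x \<in> carrier N"
    and "\<And>x y. \<lbrakk>x \<in> carrier M; y \<in> carrier M\<rbrakk> \<Longrightarrow> f (x \<oplus>\<^bsub>M\<^esub> y) = f x \<oplus>\<^bsub>N\<^esub> f y"
    and "\<And>a x. \<lbrakk>a \<in> carrier A; x \<in> carrier M\<rbrakk> \<Longrightarrow> f (a \<odot>\<^bsub>M\<^esub> x) = a \<odot>\<^bsub>N\<^esub> f x"
  shows "lin A M N f"
  using assms by (simp add: lin_def)

lemma linD:
  assumes "lin A M N f"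
  shows lin_closed: "x \<in> carrier M \<Longrightarrow> f x \<in> carrier N"
    and lin_add: "\<lbrakk>x \<in> carrier M; y \<in> carrier M\<rbrakk> \<Longrightarrow> f (x \<oplus>\<^bsub>M\<^esub> y) = f x \<oplus>\<^bsub>N\<^esub> f y"
    and lin_smult: "\<lbrakk>a \<in> carrier A; x \<in> carrier M\<rbrakk> \<Longrightarrow> f (a \<odot>\<^bsub>M\<^esub> x) = a \<odot>\<^bsub>N\<^esub> f x"
  using assms by (auto simp: lin_def)

lemma add_zero:
  assumes "abelian_group M" "abelian_group N" "f \<in> carrier M \<rightarrow> carrier N"
    and "\<And>x y. \<lbrakk>x \<in> carrier M; y \<in> carrier M\<rbrakk> \<Longrightarrow> f (x \<oplus>\<^bsub>M\<^esub> y) = f x \<oplus>\<^bsub>N\<^esub> f y"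
  shows "f \<zero>\<^bsub>M\<^esub> = \<zero>\<^bsub>N\<^esub>"
proof -
  interpret M: abelian_group M by fact
  interpret N: abelian_group N by fact
  have c: "f \<zero>\<^bsub>M\<^esub> \<in> carrier N" using assms(3) M.zero_closed by blast
  have "f \<zero>\<^bsub>M\<^esub> \<oplus>\<^bsub>N\<^esub> f \<zero>\<^bsub>M\<^esub> = f \<zero>\<^bsub>M\<^esub>"
    using assms(4)[OF M.zero_closed M.zero_closed] by simp
  then show ?thesis using c by (metis N.add.l_cancel_one')
qed

lemma lin_zero:
  assumes "lin A M N f" "module A M" "module A N"
  shows "f \<zero>\<^bsub>M\<^esub> = \<zero>\<^bsub>N\<^esub>"
  using assms by (intro add_zero) (auto simp: lin_def module_def)

lemma lin_neg:
  assumes "lin A M N f" "module A M" "module A N" "x \<in> carrier M"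
  shows "f (\<ominus>\<^bsub>M\<^esub> x) = \<ominus>\<^bsub>N\<^esub> f x"
proof -
  interpret M: module A M by fact
  interpret N: module A N by fact
  have "f (\<ominus>\<^bsub>M\<^esub> x) \<oplus>\<^bsub>N\<^esub> f x = \<zero>\<^bsub>N\<^esub>"
    using assms lin_add[OF assms(1), of "\<ominus>\<^bsub>M\<^esub> x" x] by (simp add: M.M.l_neg lin_zero[OF assms(1-3)])
  then show ?thesis
    using assms lin_closed[OF assms(1)] by (metis M.M.a_inv_closed N.M.minus_equality)
qed

lemma lin_minus:
  assumes "lin A M N f" "module A M" "module A N" "x \<in> carrier M" "y \<in> carrier M"
  shows "f (x \<ominus>\<^bsub>M\<^esub> y) = f x \<ominus>\<^bsub>N\<^esub> f y"
proof -
  interpret M: module A M by fact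
  show ?thesis using assms by (simp add: a_minus_def lin_add[OF assms(1)] lin_neg[OF assms(1-3)])
qed

lemma lin_compose:
  assumes "lin A M N f" "lin A N L g"
  shows "lin A M L (\<lambda>x. g (f x))"
  by (rule linI) (simp_all add: linD[OF assms(1)] linD[OF assms(2)])

lemma lin_cong:
  assumes "lin A M N f" "\<And>x. x \<in> carrier M \<Longrightarrow> g x = f x" "module A M"
  shows "lin A M N g"
proof -
  interpret M: module A M by fact
  show ?thesis using assms(1,2) by (auto simp: lin_def)
qed

lemma lin_id: "lin A M M (\<lambda>x. x)"
  by (auto simp: lin_def)

lemma lin_const_zero:
  assumes "module A N" shows "lin A M N (\<lambda>x. \<zero>\<^bsub>N\<^esub>)"
proof -
  interpret N: module A N by fact
  show ?thesis by (auto simp: lin_def)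
qed

lemma lin_plus:
  assumes "module A N" "lin A M N f" "lin A M N g"
  shows "lin A M N (\<lambda>x. f x \<oplus>\<^bsub>N\<^esub> g x)"
proof -
  interpret N: module A N by fact
  note [simp] = linD[OF assms(2)] linD[OF assms(3)]
  show ?thesis by (rule linI) (simp_all add: N.M.a_ac N.smult_r_distr)
qed

lemma lin_scale:
  assumes "module A N" "lin A M N f" "a \<in> carrier A"
  shows "lin A M N (\<lambda>x. a \<odot>\<^bsub>N\<^esub> f x)"
proof -
  interpret N: module A N by fact
  note [simp] = linD[OF assms(2)] assms(3)
  show ?thesis
    by (rule linI) (simp_all add: N.smult_r_distr N.smult_assoc1[symmetric] N.R.m_comm)
qed

lemma lin_uminus:
  assumes "module A N" "lin A M N f"
  shows "lin A M N (\<lambda>x. \<ominus>\<^bsub>N\<^esub> f x)"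
proof -
  interpret N: module A N by fact
  note [simp] = linD[OF assms(2)]
  show ?thesis by (rule linI) (simp_all add: N.M.minus_add N.M.a_comm N.smult_r_minus)
qed

lemma lin_diff:
  assumes "module A N" "lin A M N f" "lin A M N g"
  shows "lin A M N (\<lambda>x. f x \<ominus>\<^bsub>N\<^esub> g x)"
  unfolding a_minus_def by (intro lin_plus lin_uminus assms)

lemma lin_times:
  assumes "module A N" "lin A M (self_module A) \<phi>" "n \<in> carrier N"
  shows "lin A M N (\<lambda>x. \<phi> x \<odot>\<^bsub>N\<^esub> n)"
proof -
  interpret N: module A N by fact
  note [simp] = linD[OF assms(2), simplified] assms(3)
  show ?thesis by (rule linI) (simp_all add: N.smult_l_distr N.smult_assoc1)
qed

lemma module_self:
  assumes "cring A" shows "module A (self_module A)"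
proof -
  interpret A: cring A by fact
  have "abelian_group (self_module A)"
    by (rule abelian_groupI) (auto simp: A.a_ac intro: A.add.l_inv_ex)
  then show ?thesis
    by (intro moduleI) (auto simp: A.l_distr A.r_distr A.m_assoc A.is_cring)
qed

lemma bilinearD:
  assumes "bilinear A M N L \<beta>"
  shows bilinear_right: "x \<in> carrier M \<Longrightarrow> lin A N L (\<beta> x)"
    and bilinear_left: "y \<in> carrier N \<Longrightarrow> lin A M L (\<lambda>x. \<beta> x y)"
    and bilinear_closed: "\<lbrakk>x \<in> carrier M; y \<in> carrier N\<rbrakk> \<Longrightarrow> \<beta> x y \<in> carrier L"
    and bilinear_add_left: "\<lbrakk>x \<in> carrier M; x' \<in> carrier M; y \<in> carrier N\<rbrakk>
      \<Longrightarrow> \<beta> (x \<oplus>\<^bsub>M\<^esub> x') y = \<beta> x y \<oplus>\<^bsub>L\<^esub> \<beta> x' y"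
    and bilinear_add_right: "\<lbrakk>x \<in> carrier M; y \<in> carrier N; y' \<in> carrier N\<rbrakk>
      \<Longrightarrow> \<beta> x (y \<oplus>\<^bsub>N\<^esub> y') = \<beta> x y \<oplus>\<^bsub>L\<^esub> \<beta> x y'"
    and bilinear_smult_left: "\<lbrakk>a \<in> carrier A; x \<in> carrier M; y \<in> carrier N\<rbrakk>
      \<Longrightarrow> \<beta> (a \<odot>\<^bsub>M\<^esub> x) y = a \<odot>\<^bsub>L\<^esub> \<beta> x y"
    and bilinear_smult_right: "\<lbrakk>a \<in> carrier A; x \<in> carrier M; y \<in> carrier N\<rbrakk>
      \<Longrightarrow> \<beta> x (a \<odot>\<^bsub>N\<^esub> y) = a \<odot>\<^bsub>L\<^esub> \<beta> x y"
  using assms by (auto simp: bilinear_def lin_def)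

lemma bilinear_balanced: "bilinear A M N L \<beta> \<Longrightarrow> balanced A M N L \<beta>"
  by (simp add: balanced_def bilinearD)


section \<open>Tensor products as modules\<close>

text \<open>Products and integer powers depend only on the carrier, the product and the unit of a
  group. This permits passing between the multiplicative \<open>tensor_group\<close> and the
  additive group of \<open>tensor_product\<close>, which are different records.\<close>

lemma tensor_lift_group_cong:
  fixes \<phi> :: "'m \<times> 'n \<Rightarrow> 'g" and G :: "('g, 'x) monoid_scheme" and H :: "('g, 'y) monoid_scheme"
  assumes "carrier G = carrier H" "monoid.mult G = monoid.mult H" "monoid.one G = monoid.one H"
  shows "tensor_lift G \<phi> = tensor_lift H \<phi>"
proof -
  have inv: "m_inv G = m_inv H" by (intro ext) (simp add: m_inv_def assms)
  have npow: "x [^]\<^bsub>G\<^esub> n = x [^]\<^bsub>H\<^esub> n" for x and n :: nat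
    by (simp add: nat_pow_def assms)
  have pow: "x [^]\<^bsub>G\<^esub> n = x [^]\<^bsub>H\<^esub> n" for x and n :: int
    unfolding int_pow_def2 npow inv by (rule refl)
  have "finprod G f K = finprod H f K" for f and K :: "('m \<times> 'n) set"
    by (simp add: finprod_def assms)
  then show ?thesis by (intro ext) (simp add: tensor_lift_def pow)
qed

lemma tensor_product_group:
  "carrier (tensor_product A M N) = carrier (tensor_group A M N)"
  "ring.add (tensor_product A M N) = monoid.mult (tensor_group A M N)"
  "ring.zero (tensor_product A M N) = monoid.one (tensor_group A M N)"
  by (simp_all add: tensor_product_def Let_def)

lemma tensor_lift_add_monoid:
  "tensor_lift (tensor_group A M N) \<phi> = tensor_lift (add_monoid (tensor_product A M N)) \<phi>"
  by (rule tensor_lift_group_cong) (simp_all add: tensor_product_group)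

context
  fixes A :: "('a, 'x) ring_scheme" and M :: "('a, 'm, 'y) module_scheme"
    and N :: "('a, 'n, 'z) module_scheme"
  assumes M: "module A M" and N: "module A N"
begin

interpretation M: module A M by (rule M)
interpretation N: module A N by (rule N)

lemma tensor_relations_subset:
  "tensor_relations A M N \<subseteq> carrier (free_Abelian_group (carrier M \<times> carrier N))"
  by (auto simp: tensor_relations_def dest!: subsetD[OF keys_diff])

lemma tensor_kernel_normal:
  "tensor_kernel A M N \<lhd> free_Abelian_group (carrier M \<times> carrier N)"
proof -
  interpret F: comm_group "free_Abelian_group (carrier M \<times> carrier N)"
    by (rule abelian_free_Abelian_group)
  show ?thesis
    unfolding tensor_kernel_def
    by (intro F.subgroup_imp_normal F.generate_is_subgroup tensor_relations_subset)
qed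

lemma tensor_abelian_group: "abelian_group (tensor_product A M N)"
proof -
  interpret F: comm_group "free_Abelian_group (carrier M \<times> carrier N)"
    by (rule abelian_free_Abelian_group)
  have "comm_group (tensor_group A M N)"
    unfolding tensor_group_def
    by (rule F.abelian_FactGroup) (rule normal_imp_subgroup[OF tensor_kernel_normal])
  then interpret G: comm_group "tensor_group A M N" .
  show ?thesis
    by (rule abelian_groupI)
      (auto simp: tensor_product_group G.m_ac intro: G.l_inv_ex)
qed

lemma tensor_coset_mult:
  fixes c d
  defines "cl \<equiv> \<lambda>c. tensor_kernel A M N #>\<^bsub>free_Abelian_group (carrier M \<times> carrier N)\<^esub> c"
  assumes "c \<in> carrier (free_Abelian_group (carrier M \<times> carrier N))"
    "d \<in> carrier (free_Abelian_group (carrier M \<times> carrier N))"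
  shows "cl (c + d) = cl c \<oplus>\<^bsub>tensor_product A M N\<^esub> cl d"
  using normal.rcos_sum[OF tensor_kernel_normal assms(2,3)]
  by (simp add: tensor_product_def Let_def tensor_group_def FactGroup_def cl_def)

lemma tensor_coset_relation:
  fixes c d
  defines "cl \<equiv> \<lambda>c. tensor_kernel A M N #>\<^bsub>free_Abelian_group (carrier M \<times> carrier N)\<^esub> c"
  assumes "c \<in> carrier (free_Abelian_group (carrier M \<times> carrier N))"
    "d \<in> carrier (free_Abelian_group (carrier M \<times> carrier N))"
    and "c - d \<in> tensor_relations A M N"
  shows "cl c = cl d"
proof -
  interpret F: comm_group "free_Abelian_group (carrier M \<times> carrier N)"
    by (rule abelian_free_Abelian_group)
  have s: "subgroup (tensor_kernel A M N) (free_Abelian_group (carrier M \<times> carrier N))"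
    by (rule normal_imp_subgroup[OF tensor_kernel_normal])
  have "c - d \<in> tensor_kernel A M N"
    unfolding tensor_kernel_def using assms(4) by (rule generate.incl)
  then have "c \<in> cl d"
    unfolding cl_def r_coset_def by (auto intro!: bexI[of _ "c - d"])
  then show ?thesis
    unfolding cl_def by (rule F.repr_independence[OF _ assms(3) s, symmetric])
qed

lemma pure_closed [intro]:
  "\<lbrakk>x \<in> carrier M; y \<in> carrier N\<rbrakk> \<Longrightarrow> pure_tensor A M N x y \<in> carrier (tensor_product A M N)"
  by (auto simp: tensor_product_def Let_def tensor_group_def FactGroup_def RCOSETS_def pure_tensor_def)

lemma pure_add_left:
  assumes "x \<in> carrier M" "x' \<in> carrier M" "y \<in> carrier N"
  shows "pure_tensor A M N (x \<oplus>\<^bsub>M\<^esub> x') y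
    = pure_tensor A M N x y \<oplus>\<^bsub>tensor_product A M N\<^esub> pure_tensor A M N x' y"
proof -
  have "frag_of (x \<oplus>\<^bsub>M\<^esub> x', y) - (frag_of (x, y) + frag_of (x', y)) \<in> tensor_relations A M N"
    unfolding diff_diff_eq[symmetric] tensor_relations_def using assms by blast
  moreover have "frag_of (x, y) + frag_of (x', y) \<in> carrier (free_Abelian_group (carrier M \<times> carrier N))"
    using assms by (auto dest!: subsetD[OF Poly_Mapping.keys_add])
  ultimately show ?thesis
    using assms unfolding pure_tensor_def
    by (subst tensor_coset_mult[symmetric]) (simp, simp, intro tensor_coset_relation, simp_all)
qed

lemma pure_add_right:
  assumes "x \<in> carrier M" "y \<in> carrier N" "y' \<in> carrier N"
  shows "pure_tensor A M N x (y \<oplus>\<^bsub>N\<^esub> y')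
    = pure_tensor A M N x y \<oplus>\<^bsub>tensor_product A M N\<^esub> pure_tensor A M N x y'"
proof -
  have "frag_of (x, y \<oplus>\<^bsub>N\<^esub> y') - (frag_of (x, y) + frag_of (x, y')) \<in> tensor_relations A M N"
    unfolding diff_diff_eq[symmetric] tensor_relations_def using assms by blast
  moreover have "frag_of (x, y) + frag_of (x, y') \<in> carrier (free_Abelian_group (carrier M \<times> carrier N))"
    using assms by (auto dest!: subsetD[OF Poly_Mapping.keys_add])
  ultimately show ?thesis
    using assms unfolding pure_tensor_def
    by (subst tensor_coset_mult[symmetric]) (simp, simp, intro tensor_coset_relation, simp_all)
qed

lemma pure_balanced:
  assumes "a \<in> carrier A" "x \<in> carrier M" "y \<in> carrier N"
  shows "pure_tensor A M N (a \<odot>\<^bsub>M\<^esub> x) y = pure_tensor A M N x (a \<odot>\<^bsub>N\<^esub> y)"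
proof -
  have "frag_of (a \<odot>\<^bsub>M\<^esub> x, y) - frag_of (x, a \<odot>\<^bsub>N\<^esub> y) \<in> tensor_relations A M N"
    unfolding tensor_relations_def using assms by blast
  then show ?thesis
    using assms unfolding pure_tensor_def by (intro tensor_coset_relation) simp_all
qed

text \<open>A tensor is the class of an integer combination of pairs, and -(x \<otimes> y) = (-x)
  \<otimes> y turns this into a sum of pure tensors; hence there is no case for negatives.\<close>

lemma tensor_induct [consumes 1, case_names zero add]:
  assumes T: "T \<in> carrier (tensor_product A M N)"
    and zero: "Q \<zero>\<^bsub>tensor_product A M N\<^esub>"
    and add: "\<And>x y T. \<lbrakk>x \<in> carrier M; y \<in> carrier N; T \<in> carrier (tensor_product A M N); Q T\<rbrakk>
      \<Longrightarrow> Q (pure_tensor A M N x y \<oplus>\<^bsub>tensor_product A M N\<^esub> T)"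
  shows "Q T"
proof -
  let ?F = "free_Abelian_group (carrier M \<times> carrier N)"
  let ?T = "tensor_product A M N"
  let ?cl = "\<lambda>c. tensor_kernel A M N #>\<^bsub>?F\<^esub> c"
  interpret T: abelian_group ?T by (rule tensor_abelian_group)
  have neg: "\<ominus>\<^bsub>?T\<^esub> pure_tensor A M N x y = pure_tensor A M N (\<ominus>\<^bsub>M\<^esub> x) y"
    if "x \<in> carrier M" "y \<in> carrier N" for x y
  proof -
    have "pure_tensor A M N \<zero>\<^bsub>M\<^esub> y = \<zero>\<^bsub>?T\<^esub>"
      by (rule add_zero) (use that in \<open>auto simp: M.M.abelian_group_axioms T.abelian_group_axioms pure_add_left\<close>)
    then have "pure_tensor A M N (\<ominus>\<^bsub>M\<^esub> x) y \<oplus>\<^bsub>?T\<^esub> pure_tensor A M N x y = \<zero>\<^bsub>?T\<^esub>"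
      using that by (simp add: pure_add_left[symmetric] M.M.l_neg)
    then show ?thesis using that by (intro T.minus_equality) (simp_all add: pure_closed)
  qed
  have cl: "?cl c \<in> carrier ?T" if "c \<in> carrier ?F" for c
    unfolding tensor_product_group tensor_group_def FactGroup_def partial_object.simps RCOSETS_def
    using that by (intro UN_I[of c]) simp_all
  \<comment> \<open>Induction on formal sums passes through differences, for which \<open>Q\<close>
    of a single class is too weak. What is preserved by differences is that adding or subtracting
    the class respects \<open>Q\<close>.\<close>
  have *: "(\<forall>S\<in>carrier ?T. Q S \<longrightarrow> Q (?cl c \<oplus>\<^bsub>?T\<^esub> S) \<and> Q (\<ominus>\<^bsub>?T\<^esub> ?cl c \<oplus>\<^bsub>?T\<^esub> S))"
    if "Poly_Mapping.keys c \<subseteq> carrier M \<times> carrier N" for c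
    using that
  proof (induction c rule: free_Abelian_group_induct[consumes 1])
    case 1
    have "?cl 0 \<oplus>\<^bsub>?T\<^esub> ?cl 0 = ?cl 0"
      using tensor_coset_mult[of 0 0] by simp
    then have z: "?cl 0 = \<zero>\<^bsub>?T\<^esub>" using cl[of 0] by (simp add: T.add.l_cancel_one')
    have n: "\<ominus>\<^bsub>?T\<^esub> \<zero>\<^bsub>?T\<^esub> = \<zero>\<^bsub>?T\<^esub>" by (rule T.minus_equality) simp_all
    show ?case unfolding z n by simp
  next
    case (2 x y)
    then have xy: "x \<in> carrier ?F" "y \<in> carrier ?F" and xy': "x - y \<in> carrier ?F"
      using keys_diff[of x y] by auto
    note [simp] = cl[OF xy(1)] cl[OF xy(2)] cl[OF xy']
    have "?cl x = ?cl (x - y) \<oplus>\<^bsub>?T\<^esub> ?cl y"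
      using tensor_coset_mult[OF xy' xy(2)] by simp
    then have e: "?cl (x - y) = ?cl x \<oplus>\<^bsub>?T\<^esub> \<ominus>\<^bsub>?T\<^esub> ?cl y"
      by (simp add: T.a_assoc T.r_neg)
    show ?case
    proof (intro ballI impI conjI)
      fix S assume S: "S \<in> carrier ?T" "Q S"
      have *: "Q (\<ominus>\<^bsub>?T\<^esub> ?cl y \<oplus>\<^bsub>?T\<^esub> S)" "Q (?cl y \<oplus>\<^bsub>?T\<^esub> S)"
        using 2(4) S by blast+
      have "Q (?cl x \<oplus>\<^bsub>?T\<^esub> (\<ominus>\<^bsub>?T\<^esub> ?cl y \<oplus>\<^bsub>?T\<^esub> S))"
        using 2(3) S *(1) by simp
      then show "Q (?cl (x - y) \<oplus>\<^bsub>?T\<^esub> S)"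
        unfolding e using S by (simp add: T.a_assoc)
      have "Q (\<ominus>\<^bsub>?T\<^esub> ?cl x \<oplus>\<^bsub>?T\<^esub> (?cl y \<oplus>\<^bsub>?T\<^esub> S))"
        using 2(3) S *(2) by simp
      then show "Q (\<ominus>\<^bsub>?T\<^esub> ?cl (x - y) \<oplus>\<^bsub>?T\<^esub> S)"
        unfolding e using S by (simp add: T.a_assoc T.minus_add)
    qed
  next
    case (3 xy)
    obtain x y where xy: "xy = (x, y)" "x \<in> carrier M" "y \<in> carrier N" using 3 by auto
    have e: "?cl (frag_of xy) = pure_tensor A M N x y" by (simp add: xy pure_tensor_def)
    show ?case unfolding e using xy add[of x y] add[of "\<ominus>\<^bsub>M\<^esub> x" y] by (simp add: neg)
  qed
  obtain c where c: "c \<in> carrier ?F" "T = ?cl c"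
    using T unfolding tensor_product_group tensor_group_def FactGroup_def partial_object.simps RCOSETS_def
    by (elim UN_E singletonE)
  have "Q (T \<oplus>\<^bsub>?T\<^esub> \<zero>\<^bsub>?T\<^esub>)" unfolding c(2) using *[OF c(1)[simplified]] zero by simp
  with T show ?thesis by simp
qed

lemma tlift:
  assumes Y: "abelian_group Y" and \<phi>: "balanced A M N Y \<phi>"
  shows tlift_closed: "T \<in> carrier (tensor_product A M N) \<Longrightarrow>
      tensor_lift (add_monoid Y) (case_prod \<phi>) T \<in> carrier Y"
    and tlift_add: "\<lbrakk>S \<in> carrier (tensor_product A M N); T \<in> carrier (tensor_product A M N)\<rbrakk> \<Longrightarrow>
      tensor_lift (add_monoid Y) (case_prod \<phi>) (S \<oplus>\<^bsub>tensor_product A M N\<^esub> T)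
      = tensor_lift (add_monoid Y) (case_prod \<phi>) S \<oplus>\<^bsub>Y\<^esub> tensor_lift (add_monoid Y) (case_prod \<phi>) T"
    and tlift_pure: "\<lbrakk>x \<in> carrier M; y \<in> carrier N\<rbrakk> \<Longrightarrow>
      tensor_lift (add_monoid Y) (case_prod \<phi>) (pure_tensor A M N x y) = \<phi> x y"
    and tlift_zero: "tensor_lift (add_monoid Y) (case_prod \<phi>) \<zero>\<^bsub>tensor_product A M N\<^esub> = \<zero>\<^bsub>Y\<^esub>"
proof -
  let ?f = "tensor_lift (add_monoid Y) (case_prod \<phi>)"
  have G: "comm_group (add_monoid Y)" using Y by (simp add: abelian_group.a_comm_group)
  note \<phi>' = \<phi>[unfolded balanced_def]
  have hom: "?f \<in> hom (tensor_group A M N) (add_monoid Y)"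
    by (rule tensor_lift_hom[OF M N G]) (use \<phi>' in auto)
  show closed: "T \<in> carrier (tensor_product A M N) \<Longrightarrow> ?f T \<in> carrier Y" for T
    using hom by (auto simp: hom_def tensor_product_group)
  show add: "\<lbrakk>S \<in> carrier (tensor_product A M N); T \<in> carrier (tensor_product A M N)\<rbrakk> \<Longrightarrow>
      ?f (S \<oplus>\<^bsub>tensor_product A M N\<^esub> T) = ?f S \<oplus>\<^bsub>Y\<^esub> ?f T" for S T
    using hom by (auto simp: hom_def tensor_product_group)
  show "\<lbrakk>x \<in> carrier M; y \<in> carrier N\<rbrakk> \<Longrightarrow> ?f (pure_tensor A M N x y) = \<phi> x y" for x y
    using tensor_lift_pure_tensor[OF M N G, of "case_prod \<phi>"] \<phi>' by auto
  show "?f \<zero>\<^bsub>tensor_product A M N\<^esub> = \<zero>\<^bsub>Y\<^esub>"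
    by (rule add_zero[OF tensor_abelian_group Y]) (use closed add in auto)
qed

lemma tensor_smult:
  "a \<odot>\<^bsub>tensor_product A M N\<^esub> T =
    tensor_lift (add_monoid (tensor_product A M N)) (\<lambda>(x, y). pure_tensor A M N (a \<odot>\<^bsub>M\<^esub> x) y) T"
  by (subst tensor_lift_add_monoid[symmetric]) (simp add: tensor_product_def Let_def)

lemma smult_balanced:
  assumes "a \<in> carrier A"
  shows "balanced A M N (tensor_product A M N) (\<lambda>x y. pure_tensor A M N (a \<odot>\<^bsub>M\<^esub> x) y)"
  unfolding balanced_def
  using assms
  by (auto simp: pure_add_left pure_add_right pure_balanced[symmetric] M.smult_r_distr
      M.smult_assoc1[symmetric] M.R.m_comm)

lemma tensor_smult_pure:
  assumes "a \<in> carrier A" "x \<in> carrier M" "y \<in> carrier N"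
  shows "a \<odot>\<^bsub>tensor_product A M N\<^esub> pure_tensor A M N x y = pure_tensor A M N (a \<odot>\<^bsub>M\<^esub> x) y"
  unfolding tensor_smult
  by (rule tlift_pure[OF tensor_abelian_group smult_balanced]) (use assms in auto)

lemma tensor_module: "module A (tensor_product A M N)"
proof -
  let ?T = "tensor_product A M N"
  interpret T: abelian_group ?T by (rule tensor_abelian_group)
  note l = tlift[OF tensor_abelian_group smult_balanced, folded tensor_smult]
  show ?thesis
  proof (rule moduleI)
    show "cring A" by (rule M.R.is_cring)
    show "abelian_group ?T" by (rule tensor_abelian_group)
    show "a \<odot>\<^bsub>?T\<^esub> T \<in> carrier ?T" if "a \<in> carrier A" "T \<in> carrier ?T" for a T
      using that by (rule l)
    show "a \<odot>\<^bsub>?T\<^esub> (S \<oplus>\<^bsub>?T\<^esub> T) = a \<odot>\<^bsub>?T\<^esub> S \<oplus>\<^bsub>?T\<^esub> a \<odot>\<^bsub>?T\<^esub> T"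
      if "a \<in> carrier A" "S \<in> carrier ?T" "T \<in> carrier ?T" for a S T
      using that by (rule l)
    show "(a \<oplus>\<^bsub>A\<^esub> b) \<odot>\<^bsub>?T\<^esub> T = a \<odot>\<^bsub>?T\<^esub> T \<oplus>\<^bsub>?T\<^esub> b \<odot>\<^bsub>?T\<^esub> T"
      if ab: "a \<in> carrier A" "b \<in> carrier A" and "T \<in> carrier ?T" for a b T
      using that(3)
    proof (induction rule: tensor_induct)
      case zero then show ?case using ab by (simp add: l)
    next
      case (add x y T)
      then have "pure_tensor A M N x y \<in> carrier ?T" by auto
      with add ab show ?case
        by (simp add: l tensor_smult_pure M.smult_l_distr pure_add_left pure_closed T.a_ac)
    qed
    show "(a \<otimes>\<^bsub>A\<^esub> b) \<odot>\<^bsub>?T\<^esub> T = a \<odot>\<^bsub>?T\<^esub> (b \<odot>\<^bsub>?T\<^esub> T)"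
      if ab: "a \<in> carrier A" "b \<in> carrier A" and "T \<in> carrier ?T" for a b T
      using that(3)
      by (induction rule: tensor_induct)
        (use ab in \<open>simp_all add: l tensor_smult_pure M.smult_assoc1 pure_closed\<close>)
    show "\<one>\<^bsub>A\<^esub> \<odot>\<^bsub>?T\<^esub> T = T" if "T \<in> carrier ?T" for T
      using that
      by (induction rule: tensor_induct) (simp_all add: l tensor_smult_pure pure_closed)
  qed
qed

lemma pure_bilinear: "bilinear A M N (tensor_product A M N) (pure_tensor A M N)"
  unfolding bilinear_def lin_def
  by (auto simp: pure_add_left pure_add_right tensor_smult_pure pure_balanced)

text \<open>Additivity suffices because pure tensors generate the group. The scalar-free form serves
  the comparison of two maps into the endomorphisms of \<open>PB\<close>.\<close>

lemma tensor_hom_eq: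
  assumes "abelian_group Y"
    and "\<And>T. T \<in> carrier (tensor_product A M N) \<Longrightarrow> f T \<in> carrier Y"
    and "\<And>S T. \<lbrakk>S \<in> carrier (tensor_product A M N); T \<in> carrier (tensor_product A M N)\<rbrakk> \<Longrightarrow>
      f (S \<oplus>\<^bsub>tensor_product A M N\<^esub> T) = f S \<oplus>\<^bsub>Y\<^esub> f T"
    and "\<And>T. T \<in> carrier (tensor_product A M N) \<Longrightarrow> g T \<in> carrier Y"
    and "\<And>S T. \<lbrakk>S \<in> carrier (tensor_product A M N); T \<in> carrier (tensor_product A M N)\<rbrakk> \<Longrightarrow>
      g (S \<oplus>\<^bsub>tensor_product A M N\<^esub> T) = g S \<oplus>\<^bsub>Y\<^esub> g T"
    and "\<And>x y. \<lbrakk>x \<in> carrier M; y \<in> carrier N\<rbrakk> \<Longrightarrow>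
      f (pure_tensor A M N x y) = g (pure_tensor A M N x y)"
    and "T \<in> carrier (tensor_product A M N)"
  shows "f T = g T"
  using assms(7)
proof (induction rule: tensor_induct)
  case zero
  have "f \<zero>\<^bsub>tensor_product A M N\<^esub> = \<zero>\<^bsub>Y\<^esub>" "g \<zero>\<^bsub>tensor_product A M N\<^esub> = \<zero>\<^bsub>Y\<^esub>"
    using assms by (auto intro!: add_zero tensor_abelian_group)
  then show ?case by simp
next
  case (add x y T)
  then show ?case by (simp add: assms(3,5,6) pure_closed)
qed

lemma tlift_lin:
  assumes Y: "module A Y" and \<phi>: "bilinear A M N Y \<phi>"
  shows "lin A (tensor_product A M N) Y (tensor_lift (add_monoid Y) (case_prod \<phi>))"
proof -
  let ?T = "tensor_product A M N"
  interpret Y: module A Y by fact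
  interpret T: module A ?T by (rule tensor_module)
  define L where "L = tensor_lift (add_monoid Y) (case_prod \<phi>)"
  note l = tlift[OF Y.abelian_group_axioms bilinear_balanced[OF \<phi>], folded L_def]
  have "lin A ?T Y L"
  proof (rule linI)
    fix a T assume a: "a \<in> carrier A" and "T \<in> carrier ?T"
    from this(2) show "L (a \<odot>\<^bsub>?T\<^esub> T) = a \<odot>\<^bsub>Y\<^esub> L T"
    proof (induction rule: tensor_induct)
      case zero then show ?case using a by (simp add: l)
    next
      case (add x y T)
      then have p: "pure_tensor A M N x y \<in> carrier ?T" "pure_tensor A M N (a \<odot>\<^bsub>M\<^esub> x) y \<in> carrier ?T"
        using a by auto
      show ?case using add a p
        by (simp add: l T.smult_r_distr Y.smult_r_distr tensor_smult_pure
            bilinear_smult_left[OF \<phi>] bilinear_closed[OF \<phi>])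
    qed
  qed (simp_all add: l)
  then show ?thesis by (simp add: L_def)
qed

end


section \<open>Functoriality of the tensor product\<close>

text \<open>\<open>id \<otimes> f\<close> on \<open>B \<otimes>\<^sub>A M\<close>, with values in \<open>B \<otimes>\<^sub>A N\<close>.\<close>

definition tmap where
  "tmap A B N f = tensor_lift (add_monoid (tensor_product A B N)) (\<lambda>(b, x). pure_tensor A B N b (f x))"

text \<open>The map \<open>B \<otimes>\<^sub>A M \<rightarrow> B\<close> obtained from a functional \<open>M \<rightarrow> A\<close>.\<close>

definition teval where
  "teval B \<phi> = tensor_lift (add_monoid B) (\<lambda>(b, x). \<phi> x \<odot>\<^bsub>B\<^esub> b)"

lemma tensor_lin_eq:
  assumes "module A M" "module A N" "module A Y"
    and f: "lin A (tensor_product A M N) Y f" and g: "lin A (tensor_product A M N) Y g"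
    and "\<And>x y. \<lbrakk>x \<in> carrier M; y \<in> carrier N\<rbrakk> \<Longrightarrow>
      f (pure_tensor A M N x y) = g (pure_tensor A M N x y)"
    and "T \<in> carrier (tensor_product A M N)"
  shows "f T = g T"
  using assms(1-3)
  by (intro tensor_hom_eq[where f = f and g = g and Y = Y and T = T, OF assms(1,2)] linD[OF f] linD[OF g] assms(6,7))
    (auto simp: module_def)

context
  fixes A :: "('a, 'x) ring_scheme" and B :: "('a, 'b, 'y) module_scheme"
    and M :: "('a, 'm, 'z) module_scheme"
  assumes B: "module A B" and M: "module A M"
begin

interpretation B: module A B by (rule B)
interpretation M: module A M by (rule M)

lemma tmap_bilinear:
  assumes N: "module A N" and f: "lin A M N f"
  shows "bilinear A B M (tensor_product A B N) (\<lambda>b x. pure_tensor A B N b (f x))"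
  by (simp add: bilinear_def lin_def linD[OF f] bilinearD[OF pure_bilinear[OF B N]])

lemma teval_bilinear:
  assumes f: "lin A M (self_module A) \<phi>"
  shows "bilinear A B M B (\<lambda>b x. \<phi> x \<odot>\<^bsub>B\<^esub> b)"
  using linD[OF f]
  by (simp add: bilinear_def lin_def B.smult_l_distr B.smult_r_distr B.smult_assoc1[symmetric] B.R.m_comm)

lemma tmap_lin:
  assumes N: "module A N" and f: "lin A M N f"
  shows "lin A (tensor_product A B M) (tensor_product A B N) (tmap A B N f)"
  unfolding tmap_def by (rule tlift_lin[OF B M tensor_module[OF B N] tmap_bilinear[OF assms]])

lemma tmap_pure:
  assumes N: "module A N" and f: "lin A M N f" and "b \<in> carrier B" "x \<in> carrier M"
  shows "tmap A B N f (pure_tensor A B M b x) = pure_tensor A B N b (f x)"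
  unfolding tmap_def
  by (rule tlift_pure[OF B M tensor_abelian_group[OF B N] bilinear_balanced[OF tmap_bilinear[OF N f]] assms(3,4)])

lemma teval_lin:
  assumes f: "lin A M (self_module A) \<phi>"
  shows "lin A (tensor_product A B M) B (teval B \<phi>)"
  unfolding teval_def by (rule tlift_lin[OF B M B teval_bilinear[OF assms]])

lemma teval_pure:
  assumes f: "lin A M (self_module A) \<phi>" and "b \<in> carrier B" "x \<in> carrier M"
  shows "teval B \<phi> (pure_tensor A B M b x) = \<phi> x \<odot>\<^bsub>B\<^esub> b"
  unfolding teval_def
  by (rule tlift_pure[OF B M B.abelian_group_axioms bilinear_balanced[OF teval_bilinear[OF f]] assms(2,3)])

text \<open>A linear map on B \<otimes> M is determined by its values at pure tensors. The rules for
  \<open>tmap\<close> below, such as additivity in \<open>f\<close>, reduce in this way to one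
  evaluation at b \<otimes> x.\<close>

lemma tmap_eqI:
  assumes N: "module A N" and f: "lin A M N f" and g: "lin A (tensor_product A B M) (tensor_product A B N) g"
    and "\<And>b x. \<lbrakk>b \<in> carrier B; x \<in> carrier M\<rbrakk> \<Longrightarrow>
      pure_tensor A B N b (f x) = g (pure_tensor A B M b x)"
    and "T \<in> carrier (tensor_product A B M)"
  shows "tmap A B N f T = g T"
  by (rule tensor_lin_eq[OF B M tensor_module[OF B N] tmap_lin[OF N f] g])
    (simp_all add: tmap_pure[OF N f] assms)

lemma tmap_cong:
  assumes N: "module A N" and f: "lin A M N f" and "\<And>x. x \<in> carrier M \<Longrightarrow> g x = f x"
    and "T \<in> carrier (tensor_product A B M)"
  shows "tmap A B N g T = tmap A B N f T"
proof (rule tmap_eqI[OF N _ tmap_lin[OF N f] _ assms(4)])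
  show "lin A M N g" by (rule lin_cong[OF f assms(3) M])
qed (simp add: tmap_pure[OF N f] assms(3))

lemma tmap_id: "T \<in> carrier (tensor_product A B M) \<Longrightarrow> tmap A B M (\<lambda>x. x) T = T"
  by (rule tmap_eqI[OF M lin_id lin_id]) simp_all

text \<open>\<open>M\<close> is fixed in this context, so the behaviour of \<open>tmap\<close> on B
  \<otimes> N has to enter as the assumptions \<open>gN\<close> and \<open>gl\<close>; they are
  discharged in \<open>tmap_tmap\<close>.\<close>

lemma tmap_comp:
  assumes N: "module A N" and L: "module A L" and f: "lin A M N f" and g: "lin A N L g"
    and gN: "\<And>b y. \<lbrakk>b \<in> carrier B; y \<in> carrier N\<rbrakk> \<Longrightarrow>
      tmap A B L g (pure_tensor A B N b y) = pure_tensor A B L b (g y)"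
    and gl: "lin A (tensor_product A B N) (tensor_product A B L) (tmap A B L g)"
    and T: "T \<in> carrier (tensor_product A B M)"
  shows "tmap A B L g (tmap A B N f T) = tmap A B L (\<lambda>x. g (f x)) T"
  by (rule sym, rule tmap_eqI[OF L lin_compose[OF f g] lin_compose[OF tmap_lin[OF N f] gl] _ T])
    (simp add: tmap_pure[OF N f] linD[OF f] gN)

lemma teval_eqI:
  assumes f: "lin A M (self_module A) f" and g: "lin A (tensor_product A B M) B g"
    and "\<And>b x. \<lbrakk>b \<in> carrier B; x \<in> carrier M\<rbrakk> \<Longrightarrow> f x \<odot>\<^bsub>B\<^esub> b = g (pure_tensor A B M b x)"
    and "T \<in> carrier (tensor_product A B M)"
  shows "teval B f T = g T"
  by (rule tensor_lin_eq[OF B M B teval_lin[OF f] g]) (simp_all add: teval_pure[OF f] assms)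

lemma tmap_plus:
  assumes N: "module A N" and f: "lin A M N f" and g: "lin A M N g"
    and T: "T \<in> carrier (tensor_product A B M)"
  shows "tmap A B N (\<lambda>x. f x \<oplus>\<^bsub>N\<^esub> g x) T = tmap A B N f T \<oplus>\<^bsub>tensor_product A B N\<^esub> tmap A B N g T"
  by (rule tmap_eqI[OF N lin_plus[OF N f g] lin_plus[OF tensor_module[OF B N] tmap_lin[OF N f] tmap_lin[OF N g]] _ T])
    (simp add: linD[OF f] linD[OF g] tmap_pure[OF N f] tmap_pure[OF N g] pure_add_right[OF B N])

lemma tmap_diff:
  assumes N: "module A N" and f: "lin A M N f" and g: "lin A M N g"
    and T: "T \<in> carrier (tensor_product A B M)"
  shows "tmap A B N (\<lambda>x. f x \<ominus>\<^bsub>N\<^esub> g x) T = tmap A B N f T \<ominus>\<^bsub>tensor_product A B N\<^esub> tmap A B N g T"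
proof (rule tmap_eqI[OF N lin_diff[OF N f g] lin_diff[OF tensor_module[OF B N] tmap_lin[OF N f] tmap_lin[OF N g]] _ T])
  fix b x assume "b \<in> carrier B" "x \<in> carrier M"
  then show "pure_tensor A B N b (f x \<ominus>\<^bsub>N\<^esub> g x) = tmap A B N f (pure_tensor A B M b x)
      \<ominus>\<^bsub>tensor_product A B N\<^esub> tmap A B N g (pure_tensor A B M b x)"
    using lin_minus[OF bilinear_right[OF pure_bilinear[OF B N]] N tensor_module[OF B N]]
    by (simp add: linD[OF f] linD[OF g] tmap_pure[OF N f] tmap_pure[OF N g])
qed

lemma tmap_scale:
  assumes N: "module A N" and f: "lin A M N f" and a: "a \<in> carrier A"
    and T: "T \<in> carrier (tensor_product A B M)"
  shows "tmap A B N (\<lambda>x. a \<odot>\<^bsub>N\<^esub> f x) T = a \<odot>\<^bsub>tensor_product A B N\<^esub> tmap A B N f T"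
  by (rule tmap_eqI[OF N lin_scale[OF N f a] lin_scale[OF tensor_module[OF B N] tmap_lin[OF N f] a] _ T])
    (simp add: linD[OF f] a tmap_pure[OF N f] bilinear_smult_right[OF pure_bilinear[OF B N]])

lemma tmap_zero:
  assumes N: "module A N" and T: "T \<in> carrier (tensor_product A B M)"
  shows "tmap A B N (\<lambda>x. \<zero>\<^bsub>N\<^esub>) T = \<zero>\<^bsub>tensor_product A B N\<^esub>"
  by (rule tmap_eqI[OF N lin_const_zero[OF N] lin_const_zero[OF tensor_module[OF B N]] _ T])
    (rule lin_zero[OF bilinear_right[OF pure_bilinear[OF B N]] N tensor_module[OF B N]])

text \<open>The scalar moves across the tensor sign: b \<otimes> \<phi>(x) n = \<phi>(x) b \<otimes>
  n. Hence a rank one map sees \<open>T\<close> only through \<open>teval B \<phi> T\<close>, which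
  is why it vanishes on solutions.\<close>

lemma tmap_times:
  assumes N: "module A N" and f: "lin A M (self_module A) \<phi>" and n: "n \<in> carrier N"
    and T: "T \<in> carrier (tensor_product A B M)"
  shows "tmap A B N (\<lambda>x. \<phi> x \<odot>\<^bsub>N\<^esub> n) T = pure_tensor A B N (teval B \<phi> T) n"
  by (rule tmap_eqI[OF N lin_times[OF N f n]
        lin_compose[OF teval_lin[OF f] bilinear_left[OF pure_bilinear[OF B N] n]] _ T])
    (use linD[OF f] n in \<open>simp add: teval_pure[OF f] bilinearD[OF pure_bilinear[OF B N]]\<close>)

text \<open>The left factor absorbs the divisor: if a b' = b then a (b' \<otimes> x) = b \<otimes>
  x.\<close>

lemma divisible_tensor:
  assumes a: "a \<in> carrier A" and div: "\<And>b. b \<in> carrier B \<Longrightarrow> \<exists>b'\<in>carrier B. a \<odot>\<^bsub>B\<^esub> b' = b"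
    and T: "T \<in> carrier (tensor_product A B M)"
  shows "\<exists>T'\<in>carrier (tensor_product A B M). a \<odot>\<^bsub>tensor_product A B M\<^esub> T' = T"
proof -
  interpret T: module A "tensor_product A B M" by (rule tensor_module[OF B M])
  from T show ?thesis
  proof (induction rule: tensor_induct[OF B M, consumes 1])
    case 1 then show ?case using a by (intro bexI[of _ "\<zero>\<^bsub>tensor_product A B M\<^esub>"]) simp_all
  next
    case (2 b x T)
    obtain b' T' where *: "b' \<in> carrier B" "a \<odot>\<^bsub>B\<^esub> b' = b"
        "T' \<in> carrier (tensor_product A B M)" "a \<odot>\<^bsub>tensor_product A B M\<^esub> T' = T"
      using div[OF 2(1)] 2 by blast
    with 2 a show ?case
      by (intro bexI[of _ "pure_tensor A B M b' x \<oplus>\<^bsub>tensor_product A B M\<^esub> T'"])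
        (simp_all add: T.smult_r_distr pure_closed[OF B M] tensor_smult_pure[OF B M])
  qed
qed

end

lemma tmap_tmap:
  assumes "module A B" "module A M" "module A N" "module A L" "lin A M N f" "lin A N L g"
    and "T \<in> carrier (tensor_product A B M)"
  shows "tmap A B L g (tmap A B N f T) = tmap A B L (\<lambda>x. g (f x)) T"
  using assms by (intro tmap_comp) (auto simp: tmap_pure intro: tmap_lin)

lemma teval_tmap:
  assumes B: "module A B" and M: "module A M" and N: "module A N" and f: "lin A M N f"
    and \<phi>: "lin A N (self_module A) \<phi>" and "T \<in> carrier (tensor_product A B M)"
  shows "teval B \<phi> (tmap A B N f T) = teval B (\<lambda>x. \<phi> (f x)) T"
  by (rule sym, rule teval_eqI[OF B M lin_compose[OF f \<phi>] lin_compose[OF tmap_lin[OF B M N f] teval_lin[OF B N \<phi>]] _ assms(6)])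
    (simp add: tmap_pure[OF B M N f] teval_pure[OF B N \<phi>] linD[OF f])


section \<open>The span of a submodule\<close>

text \<open>The image of B \<otimes> K in B \<otimes> M. The tensor product B \<otimes> K is a
  quotient of a different free group, not a subset of B \<otimes> M, and it need not map injectively
  there.\<close>

definition tspan where
  "tspan A B M K = tmap A B M (\<lambda>x. x) ` carrier (tensor_product A B (M\<lparr>carrier := K\<rparr>))"

lemma submodule_module: "\<lbrakk>module A M; submodule K A M\<rbrakk> \<Longrightarrow> module A (M\<lparr>carrier := K\<rparr>)"
  by (rule submodule.submodule_is_module)

lemma submodule_subset: "submodule K A M \<Longrightarrow> K \<subseteq> carrier M"
  using subgroup.subset[OF submodule.axioms(1)] by fastforce

lemma lin_inclusion: "submodule K A M \<Longrightarrow> lin A (M\<lparr>carrier := K\<rparr>) M (\<lambda>x. x)"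
  using submodule_subset by (auto simp: lin_def)

lemma lin_restrict:
  assumes "lin A M N f" "submodule K A M" "\<And>x. x \<in> K \<Longrightarrow> f x \<in> K'"
  shows "lin A (M\<lparr>carrier := K\<rparr>) (N\<lparr>carrier := K'\<rparr>) f"
  using linD[OF assms(1)] assms(3) submodule_subset[OF assms(2)] by (auto simp: lin_def subset_iff)

lemma lin_into:
  assumes "lin A M N f" "\<And>x. x \<in> carrier M \<Longrightarrow> f x \<in> K'"
  shows "lin A M (N\<lparr>carrier := K'\<rparr>) f"
  using assms by (auto simp: lin_def)

lemma tmap_tspan:
  assumes B: "module A B" and M: "module A M" and K: "submodule K A M" and K': "submodule K' A M"
    and f: "lin A M M f" and fK: "\<And>x. x \<in> K \<Longrightarrow> f x \<in> K'" and T: "T \<in> tspan A B M K"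
  shows "tmap A B M f T \<in> tspan A B M K'"
proof -
  note MK = submodule_module[OF M K] and MK' = submodule_module[OF M K']
  obtain U where U: "U \<in> carrier (tensor_product A B (M\<lparr>carrier := K\<rparr>))" "T = tmap A B M (\<lambda>x. x) U"
    using T by (auto simp: tspan_def)
  note fr = lin_restrict[OF f K fK]
  have "tmap A B M f T = tmap A B M f U"
    unfolding U(2) using tmap_tmap[OF B MK M M lin_inclusion[OF K] f U(1)] by simp
  also have "\<dots> = tmap A B M (\<lambda>x. x) (tmap A B (M\<lparr>carrier := K'\<rparr>) f U)"
    using tmap_tmap[OF B MK MK' M fr lin_inclusion[OF K'] U(1)] by simp
  finally show ?thesis
    using lin_closed[OF tmap_lin[OF B MK MK' fr] U(1)] by (auto simp: tspan_def)
qed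

lemma tspan_mono:
  assumes B: "module A B" and M: "module A M" and K: "submodule K A M" and K': "submodule K' A M"
    and "K \<subseteq> K'" and T: "T \<in> tspan A B M K"
  shows "T \<in> tspan A B M K'"
proof -
  have "T \<in> carrier (tensor_product A B M)"
    using T linD[OF tmap_lin[OF B submodule_module[OF M K] M lin_inclusion[OF K]]]
    by (auto simp: tspan_def)
  then show ?thesis
    using tmap_tspan[OF B M K K' lin_id _ T] assms(5) by (auto simp: tmap_id[OF B M])
qed

lemma tspan_pure:
  assumes B: "module A B" and M: "module A M" and K: "submodule K A M" and "b \<in> carrier B" "k \<in> K"
  shows "pure_tensor A B M b k \<in> tspan A B M K"
  unfolding tspan_def
  by (rule image_eqI[where x = "pure_tensor A B (M\<lparr>carrier := K\<rparr>) b k"])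
    (use assms in \<open>simp_all add: tmap_pure[OF B submodule_module[OF M K] M lin_inclusion[OF K]]
      pure_closed[OF B submodule_module[OF M K]]\<close>)

lemma tspan_add:
  assumes B: "module A B" and M: "module A M" and K: "submodule K A M"
    and "S \<in> tspan A B M K" "T \<in> tspan A B M K"
  shows "S \<oplus>\<^bsub>tensor_product A B M\<^esub> T \<in> tspan A B M K"
proof -
  note l = tmap_lin[OF B submodule_module[OF M K] M lin_inclusion[OF K]]
  interpret T: module A "tensor_product A B (M\<lparr>carrier := K\<rparr>)"
    by (rule tensor_module[OF B submodule_module[OF M K]])
  show ?thesis
    using assms(4,5) unfolding tspan_def by (auto simp: lin_add[OF l, symmetric])
qed


section \<open>Maps factoring through a set of functionals\<close>

definition functionals where
  "functionals A M = {\<phi>. lin A M (self_module A) \<phi>}"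

definition common_kernel where
  "common_kernel A M R = {x \<in> carrier M. \<forall>\<phi>\<in>R. \<phi> x = \<zero>\<^bsub>A\<^esub>}"

definition tensor_solutions where
  "tensor_solutions A B M R = {T \<in> carrier (tensor_product A B M). \<forall>\<phi>\<in>R. teval B \<phi> T = \<zero>\<^bsub>B\<^esub>}"

inductive_set factoring :: "('m \<Rightarrow> 'a) set \<Rightarrow> ('a, 'm, 'y) module_scheme \<Rightarrow> ('m \<Rightarrow> 'm) set"
  for R :: "('m \<Rightarrow> 'a) set" and M :: "('a, 'm, 'y) module_scheme"
  where
    zero: "(\<And>x. x \<in> carrier M \<Longrightarrow> \<gamma> x = \<zero>\<^bsub>M\<^esub>) \<Longrightarrow> \<gamma> \<in> factoring R M"
  | step: "\<lbrakk>\<gamma> \<in> factoring R M; \<phi> \<in> R; m \<in> carrier M;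
      \<And>x. x \<in> carrier M \<Longrightarrow> \<gamma>' x = \<phi> x \<odot>\<^bsub>M\<^esub> m \<oplus>\<^bsub>M\<^esub> \<gamma> x\<rbrakk> \<Longrightarrow> \<gamma>' \<in> factoring R M"

context
  fixes A :: "('a, 'x) ring_scheme" and M :: "('a, 'm, 'z) module_scheme" and R :: "('m \<Rightarrow> 'a) set"
  assumes M: "module A M" and R: "R \<subseteq> functionals A M"
begin

interpretation M: module A M by (rule M)

lemma functionalD:
  assumes "\<phi> \<in> R" shows "lin A M (self_module A) \<phi>"
  using assms R by (auto simp: functionals_def)

lemma common_kernel_submodule: "submodule (common_kernel A M R) A M"
proof (rule M.submoduleI)
  note l = linD[OF functionalD, simplified]
  have carr: "x \<in> carrier M" if "x \<in> common_kernel A M R" for x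
    using that by (simp add: common_kernel_def)
  have z: "\<phi> x = \<zero>\<^bsub>A\<^esub>" if "\<phi> \<in> R" "x \<in> common_kernel A M R" for x \<phi>
    using that by (auto simp: common_kernel_def)
  have I: "x \<in> common_kernel A M R" if "x \<in> carrier M" "\<And>\<phi>. \<phi> \<in> R \<Longrightarrow> \<phi> x = \<zero>\<^bsub>A\<^esub>" for x
    using that by (auto simp: common_kernel_def)
  show "common_kernel A M R \<subseteq> carrier M" by (auto simp: common_kernel_def)
  show "\<zero>\<^bsub>M\<^esub> \<in> common_kernel A M R"
    using lin_zero[OF functionalD M module_self[OF M.R.is_cring]] by (intro I) simp_all
  show smult: "a \<odot>\<^bsub>M\<^esub> x \<in> common_kernel A M R" if "a \<in> carrier A" "x \<in> common_kernel A M R" for a x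
    by (rule I) (simp_all add: that carr z[OF _ that(2)] l(3))
  show "x \<oplus>\<^bsub>M\<^esub> y \<in> common_kernel A M R"
    if "x \<in> common_kernel A M R" "y \<in> common_kernel A M R" for x y
    by (rule I) (simp_all add: that carr z[OF _ that(1)] z[OF _ that(2)] l(2))
  show "\<ominus>\<^bsub>M\<^esub> x \<in> common_kernel A M R" if "x \<in> common_kernel A M R" for x
    using smult[OF _ that, of "\<ominus>\<^bsub>A\<^esub> \<one>\<^bsub>A\<^esub>"] carr[OF that] by (simp add: M.smult_l_minus)
qed

lemma factoring_lin: "\<gamma> \<in> factoring R M \<Longrightarrow> lin A M M \<gamma>"
proof (induction rule: factoring.induct)
  case (zero \<gamma>)
  then show ?case by (intro lin_cong[OF lin_const_zero[OF M] _ M])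
next
  case (step \<gamma> \<phi> m \<gamma>')
  then show ?case
    by (intro lin_cong[OF lin_plus[OF M lin_times[OF M functionalD] step.IH] _ M])
qed

lemma factoring_closed: "\<lbrakk>\<gamma> \<in> factoring R M; x \<in> carrier M\<rbrakk> \<Longrightarrow> \<gamma> x \<in> carrier M"
  using lin_closed[OF factoring_lin] .

lemma factoring_cong:
  assumes "\<gamma> \<in> factoring R M" "\<And>x. x \<in> carrier M \<Longrightarrow> \<gamma>' x = \<gamma> x"
  shows "\<gamma>' \<in> factoring R M"
  using assms
proof (cases rule: factoring.cases)
  case zero then show ?thesis using assms by (intro factoring.zero) simp
next
  case (step \<gamma> \<phi> m) then show ?thesis using assms by (intro factoring.step[OF step(1-3)]) simp
qed

lemma factoring_single:
  assumes "\<phi> \<in> R" "m \<in> carrier M"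
  shows "(\<lambda>x. \<phi> x \<odot>\<^bsub>M\<^esub> m) \<in> factoring R M"
  by (rule factoring.step[OF factoring.zero assms])
    (use linD[OF functionalD[OF assms(1)]] assms(2) in auto)

lemma factoring_add:
  assumes "\<gamma> \<in> factoring R M" "\<delta> \<in> factoring R M"
  shows "(\<lambda>x. \<gamma> x \<oplus>\<^bsub>M\<^esub> \<delta> x) \<in> factoring R M"
  using assms(1)
proof (induction rule: factoring.induct)
  case (zero \<gamma>)
  then show ?case using factoring_closed[OF assms(2)]
    by (intro factoring_cong[OF assms(2)]) simp
next
  case (step \<gamma> \<phi> m \<gamma>')
  show ?case
    by (rule factoring.step[OF step.IH step(2,3)])
      (use step(3,4) lin_closed[OF functionalD[OF step(2)]] factoring_closed[OF step(1)]
        factoring_closed[OF assms(2)] in \<open>simp add: M.M.a_assoc\<close>)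
qed

lemma factoring_kernel:
  assumes "\<gamma> \<in> factoring R M" "x \<in> common_kernel A M R"
  shows "\<gamma> x = \<zero>\<^bsub>M\<^esub>"
  using assms
  by (induction rule: factoring.induct) (auto simp: common_kernel_def)

text \<open>Linearity gives \<tau>(\<phi>(\<sigma> x) m) = \<phi>(\<sigma> x) \<tau>(m), so only the
  rank one terms with functional \<phi> \<sigma> have to be examined. The two sets of functionals
  differ because the elimination replaces \<open>R\<close> by \<open>R'\<close> and has to translate
  back.\<close>

lemma factoring_comp:
  assumes R': "R' \<subseteq> functionals A M" and \<gamma>: "\<gamma> \<in> factoring R' M"
    and \<tau>: "lin A M M \<tau>" and \<sigma>: "lin A M M \<sigma>"
    and *: "\<And>\<phi> m. \<lbrakk>\<phi> \<in> R'; m \<in> carrier M\<rbrakk> \<Longrightarrow> (\<lambda>x. \<phi> (\<sigma> x) \<odot>\<^bsub>M\<^esub> m) \<in> factoring R M"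
  shows "(\<lambda>x. \<tau> (\<gamma> (\<sigma> x))) \<in> factoring R M"
  using \<gamma>
proof (induction rule: factoring.induct)
  case (zero \<gamma>)
  then show ?case
    by (intro factoring.zero) (simp add: linD[OF \<sigma>] lin_zero[OF \<tau> M M])
next
  case (step \<gamma> \<phi> m \<gamma>')
  have \<phi>: "lin A M (self_module A) \<phi>" using step(2) R' by (auto simp: functionals_def)
  \<comment> \<open>\<open>factoring_closed\<close> is available here for the fixed \<open>R\<close>
    only, whereas \<open>\<gamma>\<close> is built from \<open>R'\<close>.\<close>
  have \<gamma>: "(\<lambda>x. \<gamma> (\<sigma> x)) \<in> carrier M \<rightarrow> carrier M"
    using step(1)
  proof (induction rule: factoring.induct)
    case (step \<gamma> \<phi> m \<gamma>')
    have "lin A M (self_module A) \<phi>" using step(2) R' by (auto simp: functionals_def)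
    then show ?case using step(3,4,5) lin_closed[OF \<sigma>] lin_closed[of A M "self_module A" \<phi>]
      by (simp add: Pi_iff)
  qed (simp add: linD[OF \<sigma>])
  show ?case
    by (rule factoring_cong[OF factoring_add[OF *[OF step(2) lin_closed[OF \<tau> step(3)]] step.IH]])
      (use \<gamma> linD[OF \<phi>] step(3,4) in \<open>simp add: linD[OF \<sigma>] linD[OF \<tau>] Pi_iff\<close>)
qed

text \<open>Each term \<phi>(x) m becomes (id \<otimes> \<phi>)(T) \<otimes> m, which is zero at a
  solution. This is the analogue of \<open>factoring_kernel\<close> over \<open>B\<close>, with
  solutions in place of the span of the kernel.\<close>

lemma factoring_tensor_solutions:
  assumes B: "module A B" and \<gamma>: "\<gamma> \<in> factoring R M" and T: "T \<in> tensor_solutions A B M R"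
  shows "tmap A B M \<gamma> T = \<zero>\<^bsub>tensor_product A B M\<^esub>"
  using \<gamma>
proof (induction rule: factoring.induct)
  have T': "T \<in> carrier (tensor_product A B M)" using T by (simp add: tensor_solutions_def)
  interpret T: module A "tensor_product A B M" by (rule tensor_module[OF B M])
  case (zero \<gamma>)
  have "tmap A B M \<gamma> T = tmap A B M (\<lambda>x. \<zero>\<^bsub>M\<^esub>) T"
    by (rule tmap_cong[OF B M M lin_const_zero[OF M] zero T'])
  then show ?case by (simp add: tmap_zero[OF B M M T'])
next
  have T': "T \<in> carrier (tensor_product A B M)" using T by (simp add: tensor_solutions_def)
  interpret T: module A "tensor_product A B M" by (rule tensor_module[OF B M])
  case (step \<gamma> \<phi> m \<gamma>')
  note l = lin_times[OF M functionalD[OF step(2)] step(3)] factoring_lin[OF step(1)]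
  have "tmap A B M \<gamma>' T = tmap A B M (\<lambda>x. \<phi> x \<odot>\<^bsub>M\<^esub> m \<oplus>\<^bsub>M\<^esub> \<gamma> x) T"
    by (rule tmap_cong[OF B M M lin_plus[OF M l] step(4) T'])
  also have "\<dots> = pure_tensor A B M (teval B \<phi> T) m \<oplus>\<^bsub>tensor_product A B M\<^esub> \<zero>\<^bsub>tensor_product A B M\<^esub>"
    by (simp add: tmap_plus[OF B M M l T'] tmap_times[OF B M M functionalD[OF step(2)] step(3) T'] step.IH)
  also have "teval B \<phi> T = \<zero>\<^bsub>B\<^esub>" using T step(2) by (simp add: tensor_solutions_def)
  also have "pure_tensor A B M \<zero>\<^bsub>B\<^esub> m = \<zero>\<^bsub>tensor_product A B M\<^esub>"
    by (rule lin_zero[OF bilinear_left[OF pure_bilinear[OF B M] step(3)] B tensor_module[OF B M]])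
  finally show ?case by simp
qed

end


section \<open>Dual bases\<close>

text \<open>A family rather than a set, so that the matrix units of an endomorphism module can be
  indexed by pairs.\<close>

definition dual_basis where
  "dual_basis A M J e \<xi> \<longleftrightarrow> finite J \<and> e \<in> J \<rightarrow> carrier M \<and> \<xi> ` J \<subseteq> functionals A M \<and>
    (\<forall>i\<in>J. \<forall>j\<in>J. \<xi> i (e j) = (if i = j then \<one>\<^bsub>A\<^esub> else \<zero>\<^bsub>A\<^esub>)) \<and>
    (\<forall>x\<in>carrier M. x = (\<Oplus>\<^bsub>M\<^esub>j\<in>J. \<xi> j x \<odot>\<^bsub>M\<^esub> e j))"

lemma dual_basisD:
  assumes "dual_basis A M J e \<xi>"
  shows "finite J" and "j \<in> J \<Longrightarrow> e j \<in> carrier M" and "j \<in> J \<Longrightarrow> lin A M (self_module A) (\<xi> j)"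
    and "\<lbrakk>i \<in> J; j \<in> J\<rbrakk> \<Longrightarrow> \<xi> i (e j) = (if i = j then \<one>\<^bsub>A\<^esub> else \<zero>\<^bsub>A\<^esub>)"
    and "x \<in> carrier M \<Longrightarrow> x = (\<Oplus>\<^bsub>M\<^esub>j\<in>J. \<xi> j x \<odot>\<^bsub>M\<^esub> e j)"
  using assms unfolding dual_basis_def functionals_def by blast+

lemma finsum_in_subset:
  assumes "abelian_group M" "finite J" "S \<subseteq> carrier M" "\<zero>\<^bsub>M\<^esub> \<in> S"
    and "\<And>x y. \<lbrakk>x \<in> S; y \<in> S\<rbrakk> \<Longrightarrow> x \<oplus>\<^bsub>M\<^esub> y \<in> S" and "\<And>j. j \<in> J \<Longrightarrow> g j \<in> S"
  shows "finsum M g J \<in> S"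
proof -
  interpret M: abelian_group M by fact
  show ?thesis
    using assms(2,6)
  proof (induction J)
    case empty then show ?case by (simp add: assms(4))
  next
    case (insert j J)
    then have "g \<in> J \<rightarrow> carrier M" "g j \<in> carrier M" using assms(3) by auto
    with insert assms(5) show ?case by simp
  qed
qed

lemma lin_finsum:
  assumes f: "lin A M N f" and M: "module A M" and N: "module A N" and "finite J" and "g \<in> J \<rightarrow> carrier M"
  shows "f (finsum M g J) = (\<Oplus>\<^bsub>N\<^esub>j\<in>J. f (g j))"
proof -
  interpret M: module A M by fact
  interpret N: module A N by fact
  show ?thesis
    using assms(4,5)
  proof (induction J)
    case empty then show ?case by (simp add: lin_zero[OF f M N])
  next
    case (insert j J)
    then have "g \<in> J \<rightarrow> carrier M" "g j \<in> carrier M" by auto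
    moreover from this have "(\<lambda>j. f (g j)) \<in> J \<rightarrow> carrier N" "f (g j) \<in> carrier N"
      using linD[OF f] by auto
    ultimately show ?case using insert by (simp add: lin_add[OF f])
  qed
qed

lemma dual_basis_span:
  assumes M: "module A M" and db: "dual_basis A M J e \<xi>"
    and S: "S \<subseteq> carrier M" "\<zero>\<^bsub>M\<^esub> \<in> S" "\<And>x y. \<lbrakk>x \<in> S; y \<in> S\<rbrakk> \<Longrightarrow> x \<oplus>\<^bsub>M\<^esub> y \<in> S"
      "\<And>a x. \<lbrakk>a \<in> carrier A; x \<in> S\<rbrakk> \<Longrightarrow> a \<odot>\<^bsub>M\<^esub> x \<in> S" "\<And>j. j \<in> J \<Longrightarrow> e j \<in> S"
    and x: "x \<in> carrier M"
  shows "x \<in> S"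
proof -
  interpret M: module A M by fact
  have "(\<Oplus>\<^bsub>M\<^esub>j\<in>J. \<xi> j x \<odot>\<^bsub>M\<^esub> e j) \<in> S"
    by (rule finsum_in_subset[OF M.abelian_group_axioms dual_basisD(1)[OF db] S(1-3)])
      (use S(4,5) lin_closed[OF dual_basisD(3)[OF db] x] in auto)
  then show ?thesis using dual_basisD(5)[OF db x] by simp
qed

lemma dual_basis_lin_eq:
  assumes M: "module A M" and N: "module A N" and db: "dual_basis A M J e \<xi>"
    and f: "lin A M N f" and g: "lin A M N g" and eq: "\<And>j. j \<in> J \<Longrightarrow> f (e j) = g (e j)"
    and x: "x \<in> carrier M"
  shows "f x = g x"
proof -
  interpret M: module A M by fact
  have "x \<in> {x \<in> carrier M. f x = g x}"
    by (rule dual_basis_span[OF M db _ _ _ _ _ x])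
      (use linD[OF f] linD[OF g] lin_zero[OF f M N] lin_zero[OF g M N] eq dual_basisD(2)[OF db] in auto)
  then show ?thesis by simp
qed

text \<open>The map \<open>s\<close> that sends x to the sum of the \<xi>_j(x) e_j is linear and
  fixes every \<open>e j\<close>, so its fixed points are everything once the family spans. Spanning
  is stated as an induction principle on subsets \<open>S\<close>, which avoids linear
  combinations.\<close>

lemma dual_basisI:
  assumes M: "module A M" and "finite J" "e \<in> J \<rightarrow> carrier M" "\<xi> ` J \<subseteq> functionals A M"
    and \<delta>: "\<And>i j. \<lbrakk>i \<in> J; j \<in> J\<rbrakk> \<Longrightarrow> \<xi> i (e j) = (if i = j then \<one>\<^bsub>A\<^esub> else \<zero>\<^bsub>A\<^esub>)"
    and span: "\<And>S x. \<lbrakk>S \<subseteq> carrier M; \<zero>\<^bsub>M\<^esub> \<in> S; \<And>x y. \<lbrakk>x \<in> S; y \<in> S\<rbrakk> \<Longrightarrow> x \<oplus>\<^bsub>M\<^esub> y \<in> S;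
      \<And>a x. \<lbrakk>a \<in> carrier A; x \<in> S\<rbrakk> \<Longrightarrow> a \<odot>\<^bsub>M\<^esub> x \<in> S; \<And>j. j \<in> J \<Longrightarrow> e j \<in> S; x \<in> carrier M\<rbrakk> \<Longrightarrow> x \<in> S"
  shows "dual_basis A M J e \<xi>"
proof -
  interpret M: module A M by fact
  define s where "s x = (\<Oplus>\<^bsub>M\<^esub>j\<in>J. \<xi> j x \<odot>\<^bsub>M\<^esub> e j)" for x
  have \<xi>: "lin A M (self_module A) (\<xi> j)" if "j \<in> J" for j using that assms(4) by (auto simp: functionals_def)
  note l = linD[OF \<xi>, simplified]
  have e: "e j \<in> carrier M" if "j \<in> J" for j using that assms(3) by auto
  have cl: "(\<lambda>j. \<xi> j x \<odot>\<^bsub>M\<^esub> e j) \<in> J \<rightarrow> carrier M" if "x \<in> carrier M" for x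
    using that l e by auto
  have s: "lin A M M s"
  proof (rule linI)
    show "s x \<in> carrier M" if "x \<in> carrier M" for x
      unfolding s_def using cl[OF that] by (rule M.M.finsum_closed)
    show "s (x \<oplus>\<^bsub>M\<^esub> y) = s x \<oplus>\<^bsub>M\<^esub> s y" if "x \<in> carrier M" "y \<in> carrier M" for x y
      unfolding s_def M.M.finsum_addf[OF cl[OF that(1)] cl[OF that(2)], symmetric]
      by (rule M.M.finsum_cong') (use that l e in \<open>auto simp: M.smult_l_distr\<close>)
    show "s (a \<odot>\<^bsub>M\<^esub> x) = a \<odot>\<^bsub>M\<^esub> s x" if "a \<in> carrier A" "x \<in> carrier M" for a x
      unfolding s_def M.finsum_smult_ldistr[OF assms(2) that(1) cl[OF that(2)]]
      by (rule M.M.finsum_cong') (use that l e in \<open>auto simp: M.smult_assoc1\<close>)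
  qed
  have "s (e j) = e j" if "j \<in> J" for j
  proof -
    have "s (e j) = (\<Oplus>\<^bsub>M\<^esub>i\<in>J. if j = i then e i else \<zero>\<^bsub>M\<^esub>)"
      unfolding s_def by (rule M.M.finsum_cong') (use that \<delta> e in auto)
    also have "\<dots> = e j"
      using M.M.finsum_singleton[OF that assms(2), of e] e by auto
    finally show ?thesis .
  qed
  then have sx: "x \<in> {x \<in> carrier M. s x = x}" if "x \<in> carrier M" for x
    by (intro span[OF _ _ _ _ _ that]) (use linD[OF s] lin_zero[OF s M M] e in auto)
  have "x = (\<Oplus>\<^bsub>M\<^esub>j\<in>J. \<xi> j x \<odot>\<^bsub>M\<^esub> e j)" if "x \<in> carrier M" for x
    using sx[OF that] by (simp add: s_def[symmetric])
  with assms(2-5) show ?thesis unfolding dual_basis_def by blast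
qed

text \<open>The expansion in the dual basis is a sum of rank one maps.\<close>

lemma dual_basis_factoring:
  assumes M: "module A M" and db: "dual_basis A M J e \<xi>"
  shows "(\<lambda>x. x) \<in> factoring (\<xi> ` J) M"
proof -
  interpret M: module A M by fact
  have R: "\<xi> ` J \<subseteq> functionals A M" using db by (simp add: dual_basis_def)
  note l = linD[OF dual_basisD(3)[OF db]]
  have "(\<lambda>x. \<Oplus>\<^bsub>M\<^esub>j\<in>I. \<xi> j x \<odot>\<^bsub>M\<^esub> e j) \<in> factoring (\<xi> ` J) M" if "finite I" "I \<subseteq> J" for I
    using that
  proof (induction I)
    case empty then show ?case by (intro factoring.zero) simp
  next
    case (insert i I)
    show ?case
    proof (rule factoring.step[where \<phi> = "\<xi> i" and m = "e i"])
      show "(\<lambda>x. \<Oplus>\<^bsub>M\<^esub>j\<in>I. \<xi> j x \<odot>\<^bsub>M\<^esub> e j) \<in> factoring (\<xi> ` J) M"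
        using insert by auto
      show "\<xi> i \<in> \<xi> ` J" "e i \<in> carrier M" using insert dual_basisD(2)[OF db] by auto
      fix x assume x: "x \<in> carrier M"
      have c: "\<xi> j x \<odot>\<^bsub>M\<^esub> e j \<in> carrier M" if "j \<in> J" for j
        using l(1)[OF that x] dual_basisD(2)[OF db that] by simp
      show "(\<Oplus>\<^bsub>M\<^esub>j\<in>insert i I. \<xi> j x \<odot>\<^bsub>M\<^esub> e j)
          = \<xi> i x \<odot>\<^bsub>M\<^esub> e i \<oplus>\<^bsub>M\<^esub> (\<Oplus>\<^bsub>M\<^esub>j\<in>I. \<xi> j x \<odot>\<^bsub>M\<^esub> e j)"
        by (rule M.M.finsum_insert) (use insert c in auto)
    qed
  qed
  then have "(\<lambda>x. \<Oplus>\<^bsub>M\<^esub>j\<in>J. \<xi> j x \<odot>\<^bsub>M\<^esub> e j) \<in> factoring (\<xi> ` J) M"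
    using dual_basisD(1)[OF db] by simp
  then show ?thesis
    by (rule factoring_cong[OF M R]) (rule dual_basisD(5)[OF db])
qed

text \<open>A tensor with zero coordinates is a solution for the set of all coordinate functionals.
  The identity factors through these, so it kills the tensor.\<close>

lemma dual_basis_tensor_zero:
  assumes B: "module A B" and M: "module A M" and db: "dual_basis A M J e \<xi>"
    and T: "T \<in> carrier (tensor_product A B M)" and "\<And>j. j \<in> J \<Longrightarrow> teval B (\<xi> j) T = \<zero>\<^bsub>B\<^esub>"
  shows "T = \<zero>\<^bsub>tensor_product A B M\<^esub>"
proof -
  have R: "\<xi> ` J \<subseteq> functionals A M" using db by (simp add: dual_basis_def)
  have "T \<in> tensor_solutions A B M (\<xi> ` J)" using assms(4,5) by (auto simp: tensor_solutions_def)
  then show ?thesis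
    using factoring_tensor_solutions[OF M R B dual_basis_factoring[OF M db]] tmap_id[OF B M T] by simp
qed


section \<open>Splitting\<close>

text \<open>The properties of a field \<open>F\<close> over the residue field of \<open>A\<close> at \<open>m\<close> that the elimination below needs.\<close>

definition residue_module where
  "residue_module A m B \<longleftrightarrow> (\<exists>b\<in>carrier B. b \<noteq> \<zero>\<^bsub>B\<^esub>) \<and>
    (\<forall>a\<in>m. \<forall>b\<in>carrier B. a \<odot>\<^bsub>B\<^esub> b = \<zero>\<^bsub>B\<^esub>) \<and>
    (\<forall>a\<in>carrier A - m. bij_betw (\<lambda>b. a \<odot>\<^bsub>B\<^esub> b) (carrier B) (carrier B))"

lemma residue_moduleD:
  assumes "residue_module A m B" "module A B" "a \<in> carrier A" "b \<in> carrier B"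
  shows "a \<in> m \<Longrightarrow> a \<odot>\<^bsub>B\<^esub> b = \<zero>\<^bsub>B\<^esub>"
    and "\<lbrakk>a \<notin> m; a \<odot>\<^bsub>B\<^esub> b = \<zero>\<^bsub>B\<^esub>\<rbrakk> \<Longrightarrow> b = \<zero>\<^bsub>B\<^esub>"
    and "a \<notin> m \<Longrightarrow> \<exists>b'\<in>carrier B. a \<odot>\<^bsub>B\<^esub> b' = b"
proof -
  interpret B: module A B by fact
  show "a \<in> m \<Longrightarrow> a \<odot>\<^bsub>B\<^esub> b = \<zero>\<^bsub>B\<^esub>" using assms by (auto simp: residue_module_def)
  show "\<lbrakk>a \<notin> m; a \<odot>\<^bsub>B\<^esub> b = \<zero>\<^bsub>B\<^esub>\<rbrakk> \<Longrightarrow> b = \<zero>\<^bsub>B\<^esub>"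
    using assms by (auto simp: residue_module_def bij_betw_def dest!: bspec[where x = a]
        intro: inj_onD[where x = b and y = "\<zero>\<^bsub>B\<^esub>"])
  show "\<exists>b'\<in>carrier B. a \<odot>\<^bsub>B\<^esub> b' = b" if "a \<notin> m"
  proof -
    have "b \<in> (\<lambda>b. a \<odot>\<^bsub>B\<^esub> b) ` carrier B"
      using assms that by (simp add: residue_module_def bij_betw_def)
    then show ?thesis by blast
  qed
qed

text \<open>Elements outside \<open>m\<close> act injectively on the nonzero module \<open>B\<close>
  and elements of \<open>m\<close> act as zero, so a product of two elements outside
  \<open>m\<close> cannot lie in \<open>m\<close>.\<close>

lemma residue_module_mult:
  assumes r: "residue_module A m B" and B: "module A B"
    and a: "a \<in> carrier A" "a' \<in> carrier A" "a \<notin> m" "a' \<notin> m"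
  shows "a \<otimes>\<^bsub>A\<^esub> a' \<notin> m"
proof
  interpret B: module A B by fact
  assume *: "a \<otimes>\<^bsub>A\<^esub> a' \<in> m"
  obtain b where b: "b \<in> carrier B" "b \<noteq> \<zero>\<^bsub>B\<^esub>" using r by (auto simp: residue_module_def)
  have "a \<odot>\<^bsub>B\<^esub> (a' \<odot>\<^bsub>B\<^esub> b) = \<zero>\<^bsub>B\<^esub>"
    using residue_moduleD(1)[OF r B _ b(1) *] a b by (simp add: B.smult_assoc1)
  then show False
    using residue_moduleD(2)[OF r B] a b by (metis B.smult_closed)
qed

definition compose_functionals where
  "compose_functionals R \<tau> = (\<lambda>\<phi> x. \<phi> (\<tau> x)) ` R"

lemma compose_functionals_subset:
  assumes "R \<subseteq> functionals A M" "lin A M M \<tau>"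
  shows "compose_functionals R \<tau> \<subseteq> functionals A M"
  using assms(1) by (auto simp: compose_functionals_def functionals_def intro: lin_compose[OF assms(2)])

lemma common_kernel_compose:
  assumes "lin A M M \<tau>"
  shows "x \<in> common_kernel A M (compose_functionals R \<tau>) \<longleftrightarrow>
    x \<in> carrier M \<and> \<tau> x \<in> common_kernel A M R"
  using linD[OF assms] by (auto simp: compose_functionals_def common_kernel_def)

lemma tensor_solutions_compose:
  assumes "module A B" "module A M" "R \<subseteq> functionals A M" "lin A M M \<tau>"
    and "T \<in> tensor_solutions A B M (compose_functionals R \<tau>)"
  shows "tmap A B M \<tau> T \<in> tensor_solutions A B M R"
  using assms(5) lin_closed[OF tmap_lin[OF assms(1,2,2,4)]]
    teval_tmap[OF assms(1,2,2,4) functionalD[OF assms(2,3)]]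
  by (auto simp: tensor_solutions_def compose_functionals_def)

text \<open>Multiplication by \<open>a\<close> is onto on B \<otimes> M and injective on
  \<open>B\<close>: from a T' = T follows a \<phi>(T') = \<phi>(T) = 0, hence \<phi>(T') = 0. This
  compensates for the factors \<open>a\<close> that the elimination produces.\<close>

lemma tensor_solutions_divisible:
  assumes B: "module A B" and M: "module A M" and r: "residue_module A m B" and R: "R \<subseteq> functionals A M"
    and a: "a \<in> carrier A" "a \<notin> m" and T: "T \<in> tensor_solutions A B M R"
  shows "\<exists>T'\<in>tensor_solutions A B M R. a \<odot>\<^bsub>tensor_product A B M\<^esub> T' = T"
proof -
  have "T \<in> carrier (tensor_product A B M)" using T by (simp add: tensor_solutions_def)
  then obtain T' where T': "T' \<in> carrier (tensor_product A B M)" "a \<odot>\<^bsub>tensor_product A B M\<^esub> T' = T"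
    using divisible_tensor[OF B M a(1)] residue_moduleD(3)[OF r B a(1)] a(2) by auto
  have "teval B \<phi> T' = \<zero>\<^bsub>B\<^esub>" if "\<phi> \<in> R" for \<phi>
  proof -
    note l = teval_lin[OF B M functionalD[OF M R that]]
    have "a \<odot>\<^bsub>B\<^esub> teval B \<phi> T' = \<zero>\<^bsub>B\<^esub>"
      using T that lin_smult[OF l a(1) T'(1)] T'(2) by (simp add: tensor_solutions_def)
    then show ?thesis using residue_moduleD(2)[OF r B a(1) lin_closed[OF l T'(1)] a(2)] by simp
  qed
  then show ?thesis using T' by (auto simp: tensor_solutions_def)
qed

text \<open>Elimination step at a basis element \<open>e j\<close>: if some \<open>k\<close> in the kernel has coordinate \<open>\<xi> j k \<notin> m\<close>, then \<open>k\<close>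
  may replace \<open>e j\<close>; otherwise \<open>b \<otimes> e j\<close> is not a solution, which yields \<open>\<psi> \<in> R\<close> with \<open>\<psi> (e j) \<notin> m\<close>.  In either case
  the functionals composed with \<open>\<tau>\<close> vanish at one more basis element.\<close>

theorem local_splitting:
  assumes M: "module A M" and B: "module A B" and r: "residue_module A m B"
    and db: "dual_basis A M J e \<xi>"
    and "R \<subseteq> functionals A M" "tensor_solutions A B M R \<subseteq> tspan A B M (common_kernel A M R)"
  shows "\<exists>a\<in>carrier A - m. \<exists>\<gamma>\<in>factoring R M. \<forall>\<phi>\<in>R. \<forall>x\<in>carrier M. \<phi> (\<gamma> x) = a \<otimes>\<^bsub>A\<^esub> \<phi> x"
  using assms(5,6)
\<comment> \<open>The basis stays fixed while \<open>R\<close> changes; the measure counts the basis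
  elements at which \<open>R\<close> is not identically zero.\<close>
proof (induction "card {j\<in>J. \<exists>\<phi>\<in>R. \<phi> (e j) \<noteq> \<zero>\<^bsub>A\<^esub>}" arbitrary: R rule: less_induct)
  case less
  interpret M: module A M by fact
  interpret B: module A B by fact
  let ?T = "tensor_product A B M"
  interpret T: module A ?T by (rule tensor_module[OF B M])
  note R = less.prems(1) and sol = less.prems(2)
  note SM = module_self[OF M.R.is_cring]
  note K = common_kernel_submodule[OF M R]
  note \<phi>lin = functionalD[OF M R]
  note \<phi>D = linD[OF \<phi>lin, simplified]
  have finJ: "finite J" by (rule dual_basisD(1)[OF db])
  \<comment> \<open>Since \<tau>(e_j) = 0, composition with \<open>\<tau>\<close> removes
    \<open>j\<close> from the counted indices; the condition on \<open>\<tau>\<close> ensures that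
    no new index enters.\<close>
  have smaller: "card {i\<in>J. \<exists>\<phi>\<in>compose_functionals R \<tau>. \<phi> (e i) \<noteq> \<zero>\<^bsub>A\<^esub>}
      < card {i\<in>J. \<exists>\<phi>\<in>R. \<phi> (e i) \<noteq> \<zero>\<^bsub>A\<^esub>}"
    if j: "j \<in> J" "\<exists>\<phi>\<in>R. \<phi> (e j) \<noteq> \<zero>\<^bsub>A\<^esub>" "\<tau> (e j) = \<zero>\<^bsub>M\<^esub>"
      and \<tau>: "\<And>i \<phi>. \<lbrakk>i \<in> J; i \<noteq> j; \<forall>\<phi>\<in>R. \<phi> (e i) = \<zero>\<^bsub>A\<^esub>; \<phi> \<in> R\<rbrakk> \<Longrightarrow> \<phi> (\<tau> (e i)) = \<zero>\<^bsub>A\<^esub>" for \<tau> j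
  proof (rule psubset_card_mono)
    show "finite {i\<in>J. \<exists>\<phi>\<in>R. \<phi> (e i) \<noteq> \<zero>\<^bsub>A\<^esub>}" using finJ by simp
    have "j \<notin> {i\<in>J. \<exists>\<phi>\<in>compose_functionals R \<tau>. \<phi> (e i) \<noteq> \<zero>\<^bsub>A\<^esub>}"
      using j(3) lin_zero[OF \<phi>lin M SM] by (auto simp: compose_functionals_def)
    moreover have "{i\<in>J. \<exists>\<phi>\<in>compose_functionals R \<tau>. \<phi> (e i) \<noteq> \<zero>\<^bsub>A\<^esub>}
        \<subseteq> {i\<in>J. \<exists>\<phi>\<in>R. \<phi> (e i) \<noteq> \<zero>\<^bsub>A\<^esub>}"
      using \<tau> j by (fastforce simp: compose_functionals_def)
    ultimately show "{i\<in>J. \<exists>\<phi>\<in>compose_functionals R \<tau>. \<phi> (e i) \<noteq> \<zero>\<^bsub>A\<^esub>}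
        \<subset> {i\<in>J. \<exists>\<phi>\<in>R. \<phi> (e i) \<noteq> \<zero>\<^bsub>A\<^esub>}"
      using j by blast
  qed
  have one: "\<one>\<^bsub>A\<^esub> \<notin> m"
  proof
    assume "\<one>\<^bsub>A\<^esub> \<in> m"
    then show False using r residue_moduleD(1)[OF r B M.R.one_closed]
      by (auto simp: residue_module_def)
  qed
  show ?case
  proof (cases "\<exists>j\<in>J. \<exists>\<phi>\<in>R. \<phi> (e j) \<noteq> \<zero>\<^bsub>A\<^esub>")
    case False
    \<comment> \<open>\<open>R\<close> vanishes on the basis and hence everywhere, so
      \<open>a\<close> = 1 and \<open>\<gamma>\<close> = 0 serve.\<close>
    have "\<phi> x = \<zero>\<^bsub>A\<^esub>" if "\<phi> \<in> R" "x \<in> carrier M" for \<phi> x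
      using dual_basis_lin_eq[OF M SM db \<phi>lin[OF that(1)] lin_const_zero[OF SM] _ that(2)] False that by auto
    then have "\<phi> \<zero>\<^bsub>M\<^esub> = \<one>\<^bsub>A\<^esub> \<otimes>\<^bsub>A\<^esub> \<phi> x" if "\<phi> \<in> R" "x \<in> carrier M" for \<phi> x
      using that M.M.zero_closed M.R.one_closed M.R.r_null by metis
    then show ?thesis
      using one
      by (intro bexI[where x = "\<one>\<^bsub>A\<^esub>"] bexI[where x = "\<lambda>_. \<zero>\<^bsub>M\<^esub>"] ballI) (auto intro: factoring.zero)
  next
    case True
    then obtain j where j: "j \<in> J" "\<exists>\<phi>\<in>R. \<phi> (e j) \<noteq> \<zero>\<^bsub>A\<^esub>" by blast
    have e: "e j \<in> carrier M" and \<xi>: "lin A M (self_module A) (\<xi> j)" and \<xi>e: "\<xi> j (e j) = \<one>\<^bsub>A\<^esub>"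
      using dual_basisD[OF db] j(1) by auto
    note \<xi>D = linD[OF \<xi>, simplified]
    show ?thesis
    proof (cases "\<exists>k\<in>common_kernel A M R. \<xi> j k \<notin> m")
      case True
      then obtain k where k: "k \<in> common_kernel A M R" "\<xi> j k \<notin> m" by blast
      define a where "a = \<xi> j k"
      have kM: "k \<in> carrier M" using k(1) by (simp add: common_kernel_def)
      have a: "a \<in> carrier A" "a \<notin> m" using k(2) \<xi>D(1)[OF kM] by (auto simp: a_def)
      have \<phi>k: "\<phi> k = \<zero>\<^bsub>A\<^esub>" if "\<phi> \<in> R" for \<phi> using k(1) that by (auto simp: common_kernel_def)
      \<comment> \<open>\<open>\<tau>\<close> is the projection along \<open>e j\<close> onto the
        kernel of \<open>\<xi> j\<close>, and \<open>\<sigma>\<close> is the projection along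
        \<open>k\<close> onto the same kernel, cleared of its denominator \<open>a\<close>. As
        \<open>R\<close> vanishes at \<open>k\<close>, composition with \<open>\<sigma>\<close>
        multiplies each member of \<open>R\<close> by \<open>a\<close>.\<close>
      define \<tau> where "\<tau> x = x \<ominus>\<^bsub>M\<^esub> \<xi> j x \<odot>\<^bsub>M\<^esub> e j" for x
      define \<sigma> where "\<sigma> x = a \<odot>\<^bsub>M\<^esub> x \<ominus>\<^bsub>M\<^esub> \<xi> j x \<odot>\<^bsub>M\<^esub> k" for x
      have \<tau>: "lin A M M \<tau>"
        unfolding \<tau>_def by (intro lin_diff[OF M lin_id] lin_times[OF M \<xi> e])
      have \<sigma>: "lin A M M \<sigma>"
        unfolding \<sigma>_def by (intro lin_diff[OF M lin_scale[OF M lin_id a(1)]] lin_times[OF M \<xi> kM])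
      note \<tau>D = linD[OF \<tau>] and \<sigma>D = linD[OF \<sigma>]
      have \<xi>\<tau>: "\<xi> j (\<tau> x) = \<zero>\<^bsub>A\<^esub>" if "x \<in> carrier M" for x
        using that e \<xi>D(1)[OF that] lin_neg[OF \<xi> M SM]
        by (simp add: \<tau>_def a_minus_def \<xi>D \<xi>e M.smult_l_minus[symmetric] M.R.r_neg)
      have \<xi>\<sigma>: "\<xi> j (\<sigma> x) = \<zero>\<^bsub>A\<^esub>" if "x \<in> carrier M" for x
        using that kM a \<xi>D(1)[OF that]
        by (simp add: \<sigma>_def a_minus_def \<xi>D M.smult_l_minus[symmetric] a_def[symmetric] M.R.m_comm M.R.r_neg M.R.l_minus M.R.r_minus)
      have \<tau>0: "\<tau> x = x" if "x \<in> carrier M" "\<xi> j x = \<zero>\<^bsub>A\<^esub>" for x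
        using that e by (simp add: \<tau>_def a_minus_def)
      have \<sigma>0: "\<sigma> x = a \<odot>\<^bsub>M\<^esub> x" if "x \<in> carrier M" "\<xi> j x = \<zero>\<^bsub>A\<^esub>" for x
        using that a kM by (simp add: \<sigma>_def a_minus_def)
      have \<tau>\<sigma>: "\<tau> (\<sigma> x) = \<sigma> x" if "x \<in> carrier M" for x
        using that by (intro \<tau>0 \<sigma>D \<xi>\<sigma>)
      have \<sigma>\<tau>: "\<sigma> (\<tau> x) = a \<odot>\<^bsub>M\<^esub> \<tau> x" if "x \<in> carrier M" for x
        using that by (intro \<sigma>0 \<tau>D \<xi>\<tau>)
      have \<phi>\<sigma>: "\<phi> (\<sigma> x) = a \<otimes>\<^bsub>A\<^esub> \<phi> x" if "\<phi> \<in> R" "x \<in> carrier M" for \<phi> x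
        using that kM a \<xi>D(1)[OF that(2)] \<phi>D(1)[OF that(1)]
        by (simp add: \<sigma>_def a_minus_def M.smult_l_minus[symmetric] \<phi>D \<phi>k)
      have \<tau>e: "\<tau> (e j) = \<zero>\<^bsub>M\<^esub>" using e by (simp add: \<tau>_def \<xi>e M.M.r_neg a_minus_def)
      define R' where "R' = compose_functionals R \<tau>"
      have R': "R' \<subseteq> functionals A M"
        unfolding R'_def by (rule compose_functionals_subset[OF R \<tau>])
      note K' = common_kernel_submodule[OF M R']
      have eK': "e j \<in> common_kernel A M R'"
        unfolding R'_def common_kernel_compose[OF \<tau>] \<tau>e
        using e submodule_subset[OF K] lin_zero[OF \<phi>lin M SM] by (auto simp: common_kernel_def)
      have \<sigma>K: "\<sigma> x \<in> common_kernel A M R'" if "x \<in> common_kernel A M R" for x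
      proof -
        have x: "x \<in> carrier M" using that by (simp add: common_kernel_def)
        have "\<phi> (\<sigma> x) = \<zero>\<^bsub>A\<^esub>" if "\<phi> \<in> R" for \<phi>
        proof -
          have "\<phi> x = \<zero>\<^bsub>A\<^esub>" using \<open>x \<in> common_kernel A M R\<close> that by (auto simp: common_kernel_def)
          then show ?thesis using a by (simp add: \<phi>\<sigma>[OF that x])
        qed
        then show ?thesis
          unfolding R'_def common_kernel_compose[OF \<tau>]
          using x \<sigma>D(1)[OF x] by (simp add: common_kernel_def \<tau>\<sigma>)
      qed
      have "tensor_solutions A B M R' \<subseteq> tspan A B M (common_kernel A M R')"
      proof
        fix T assume T: "T \<in> tensor_solutions A B M R'"
        then have Tc: "T \<in> carrier ?T" by (simp add: tensor_solutions_def)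
        \<comment> \<open>Since \<sigma> \<tau> = a \<tau>, the span condition for \<open>R\<close>
          controls only a \<tau> of the solution it is applied to. Applied to T' with a T' = T it
          controls \<tau>(T). The rest of \<open>T\<close> has the form b \<otimes> e_j, and
          \<open>e j\<close> lies in the new kernel.\<close>
        obtain T' where sol': "T' \<in> tensor_solutions A B M R'" and T': "a \<odot>\<^bsub>?T\<^esub> T' = T"
          using tensor_solutions_divisible[OF B M r R' a T] by blast
        have T'c: "T' \<in> carrier ?T" using sol' by (simp add: tensor_solutions_def)
        from sol' have "tmap A B M \<tau> T' \<in> tspan A B M (common_kernel A M R)"
          using sol tensor_solutions_compose[OF B M R \<tau>] unfolding R'_def by blast
        then have "tmap A B M \<sigma> (tmap A B M \<tau> T') \<in> tspan A B M (common_kernel A M R')"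
          by (intro tmap_tspan[OF B M K K' \<sigma>] \<sigma>K)
        moreover have "tmap A B M \<sigma> (tmap A B M \<tau> T') = tmap A B M \<tau> T"
        proof -
          have "tmap A B M \<sigma> (tmap A B M \<tau> T') = tmap A B M (\<lambda>x. \<sigma> (\<tau> x)) T'"
            by (rule tmap_tmap[OF B M M M \<tau> \<sigma> T'c])
          also have "\<dots> = tmap A B M (\<lambda>x. a \<odot>\<^bsub>M\<^esub> \<tau> x) T'"
            by (rule tmap_cong[OF B M M lin_scale[OF M \<tau> a(1)] \<sigma>\<tau> T'c])
          also have "\<dots> = a \<odot>\<^bsub>?T\<^esub> tmap A B M \<tau> T'" by (rule tmap_scale[OF B M M \<tau> a(1) T'c])
          also have "\<dots> = tmap A B M \<tau> (a \<odot>\<^bsub>?T\<^esub> T')"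
            by (rule lin_smult[OF tmap_lin[OF B M M \<tau>] a(1) T'c, symmetric])
          finally show ?thesis using T' by simp
        qed
        moreover have "T = tmap A B M \<tau> T \<oplus>\<^bsub>?T\<^esub> pure_tensor A B M (teval B (\<xi> j) T) (e j)"
        proof -
          have "T = tmap A B M (\<lambda>x. x) T" by (rule tmap_id[OF B M Tc, symmetric])
          also have "\<dots> = tmap A B M (\<lambda>x. \<tau> x \<oplus>\<^bsub>M\<^esub> \<xi> j x \<odot>\<^bsub>M\<^esub> e j) T"
            by (rule tmap_cong[OF B M M lin_plus[OF M \<tau> lin_times[OF M \<xi> e]] _ Tc])
              (use e \<xi>D(1) in \<open>simp add: \<tau>_def a_minus_def M.M.a_assoc M.M.l_neg\<close>)
          also have "\<dots> = tmap A B M \<tau> T \<oplus>\<^bsub>?T\<^esub> pure_tensor A B M (teval B (\<xi> j) T) (e j)"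
            by (simp add: tmap_plus[OF B M M \<tau> lin_times[OF M \<xi> e] Tc] tmap_times[OF B M M \<xi> e Tc])
          finally show ?thesis .
        qed
        moreover have "pure_tensor A B M (teval B (\<xi> j) T) (e j) \<in> tspan A B M (common_kernel A M R')"
          by (rule tspan_pure[OF B M K' lin_closed[OF teval_lin[OF B M \<xi>] Tc] eK'])
        ultimately show "T \<in> tspan A B M (common_kernel A M R')"
          using tspan_add[OF B M K'] by metis
      qed
      moreover have "card {i\<in>J. \<exists>\<phi>\<in>R'. \<phi> (e i) \<noteq> \<zero>\<^bsub>A\<^esub>} < card {i\<in>J. \<exists>\<phi>\<in>R. \<phi> (e i) \<noteq> \<zero>\<^bsub>A\<^esub>}"
        unfolding R'_def
        by (rule smaller[of j \<tau>, OF j \<tau>e]) (use \<tau>0 dual_basisD(2,4)[OF db] j in simp)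
      ultimately obtain a' \<gamma>' where \<gamma>': "a' \<in> carrier A" "a' \<notin> m" "\<gamma>' \<in> factoring R' M"
        "\<And>\<phi> x. \<lbrakk>\<phi> \<in> R'; x \<in> carrier M\<rbrakk> \<Longrightarrow> \<phi> (\<gamma>' x) = a' \<otimes>\<^bsub>A\<^esub> \<phi> x"
        using less.hyps[OF _ R'] by blast
      \<comment> \<open>By \<tau> \<sigma> = \<sigma> and \<phi> \<sigma> = a \<phi>, a term
        \<phi>(\<tau>(\<sigma> x)) n is \<phi>(x) (a n), and \<phi> \<tau> \<gamma>' \<sigma> = a'
        \<phi> \<tau> \<sigma> = a' a \<phi>.\<close>
      have "(\<lambda>x. \<tau> (\<gamma>' (\<sigma> x))) \<in> factoring R M"
      proof (rule factoring_comp[OF M R R' \<gamma>'(3) \<tau> \<sigma>])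
        fix \<phi>' n assume "\<phi>' \<in> R'" and n: "n \<in> carrier M"
        then obtain \<phi> where \<phi>: "\<phi> \<in> R" "\<phi>' = (\<lambda>x. \<phi> (\<tau> x))" by (auto simp: R'_def compose_functionals_def)
        have "(\<lambda>x. \<phi> x \<odot>\<^bsub>M\<^esub> (a \<odot>\<^bsub>M\<^esub> n)) \<in> factoring R M"
          by (rule factoring_single[OF M R \<phi>(1)]) (use a n in simp)
        then show "(\<lambda>x. \<phi>' (\<sigma> x) \<odot>\<^bsub>M\<^esub> n) \<in> factoring R M"
          by (rule factoring_cong[OF M R])
            (use \<phi>D(1)[OF \<phi>(1)] a n in \<open>simp add: \<phi>(2) \<tau>\<sigma> \<phi>\<sigma>[OF \<phi>(1)] M.smult_assoc1[symmetric] M.R.m_comm\<close>)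
      qed
      moreover have "\<phi> (\<tau> (\<gamma>' (\<sigma> x))) = (a' \<otimes>\<^bsub>A\<^esub> a) \<otimes>\<^bsub>A\<^esub> \<phi> x" if "\<phi> \<in> R" "x \<in> carrier M" for \<phi> x
      proof -
        have "(\<lambda>x. \<phi> (\<tau> x)) \<in> R'" using that by (auto simp: R'_def compose_functionals_def)
        from \<gamma>'(4)[OF this \<sigma>D(1)[OF that(2)]] show ?thesis
          using a \<gamma>'(1) \<phi>D(1)[OF that] by (simp add: \<tau>\<sigma> that \<phi>\<sigma> M.R.m_assoc)
      qed
      moreover have "a' \<otimes>\<^bsub>A\<^esub> a \<in> carrier A - m"
        using residue_module_mult[OF r B \<gamma>'(1) a(1) \<gamma>'(2) a(2)] a(1) \<gamma>'(1) by simp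
      ultimately show ?thesis
        by (intro bexI[where x = "a' \<otimes>\<^bsub>A\<^esub> a"] bexI[where x = "\<lambda>x. \<tau> (\<gamma>' (\<sigma> x))"] ballI)
    next
      case False
      obtain b where b: "b \<in> carrier B" "b \<noteq> \<zero>\<^bsub>B\<^esub>" using r by (auto simp: residue_module_def)
      have be: "pure_tensor A B M b (e j) \<in> carrier ?T" by (rule pure_closed[OF B M b(1) e])
      \<comment> \<open>The j-th coordinate sends b \<otimes> e_j to \<open>b\<close>, but it is
        zero on the span of the kernel: there the values of \<open>\<xi> j\<close> lie in
        \<open>m\<close>, which acts as zero on \<open>B\<close>.\<close>
      have "pure_tensor A B M b (e j) \<notin> tspan A B M (common_kernel A M R)"
      proof
        note MK = submodule_module[OF M K]
        note \<xi>K = lin_compose[OF lin_inclusion[OF K] \<xi>]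
        assume "pure_tensor A B M b (e j) \<in> tspan A B M (common_kernel A M R)"
        then obtain U where U: "U \<in> carrier (tensor_product A B (M\<lparr>carrier := common_kernel A M R\<rparr>))"
          "pure_tensor A B M b (e j) = tmap A B M (\<lambda>x. x) U" by (auto simp: tspan_def)
        have "b = teval B (\<xi> j) (pure_tensor A B M b (e j))"
          using b by (simp add: teval_pure[OF B M \<xi> b(1) e] \<xi>e)
        also have "\<dots> = teval B (\<xi> j) U"
          unfolding U(2) by (rule teval_tmap[OF B MK M lin_inclusion[OF K] \<xi> U(1)])
        also have "\<dots> = \<zero>\<^bsub>B\<^esub>"
          by (rule teval_eqI[OF B MK \<xi>K lin_const_zero[OF B] _ U(1)])
            (use False residue_moduleD(1)[OF r B] \<xi>D(1) submodule_subset[OF K] in auto)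
        finally show False using b by simp
      qed
      then have "pure_tensor A B M b (e j) \<notin> tensor_solutions A B M R" using sol by blast
      then obtain \<psi> where \<psi>: "\<psi> \<in> R" "\<psi> (e j) \<odot>\<^bsub>B\<^esub> b \<noteq> \<zero>\<^bsub>B\<^esub>"
        using be teval_pure[OF B M \<phi>lin b(1) e] by (auto simp: tensor_solutions_def)
      define a where "a = \<psi> (e j)"
      note \<psi>l = \<phi>lin[OF \<psi>(1)] and \<psi>D = \<phi>D[OF \<psi>(1)]
      have a: "a \<in> carrier A" "a \<notin> m"
        using \<psi>(2) residue_moduleD(1)[OF r B _ b(1)] \<psi>D(1)[OF e] by (auto simp: a_def)
      \<comment> \<open>The projection along \<open>e j\<close> onto the kernel of
        \<open>\<psi>\<close>, cleared of its denominator \<open>a\<close>. On the common kernel it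
        is multiplication by \<open>a\<close>, so the common kernel stays inside the new
        one.\<close>
      define \<tau> where "\<tau> x = a \<odot>\<^bsub>M\<^esub> x \<ominus>\<^bsub>M\<^esub> \<psi> x \<odot>\<^bsub>M\<^esub> e j" for x
      have \<tau>: "lin A M M \<tau>"
        unfolding \<tau>_def by (intro lin_diff[OF M lin_scale[OF M lin_id a(1)]] lin_times[OF M \<psi>l e])
      note \<tau>D = linD[OF \<tau>]
      have \<tau>0: "\<tau> x = a \<odot>\<^bsub>M\<^esub> x" if "x \<in> carrier M" "\<psi> x = \<zero>\<^bsub>A\<^esub>" for x
        using that a e by (simp add: \<tau>_def a_minus_def)
      have \<tau>e: "\<tau> (e j) = \<zero>\<^bsub>M\<^esub>" using e a by (simp add: \<tau>_def a_def[symmetric] M.M.r_neg a_minus_def)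
      have \<phi>\<tau>: "\<phi> (\<tau> x) = a \<otimes>\<^bsub>A\<^esub> \<phi> x \<ominus>\<^bsub>A\<^esub> \<psi> x \<otimes>\<^bsub>A\<^esub> \<phi> (e j)" if "\<phi> \<in> R" "x \<in> carrier M" for \<phi> x
        using that a e \<psi>D(1)[OF that(2)] \<phi>D(1)[OF that(1)]
        by (simp add: \<tau>_def a_minus_def M.smult_l_minus[symmetric] \<phi>D M.R.l_minus)
      define R' where "R' = compose_functionals R \<tau>"
      have R': "R' \<subseteq> functionals A M"
        unfolding R'_def by (rule compose_functionals_subset[OF R \<tau>])
      note K' = common_kernel_submodule[OF M R']
      have eK': "e j \<in> common_kernel A M R'"
        unfolding R'_def common_kernel_compose[OF \<tau>] \<tau>e
        using e lin_zero[OF \<phi>lin M SM] by (auto simp: common_kernel_def)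
      have KK': "common_kernel A M R \<subseteq> common_kernel A M R'"
      proof
        fix x assume x: "x \<in> common_kernel A M R"
        then have "\<tau> x = a \<odot>\<^bsub>M\<^esub> x" using \<psi>(1) by (intro \<tau>0) (auto simp: common_kernel_def)
        then show "x \<in> common_kernel A M R'"
          unfolding R'_def common_kernel_compose[OF \<tau>]
          using x M.submoduleE(4)[OF K a(1) x] by (auto simp: common_kernel_def)
      qed
      have "tensor_solutions A B M R' \<subseteq> tspan A B M (common_kernel A M R')"
      proof
        fix T assume T: "T \<in> tensor_solutions A B M R'"
        then have Tc: "T \<in> carrier ?T" by (simp add: tensor_solutions_def)
        \<comment> \<open>The decomposition available is a x = \<tau>(x) + \<psi>(x) e_j, so
          \<open>T\<close> has to be written as a multiple of \<open>a\<close> before it can be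
          split.\<close>
        obtain T' where sol': "T' \<in> tensor_solutions A B M R'" and T': "a \<odot>\<^bsub>?T\<^esub> T' = T"
          using tensor_solutions_divisible[OF B M r R' a T] by blast
        have T'c: "T' \<in> carrier ?T" using sol' by (simp add: tensor_solutions_def)
        from sol' have "tmap A B M \<tau> T' \<in> tspan A B M (common_kernel A M R)"
          using sol tensor_solutions_compose[OF B M R \<tau>] unfolding R'_def by blast
        then have "tmap A B M \<tau> T' \<in> tspan A B M (common_kernel A M R')"
          by (rule tspan_mono[OF B M K K' KK'])
        moreover have "T = tmap A B M \<tau> T' \<oplus>\<^bsub>?T\<^esub> pure_tensor A B M (teval B \<psi> T') (e j)"
        proof -
          have "T = a \<odot>\<^bsub>?T\<^esub> tmap A B M (\<lambda>x. x) T'" by (simp add: tmap_id[OF B M T'c] T')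
          also have "\<dots> = tmap A B M (\<lambda>x. a \<odot>\<^bsub>M\<^esub> x) T'"
            by (rule tmap_scale[OF B M M lin_id a(1) T'c, symmetric])
          also have "\<dots> = tmap A B M (\<lambda>x. \<tau> x \<oplus>\<^bsub>M\<^esub> \<psi> x \<odot>\<^bsub>M\<^esub> e j) T'"
            by (rule tmap_cong[OF B M M lin_plus[OF M \<tau> lin_times[OF M \<psi>l e]] _ T'c])
              (use e a \<psi>D(1) in \<open>simp add: \<tau>_def a_minus_def M.M.a_assoc M.M.l_neg\<close>)
          also have "\<dots> = tmap A B M \<tau> T' \<oplus>\<^bsub>?T\<^esub> pure_tensor A B M (teval B \<psi> T') (e j)"
            by (simp add: tmap_plus[OF B M M \<tau> lin_times[OF M \<psi>l e] T'c] tmap_times[OF B M M \<psi>l e T'c])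
          finally show ?thesis .
        qed
        moreover have "pure_tensor A B M (teval B \<psi> T') (e j) \<in> tspan A B M (common_kernel A M R')"
          by (rule tspan_pure[OF B M K' lin_closed[OF teval_lin[OF B M \<psi>l] T'c] eK'])
        ultimately show "T \<in> tspan A B M (common_kernel A M R')"
          using tspan_add[OF B M K'] by metis
      qed
      moreover have "card {i\<in>J. \<exists>\<phi>\<in>R'. \<phi> (e i) \<noteq> \<zero>\<^bsub>A\<^esub>} < card {i\<in>J. \<exists>\<phi>\<in>R. \<phi> (e i) \<noteq> \<zero>\<^bsub>A\<^esub>}"
        unfolding R'_def
      proof (rule smaller[of j \<tau>, OF j \<tau>e])
        fix i \<phi> assume i: "i \<in> J" "\<forall>\<phi>\<in>R. \<phi> (e i) = \<zero>\<^bsub>A\<^esub>" "\<phi> \<in> R"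
        have "\<psi> (e i) = \<zero>\<^bsub>A\<^esub>" "\<phi> (e i) = \<zero>\<^bsub>A\<^esub>" using i \<psi>(1) by blast+
        moreover from this have "\<tau> (e i) = a \<odot>\<^bsub>M\<^esub> e i" using dual_basisD(2)[OF db i(1)] by (intro \<tau>0)
        ultimately show "\<phi> (\<tau> (e i)) = \<zero>\<^bsub>A\<^esub>"
          using a \<phi>D(3)[OF i(3) a(1) dual_basisD(2)[OF db i(1)]] by simp
      qed
      ultimately obtain a' \<gamma>' where \<gamma>': "a' \<in> carrier A" "a' \<notin> m" "\<gamma>' \<in> factoring R' M"
        "\<And>\<phi> x. \<lbrakk>\<phi> \<in> R'; x \<in> carrier M\<rbrakk> \<Longrightarrow> \<phi> (\<gamma>' x) = a' \<otimes>\<^bsub>A\<^esub> \<phi> x"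
        using less.hyps[OF _ R'] by blast
      \<comment> \<open>A new functional is \<phi> \<tau> = a \<phi> - \<phi>(e_j) \<psi>, a
        combination of two members of \<open>R\<close>.\<close>
      have "(\<lambda>x. \<tau> (\<gamma>' x)) \<in> factoring R M"
      proof (rule factoring_comp[OF M R R' \<gamma>'(3) \<tau> lin_id])
        fix \<phi>' n assume "\<phi>' \<in> R'" and n: "n \<in> carrier M"
        then obtain \<phi> where \<phi>: "\<phi> \<in> R" "\<phi>' = (\<lambda>x. \<phi> (\<tau> x))" by (auto simp: R'_def compose_functionals_def)
        have \<phi>e: "\<phi> (e j) \<in> carrier A" by (rule \<phi>D(1)[OF \<phi>(1) e])
        have "(\<lambda>x. \<phi> x \<odot>\<^bsub>M\<^esub> (a \<odot>\<^bsub>M\<^esub> n) \<oplus>\<^bsub>M\<^esub> \<psi> x \<odot>\<^bsub>M\<^esub> ((\<ominus>\<^bsub>A\<^esub> \<phi> (e j)) \<odot>\<^bsub>M\<^esub> n)) \<in> factoring R M"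
          by (intro factoring_add[OF M R] factoring_single[OF M R] \<phi>(1) \<psi>(1))
            (use a n \<phi>e in simp_all)
        then show "(\<lambda>x. \<phi>' x \<odot>\<^bsub>M\<^esub> n) \<in> factoring R M"
        proof (rule factoring_cong[OF M R])
          fix x assume x: "x \<in> carrier M"
          have [simp]: "\<phi> x \<in> carrier A" "\<psi> x \<in> carrier A" using \<phi>D(1)[OF \<phi>(1) x] \<psi>D(1)[OF x] .
          show "\<phi>' x \<odot>\<^bsub>M\<^esub> n = \<phi> x \<odot>\<^bsub>M\<^esub> (a \<odot>\<^bsub>M\<^esub> n) \<oplus>\<^bsub>M\<^esub> \<psi> x \<odot>\<^bsub>M\<^esub> ((\<ominus>\<^bsub>A\<^esub> \<phi> (e j)) \<odot>\<^bsub>M\<^esub> n)"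
            using a n \<phi>e
            by (simp add: \<phi>(2) \<phi>\<tau>[OF \<phi>(1) x] a_minus_def M.smult_l_distr M.smult_assoc1[symmetric] M.R.m_comm M.R.r_minus)
        qed
      qed
      \<comment> \<open>The term with \<open>\<psi>\<close> is a correction: \<phi> \<tau> \<gamma>'
        = a' (a \<phi> - \<phi>(e_j) \<psi>), and the added multiple of \<open>e j\<close>
        contributes a' \<phi>(e_j) \<psi>.\<close>
      then have "(\<lambda>x. \<tau> (\<gamma>' x) \<oplus>\<^bsub>M\<^esub> \<psi> x \<odot>\<^bsub>M\<^esub> (a' \<odot>\<^bsub>M\<^esub> e j)) \<in> factoring R M"
        by (intro factoring_add[OF M R] factoring_single[OF M R \<psi>(1)]) (use \<gamma>' e in simp_all)
      moreover have "\<phi> (\<tau> (\<gamma>' x) \<oplus>\<^bsub>M\<^esub> \<psi> x \<odot>\<^bsub>M\<^esub> (a' \<odot>\<^bsub>M\<^esub> e j)) = (a' \<otimes>\<^bsub>A\<^esub> a) \<otimes>\<^bsub>A\<^esub> \<phi> x"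
        if "\<phi> \<in> R" "x \<in> carrier M" for \<phi> x
      proof -
        have [simp]: "\<phi> x \<in> carrier A" "\<psi> x \<in> carrier A" "\<phi> (e j) \<in> carrier A"
          using \<phi>D(1)[OF that] \<psi>D(1)[OF that(2)] \<phi>D(1)[OF that(1) e] .
        have \<gamma>x: "\<gamma>' x \<in> carrier M" by (rule factoring_closed[OF M R' \<gamma>'(3) that(2)])
        have "(\<lambda>x. \<phi> (\<tau> x)) \<in> R'" using that by (auto simp: R'_def compose_functionals_def)
        from \<gamma>'(4)[OF this that(2)]
        have "\<phi> (\<tau> (\<gamma>' x) \<oplus>\<^bsub>M\<^esub> \<psi> x \<odot>\<^bsub>M\<^esub> (a' \<odot>\<^bsub>M\<^esub> e j))
          = a' \<otimes>\<^bsub>A\<^esub> (a \<otimes>\<^bsub>A\<^esub> \<phi> x \<ominus>\<^bsub>A\<^esub> \<psi> x \<otimes>\<^bsub>A\<^esub> \<phi> (e j)) \<oplus>\<^bsub>A\<^esub> \<psi> x \<otimes>\<^bsub>A\<^esub> (a' \<otimes>\<^bsub>A\<^esub> \<phi> (e j))"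
          using \<gamma>'(1) e \<tau>D(1)[OF \<gamma>x] that by (simp add: \<phi>D[OF that(1)] \<phi>\<tau>)
        also have "\<dots> = (a' \<otimes>\<^bsub>A\<^esub> a) \<otimes>\<^bsub>A\<^esub> \<phi> x"
          using a \<gamma>'(1) by (simp add: a_minus_def M.R.r_distr M.R.m_ac M.R.a_assoc M.R.r_minus M.R.l_neg)
        finally show ?thesis .
      qed
      moreover have "a' \<otimes>\<^bsub>A\<^esub> a \<in> carrier A - m"
        using residue_module_mult[OF r B \<gamma>'(1) a(1) \<gamma>'(2) a(2)] a(1) \<gamma>'(1) by simp
      ultimately show ?thesis
        by (intro bexI[where x = "a' \<otimes>\<^bsub>A\<^esub> a"] bexI[where x = "\<lambda>x. \<tau> (\<gamma>' x) \<oplus>\<^bsub>M\<^esub> \<psi> x \<odot>\<^bsub>M\<^esub> (a' \<odot>\<^bsub>M\<^esub> e j)"] ballI)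
    qed
  qed
qed

section \<open>From local splittings to a global one\<close>

text \<open>Zorn's lemma for the ideals above \<open>I\<close> that omit 1; this form of properness
  passes to unions of chains.\<close>

lemma (in ring) exists_maximalideal:
  assumes I: "ideal I R" and "I \<noteq> carrier R"
  shows "\<exists>m. maximalideal m R \<and> I \<subseteq> m"
proof -
  define S where "S = {J. ideal J R \<and> I \<subseteq> J \<and> \<one> \<notin> J}"
  have "I \<in> S" using assms ideal.one_imp_carrier[OF I] by (auto simp: S_def)
  moreover have "\<Union>C \<in> S" if C: "C \<noteq> {}" "subset.chain S C" for C
  proof -
    have "subset.chain {I. ideal I R} C"
      using C(2) by (auto simp: pred_on.chain_def S_def)
    then have "ideal (\<Union>C) R" using chain_Union_is_ideal[of C] C(1) by auto
    moreover have "C \<subseteq> S" using C(2) by (auto simp: pred_on.chain_def)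
    ultimately show ?thesis using C(1) by (auto simp: S_def)
  qed
  ultimately obtain m where m: "m \<in> S" "\<And>J. \<lbrakk>J \<in> S; m \<subseteq> J\<rbrakk> \<Longrightarrow> J = m"
    using subset_Zorn_nonempty[of S] by blast
  have "maximalideal m R"
  proof (rule maximalidealI)
    show "ideal m R" "carrier R \<noteq> m" using m(1) by (auto simp: S_def)
    show "J = m \<or> J = carrier R" if "ideal J R" "m \<subseteq> J" "J \<subseteq> carrier R" for J
      using m(2)[of J] m(1) that ideal.one_imp_carrier[OF that(1)] by (auto simp: S_def)
  qed
  then show ?thesis using m(1) by (auto simp: S_def)
qed

text \<open>That 1 lies in the ideal \<open>I\<close> means that local factors satisfy a relation in
  which the sum of the b_i a_i is 1; the global \<open>\<gamma>\<close> is then the corresponding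
  combination of the local ones. Working with the ideal hides the finite choice.\<close>

theorem global_splitting:
  fixes A :: "('a, 'x) ring_scheme" and M :: "('a, 'm, 'z) module_scheme"
  assumes M: "module A M" and db: "dual_basis A M J e \<xi>" and R: "R \<subseteq> functionals A M"
    and loc: "\<And>m. maximalideal m A \<Longrightarrow> \<exists>B :: ('a, 'f) module. module A B \<and> residue_module A m B \<and>
      tensor_solutions A B M R \<subseteq> tspan A B M (common_kernel A M R)"
  shows "\<exists>\<gamma>\<in>factoring R M. \<forall>\<phi>\<in>R. \<forall>x\<in>carrier M. \<phi> (\<gamma> x) = \<phi> x"
proof -
  interpret M: module A M by fact
  note \<phi>D = linD[OF functionalD[OF M R], simplified]
  define I where "I = {a \<in> carrier A. \<exists>\<gamma>\<in>factoring R M. \<forall>\<phi>\<in>R. \<forall>x\<in>carrier M. \<phi> (\<gamma> x) = a \<otimes>\<^bsub>A\<^esub> \<phi> x}"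
  have II: "a \<in> I" if "a \<in> carrier A" "\<gamma> \<in> factoring R M"
    "\<And>\<phi> x. \<lbrakk>\<phi> \<in> R; x \<in> carrier M\<rbrakk> \<Longrightarrow> \<phi> (\<gamma> x) = a \<otimes>\<^bsub>A\<^esub> \<phi> x" for a \<gamma>
    unfolding I_def using that by (intro CollectI conjI bexI[where x = \<gamma>] ballI)
  have IE: "\<exists>\<gamma>\<in>factoring R M. \<forall>\<phi>\<in>R. \<forall>x\<in>carrier M. \<phi> (\<gamma> x) = a \<otimes>\<^bsub>A\<^esub> \<phi> x" if "a \<in> I" for a
    using that unfolding I_def mem_Collect_eq by (elim conjE)
  have sub: "I \<subseteq> carrier A" by (auto simp: I_def)
  \<comment> \<open>The witness for b a is \<open>\<gamma>\<close> followed by multiplication by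
    \<open>b\<close>, which turns a term \<phi>(x) m into \<phi>(x) (b m).\<close>
  have mult: "b \<otimes>\<^bsub>A\<^esub> a \<in> I" if b: "b \<in> carrier A" and aI: "a \<in> I" for a b
  proof -
    obtain \<gamma> where \<gamma>: "\<gamma> \<in> factoring R M" "\<forall>\<phi>\<in>R. \<forall>x\<in>carrier M. \<phi> (\<gamma> x) = a \<otimes>\<^bsub>A\<^esub> \<phi> x"
      using IE[OF aI] by (elim bexE)
    have a: "a \<in> carrier A" using sub that by auto
    show ?thesis
    proof (rule II)
      show "(\<lambda>x. b \<odot>\<^bsub>M\<^esub> \<gamma> x) \<in> factoring R M"
        by (rule factoring_comp[OF M R R \<gamma>(1) lin_scale[OF M lin_id b] lin_id factoring_single[OF M R]])
      show "\<phi> (b \<odot>\<^bsub>M\<^esub> \<gamma> x) = b \<otimes>\<^bsub>A\<^esub> a \<otimes>\<^bsub>A\<^esub> \<phi> x" if "\<phi> \<in> R" "x \<in> carrier M" for \<phi> x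
        using that b a \<gamma>(2) \<phi>D(1)[OF that] factoring_closed[OF M R \<gamma>(1) that(2)]
        by (simp add: \<phi>D M.R.m_assoc)
    qed (use b a in simp)
  qed
  have "ideal I A"
  proof (rule idealI)
    show "ring A" by (rule M.R.ring_axioms)
    show "subgroup I (add_monoid A)"
    proof (rule M.R.add.subgroupI)
      show "I \<subseteq> carrier A" by (rule sub)
      have "\<zero>\<^bsub>A\<^esub> \<in> I"
        by (rule II[OF _ factoring.zero[where \<gamma> = "\<lambda>_. \<zero>\<^bsub>M\<^esub>"]])
          (use lin_zero[OF functionalD[OF M R] M module_self[OF M.R.is_cring], simplified]
            M.R.l_null[OF \<phi>D(1)] in \<open>simp_all only: M.R.zero_closed\<close>)
      then show "I \<noteq> {}" by auto
      show "\<ominus>\<^bsub>A\<^esub> a \<in> I" if "a \<in> I" for a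
        using mult[of "\<ominus>\<^bsub>A\<^esub> \<one>\<^bsub>A\<^esub>" a] that sub by (auto simp: M.R.l_minus)
      show "a \<oplus>\<^bsub>A\<^esub> b \<in> I" if aI: "a \<in> I" and bI: "b \<in> I" for a b
      proof -
        obtain \<gamma> where \<gamma>: "\<gamma> \<in> factoring R M" "\<forall>\<phi>\<in>R. \<forall>x\<in>carrier M. \<phi> (\<gamma> x) = a \<otimes>\<^bsub>A\<^esub> \<phi> x"
          using IE[OF aI] by (elim bexE)
        obtain \<delta> where \<delta>: "\<delta> \<in> factoring R M" "\<forall>\<phi>\<in>R. \<forall>x\<in>carrier M. \<phi> (\<delta> x) = b \<otimes>\<^bsub>A\<^esub> \<phi> x"
          using IE[OF bI] by (elim bexE)
        have ab: "a \<in> carrier A" "b \<in> carrier A" using sub that by auto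
        show ?thesis
        proof (rule II[OF _ factoring_add[OF M R \<gamma>(1) \<delta>(1)]])
          show "\<phi> (\<gamma> x \<oplus>\<^bsub>M\<^esub> \<delta> x) = (a \<oplus>\<^bsub>A\<^esub> b) \<otimes>\<^bsub>A\<^esub> \<phi> x" if "\<phi> \<in> R" "x \<in> carrier M" for \<phi> x
            using that \<gamma>(2) \<delta>(2) ab \<phi>D(1)[OF that] factoring_closed[OF M R \<gamma>(1) that(2)]
              factoring_closed[OF M R \<delta>(1) that(2)]
            by (simp add: \<phi>D M.R.l_distr)
        qed (use ab in simp)
      qed
    qed
    show left: "x \<otimes>\<^bsub>A\<^esub> a \<in> I" if "a \<in> I" "x \<in> carrier A" for a x
      by (rule mult[OF that(2,1)])
    show "a \<otimes>\<^bsub>A\<^esub> x \<in> I" if "a \<in> I" "x \<in> carrier A" for a x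
      using left[OF that] that sub by (metis M.R.m_comm subsetD)
  qed
  moreover have "\<not> I \<subseteq> m" if m: "maximalideal m A" for m
  proof -
    obtain B :: "('a, 'f) module" where B: "module A B" "residue_module A m B"
      "tensor_solutions A B M R \<subseteq> tspan A B M (common_kernel A M R)" using loc[OF m] by blast
    have "\<exists>a\<in>carrier A - m. a \<in> I"
      using local_splitting[OF M B(1,2) db R B(3)] unfolding I_def by simp
    then show ?thesis by blast
  qed
  ultimately have "I = carrier A"
    using M.R.exists_maximalideal by blast
  then have "\<one>\<^bsub>A\<^esub> \<in> I" by simp
  note IE[OF this]
  then obtain \<gamma> where \<gamma>: "\<gamma> \<in> factoring R M" "\<forall>\<phi>\<in>R. \<forall>x\<in>carrier M. \<phi> (\<gamma> x) = \<one>\<^bsub>A\<^esub> \<otimes>\<^bsub>A\<^esub> \<phi> x"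
    by (elim bexE)
  show ?thesis
    by (rule bexI[OF _ \<gamma>(1)]) (use \<gamma>(2) \<phi>D(1) in simp)
qed

section \<open>Base change of a split kernel\<close>

lemma tspan_subset_solutions:
  assumes M: "module A M" and B: "module A B" and R: "R \<subseteq> functionals A M"
  shows "tspan A B M (common_kernel A M R) \<subseteq> tensor_solutions A B M R"
proof
  note K = common_kernel_submodule[OF M R]
  note MK = submodule_module[OF M K]
  fix T assume "T \<in> tspan A B M (common_kernel A M R)"
  then obtain U where U: "U \<in> carrier (tensor_product A B (M\<lparr>carrier := common_kernel A M R\<rparr>))"
    "T = tmap A B M (\<lambda>x. x) U" by (auto simp: tspan_def)
  have "teval B \<phi> T = \<zero>\<^bsub>B\<^esub>" if "\<phi> \<in> R" for \<phi>
  proof -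
    note \<phi> = functionalD[OF M R that]
    have "teval B \<phi> T = teval B \<phi> U"
      unfolding U(2) by (rule teval_tmap[OF B MK M lin_inclusion[OF K] \<phi> U(1)])
    also have "\<dots> = \<zero>\<^bsub>B\<^esub>"
    proof (rule teval_eqI[OF B MK lin_compose[OF lin_inclusion[OF K] \<phi>] lin_const_zero[OF B] _ U(1)])
      fix b x assume b: "b \<in> carrier B" "x \<in> carrier (M\<lparr>carrier := common_kernel A M R\<rparr>)"
      then have "\<phi> x = \<zero>\<^bsub>A\<^esub>" using that by (auto simp: common_kernel_def)
      then show "\<phi> x \<odot>\<^bsub>B\<^esub> b = \<zero>\<^bsub>B\<^esub>" using module.smult_l_null[OF B b(1)] by simp
    qed
    finally show ?thesis .
  qed
  then show "T \<in> tensor_solutions A B M R"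
    unfolding tensor_solutions_def U(2)
    using lin_closed[OF tmap_lin[OF B MK M lin_inclusion[OF K]] U(1)] by simp
qed

text \<open>With \<epsilon> = id - \<gamma>, the composite K \<rightarrow> M \<rightarrow> K of the
  inclusion and \<open>\<epsilon>\<close> is the identity, and by functoriality so is its base
  change; this gives injectivity. At a solution \<open>T\<close> the base change of
  \<open>\<gamma>\<close> vanishes, so \<open>T\<close> equals its image under the base change of
  \<open>\<epsilon>\<close>, which comes from B \<otimes> K.\<close>

theorem splitting_base_change:
  assumes M: "module A M" and B: "module A B" and R: "R \<subseteq> functionals A M"
    and \<gamma>: "\<gamma> \<in> factoring R M" "\<And>\<phi> x. \<lbrakk>\<phi> \<in> R; x \<in> carrier M\<rbrakk> \<Longrightarrow> \<phi> (\<gamma> x) = \<phi> x"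
  shows "inj_on (tmap A B M (\<lambda>x. x)) (carrier (tensor_product A B (M\<lparr>carrier := common_kernel A M R\<rparr>)))"
    and "tspan A B M (common_kernel A M R) = tensor_solutions A B M R"
proof -
  interpret M: module A M by fact
  interpret T: module A "tensor_product A B M" by (rule tensor_module[OF B M])
  let ?K = "M\<lparr>carrier := common_kernel A M R\<rparr>"
  note K = common_kernel_submodule[OF M R]
  note MK = submodule_module[OF M K]
  note \<gamma>l = factoring_lin[OF M R \<gamma>(1)]
  define \<epsilon> where "\<epsilon> x = x \<ominus>\<^bsub>M\<^esub> \<gamma> x" for x
  have \<epsilon>: "lin A M M \<epsilon>" unfolding \<epsilon>_def by (rule lin_diff[OF M lin_id \<gamma>l])
  have "\<epsilon> x \<in> common_kernel A M R" if x: "x \<in> carrier M" for x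
  proof -
    have "\<phi> (\<epsilon> x) = \<zero>\<^bsub>A\<^esub>" if "\<phi> \<in> R" for \<phi>
    proof -
      note \<phi> = functionalD[OF M R that]
      have "\<phi> (\<epsilon> x) \<oplus>\<^bsub>A\<^esub> \<phi> (\<gamma> x) = \<phi> (\<epsilon> x \<oplus>\<^bsub>M\<^esub> \<gamma> x)"
        using lin_add[OF \<phi> lin_closed[OF \<epsilon> x] lin_closed[OF \<gamma>l x]] by simp
      also have "\<epsilon> x \<oplus>\<^bsub>M\<^esub> \<gamma> x = x"
        using x lin_closed[OF \<gamma>l x] by (simp add: \<epsilon>_def a_minus_def M.M.a_assoc M.M.l_neg)
      finally have "\<phi> (\<epsilon> x) \<oplus>\<^bsub>A\<^esub> \<phi> x = \<phi> x" using \<gamma>(2)[OF that x] by simp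
      then show ?thesis
        using lin_closed[OF \<phi> x] lin_closed[OF \<phi> lin_closed[OF \<epsilon> x]] by (simp add: M.R.add.r_cancel_one')
    qed
    then show ?thesis using lin_closed[OF \<epsilon> x] by (simp add: common_kernel_def)
  qed
  then have \<epsilon>K: "lin A M ?K \<epsilon>" by (rule lin_into[OF \<epsilon>])
  have "tmap A B ?K \<epsilon> (tmap A B M (\<lambda>x. x) U) = U" if U: "U \<in> carrier (tensor_product A B ?K)" for U
  proof -
    have "tmap A B ?K \<epsilon> (tmap A B M (\<lambda>x. x) U) = tmap A B ?K \<epsilon> U"
      by (rule tmap_tmap[OF B MK M MK lin_inclusion[OF K] \<epsilon>K U])
    also have "\<dots> = tmap A B ?K (\<lambda>x. x) U"
    proof (rule tmap_cong[OF B MK MK lin_id _ U])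
      fix x assume "x \<in> carrier ?K"
      then have x: "x \<in> common_kernel A M R" by simp
      then show "\<epsilon> x = x"
        using submodule_subset[OF K] factoring_kernel[OF M R \<gamma>(1) x] by (auto simp: \<epsilon>_def a_minus_def)
    qed
    finally show ?thesis by (simp add: tmap_id[OF B MK U])
  qed
  then show "inj_on (tmap A B M (\<lambda>x. x)) (carrier (tensor_product A B ?K))"
    by (rule inj_on_inverseI)
  have "T \<in> tspan A B M (common_kernel A M R)" if T: "T \<in> tensor_solutions A B M R" for T
  proof -
    have Tc: "T \<in> carrier (tensor_product A B M)" using T by (simp add: tensor_solutions_def)
    have "tmap A B M (\<lambda>x. x) (tmap A B ?K \<epsilon> T) = tmap A B M \<epsilon> T"
      by (rule tmap_tmap[OF B M MK M \<epsilon>K lin_inclusion[OF K] Tc])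
    also have "\<dots> = tmap A B M (\<lambda>x. x) T \<ominus>\<^bsub>tensor_product A B M\<^esub> tmap A B M \<gamma> T"
      unfolding \<epsilon>_def by (rule tmap_diff[OF B M M lin_id \<gamma>l Tc])
    also have "\<dots> = T"
      using Tc by (simp add: tmap_id[OF B M Tc] factoring_tensor_solutions[OF M R B \<gamma>(1) T] a_minus_def)
    finally have "T = tmap A B M (\<lambda>x. x) (tmap A B ?K \<epsilon> T)" ..
    then show ?thesis
      unfolding tspan_def using lin_closed[OF tmap_lin[OF B M MK \<epsilon>K] Tc] by (rule image_eqI)
  qed
  then show "tspan A B M (common_kernel A M R) = tensor_solutions A B M R"
    using tspan_subset_solutions[OF M B R] by blast
qed

section \<open>Residue fields as algebras and dual bases of free modules\<close>

lemma with_smult_simps [simp]: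
  "carrier (with_smult M s) = carrier M" "ring.zero (with_smult M s) = ring.zero M"
  "ring.add (with_smult M s) = ring.add M" "smult (with_smult M s) = s"
  "monoid.mult (with_smult M s) = monoid.mult M" "monoid.one (with_smult M s) = monoid.one M"
  by (simp_all add: with_smult_def)

lemma abelian_group_cong:
  assumes "abelian_group M" "carrier N = carrier M" "ring.add N = ring.add M" "ring.zero N = ring.zero M"
  shows "abelian_group N"
proof -
  interpret M: abelian_group M by fact
  show ?thesis
    by (rule abelian_groupI) (auto simp: assms(2-4) M.a_ac intro: M.add.l_inv_ex)
qed

lemma ring_cong:
  assumes "ring M" "carrier N = carrier M" "ring.add N = ring.add M" "ring.zero N = ring.zero M"
    "monoid.mult N = monoid.mult M" "monoid.one N = monoid.one M"
  shows "ring N"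
proof -
  interpret M: ring M by fact
  have "abelian_group N" by (rule abelian_group_cong[OF M.abelian_group_axioms assms(2-4)])
  then show ?thesis
    by (intro ringI monoidI) (simp_all add: assms(2-6) M.m_assoc M.l_distr M.r_distr)
qed

lemma algebra_via_assoc_algebra:
  assumes A: "cring A" and F: "field F" and h: "h \<in> ring_hom A F"
  shows "assoc_algebra A (algebra_via h F)"
proof -
  interpret A: cring A by fact
  interpret F: field F by fact
  interpret h: ring_hom_cring A F h
    by unfold_locales (rule h)
  have "module A (algebra_via h F)"
    by (rule moduleI[OF A abelian_group_cong[OF F.abelian_group_axioms]])
      (simp_all add: algebra_via_def F.l_distr F.r_distr F.m_assoc)
  moreover have "ring (algebra_via h F)"
    by (rule ring_cong[OF F.ring_axioms]) (simp_all add: algebra_via_def)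
  ultimately show ?thesis
    by (intro assoc_algebra.intro assoc_algebra_axioms.intro)
      (simp_all add: algebra_via_def F.m_assoc F.m_lcomm)
qed

text \<open>For \<open>a\<close> outside the kernel, \<open>h a\<close> is a unit of
  \<open>F\<close>, and multiplication by its inverse inverts the action of
  \<open>a\<close>.\<close>

lemma algebra_via_residue_module:
  assumes A: "cring A" and F: "field F" and h: "h \<in> ring_hom A F"
  shows "residue_module A (a_kernel A F h) (algebra_via h F)"
proof -
  interpret A: cring A by fact
  interpret F: field F by fact
  interpret h: ring_hom_cring A F h
    by unfold_locales (rule h)
  have "bij_betw (\<lambda>b. h a \<otimes>\<^bsub>F\<^esub> b) (carrier F) (carrier F)" if "a \<in> carrier A" "h a \<noteq> \<zero>\<^bsub>F\<^esub>" for a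
  proof -
    have u: "h a \<in> Units F" using that F.field_Units by simp
    show ?thesis
      by (rule bij_betw_byWitness[where f' = "\<lambda>b. inv\<^bsub>F\<^esub> (h a) \<otimes>\<^bsub>F\<^esub> b"])
        (use that u in \<open>auto simp: F.m_assoc[symmetric]\<close>)
  qed
  moreover have "h a = \<zero>\<^bsub>F\<^esub>" if "a \<in> a_kernel A F h" for a using that unfolding a_kernel_def' mem_Collect_eq by (rule conjunct2)
  moreover have "h a \<noteq> \<zero>\<^bsub>F\<^esub>" if "a \<in> carrier A - a_kernel A F h" for a
    using that unfolding a_kernel_def' by blast
  moreover have "\<exists>b\<in>carrier F. b \<noteq> \<zero>\<^bsub>F\<^esub>" using F.one_not_zero by blast
  ultimately show ?thesis
    unfolding residue_module_def algebra_via_def with_smult_simps by simp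
qed

text \<open>The unique coefficients of \<open>x\<close> are the coordinate functionals. Their
  linearity and their values on the basis both follow from uniqueness, by exhibiting a second
  expansion. The basis elements index themselves.\<close>

lemma free_dual_basis:
  assumes M: "module A M" and free: "free_of_finite_rank A M"
  shows "\<exists>E \<xi>. dual_basis A M E (\<lambda>e. e) \<xi>"
proof -
  interpret M: module A M by fact
  obtain E where E: "E \<subseteq> carrier M" "finite E" and
    ex: "\<forall>x\<in>carrier M. \<exists>!c. c \<in> E \<rightarrow>\<^sub>E carrier A \<and> x = (\<Oplus>\<^bsub>M\<^esub>e\<in>E. c e \<odot>\<^bsub>M\<^esub> e)"
    using free unfolding free_of_finite_rank_def by (elim exE conjE)
  note ex1 = bspec[OF ex]
  define c where "c x = (THE c. c \<in> E \<rightarrow>\<^sub>E carrier A \<and> x = (\<Oplus>\<^bsub>M\<^esub>e\<in>E. c e \<odot>\<^bsub>M\<^esub> e))" for x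
  have c: "c x \<in> E \<rightarrow>\<^sub>E carrier A" "x = (\<Oplus>\<^bsub>M\<^esub>e\<in>E. c x e \<odot>\<^bsub>M\<^esub> e)" if "x \<in> carrier M" for x
    using theI'[OF ex1[OF that]] unfolding c_def by (rule conjunct1, rule conjunct2)
  have cc: "c x e \<in> carrier A" if "x \<in> carrier M" "e \<in> E" for x e
    using c(1)[OF that(1)] that(2) by auto
  \<comment> \<open>Freeness gives uniqueness among extensional families only; passing to
    \<open>restrict d E\<close> makes it usable for arbitrary coefficient functions.\<close>
  have uniq: "c x e = d e" if "d \<in> E \<rightarrow> carrier A" "x = (\<Oplus>\<^bsub>M\<^esub>e\<in>E. d e \<odot>\<^bsub>M\<^esub> e)" "e \<in> E" for x d e
  proof -
    have x: "x \<in> carrier M"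
      unfolding that(2) by (rule M.M.finsum_closed) (use that(1) E in auto)
    have "x = (\<Oplus>\<^bsub>M\<^esub>e\<in>E. restrict d E e \<odot>\<^bsub>M\<^esub> e)"
      unfolding that(2) by (rule M.M.finsum_cong') (use that(1) E in \<open>auto simp: Pi_iff subset_iff\<close>)
    then have "c x = restrict d E"
      using the1_equality[OF ex1[OF x]] restrict_PiE_iff[of d E "\<lambda>_. carrier A"] that(1)
      by (simp only: c_def Pi_iff)
    then show ?thesis using that(3) by simp
  qed
  have tm: "(\<lambda>e. c x e \<odot>\<^bsub>M\<^esub> e) \<in> E \<rightarrow> carrier M" if "x \<in> carrier M" for x
    using cc[OF that] E by auto
  have add: "c (x \<oplus>\<^bsub>M\<^esub> y) e = c x e \<oplus>\<^bsub>A\<^esub> c y e" if "x \<in> carrier M" "y \<in> carrier M" "e \<in> E" for x y e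
  proof (rule uniq[of "\<lambda>e. c x e \<oplus>\<^bsub>A\<^esub> c y e"])
    have "x \<oplus>\<^bsub>M\<^esub> y = (\<Oplus>\<^bsub>M\<^esub>e\<in>E. c x e \<odot>\<^bsub>M\<^esub> e) \<oplus>\<^bsub>M\<^esub> (\<Oplus>\<^bsub>M\<^esub>e\<in>E. c y e \<odot>\<^bsub>M\<^esub> e)"
      using c(2)[OF that(1)] c(2)[OF that(2)] by simp
    also have "\<dots> = (\<Oplus>\<^bsub>M\<^esub>e\<in>E. c x e \<odot>\<^bsub>M\<^esub> e \<oplus>\<^bsub>M\<^esub> c y e \<odot>\<^bsub>M\<^esub> e)"
      by (rule M.M.finsum_addf[symmetric]) (use tm that in auto)
    also have "\<dots> = (\<Oplus>\<^bsub>M\<^esub>e\<in>E. (c x e \<oplus>\<^bsub>A\<^esub> c y e) \<odot>\<^bsub>M\<^esub> e)"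
      by (rule M.M.finsum_cong') (use that cc E in \<open>auto simp: M.smult_l_distr subset_iff\<close>)
    finally show "x \<oplus>\<^bsub>M\<^esub> y = (\<Oplus>\<^bsub>M\<^esub>e\<in>E. (c x e \<oplus>\<^bsub>A\<^esub> c y e) \<odot>\<^bsub>M\<^esub> e)" .
  qed (use cc that in auto)
  have smult: "c (a \<odot>\<^bsub>M\<^esub> x) e = a \<otimes>\<^bsub>A\<^esub> c x e" if "a \<in> carrier A" "x \<in> carrier M" "e \<in> E" for a x e
  proof (rule uniq[of "\<lambda>e. a \<otimes>\<^bsub>A\<^esub> c x e"])
    have "a \<odot>\<^bsub>M\<^esub> x = a \<odot>\<^bsub>M\<^esub> (\<Oplus>\<^bsub>M\<^esub>e\<in>E. c x e \<odot>\<^bsub>M\<^esub> e)"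
      using c(2)[OF that(2)] by simp
    also have "\<dots> = (\<Oplus>\<^bsub>M\<^esub>e\<in>E. a \<odot>\<^bsub>M\<^esub> (c x e \<odot>\<^bsub>M\<^esub> e))"
      by (rule M.finsum_smult_ldistr) (use tm E that in auto)
    also have "\<dots> = (\<Oplus>\<^bsub>M\<^esub>e\<in>E. (a \<otimes>\<^bsub>A\<^esub> c x e) \<odot>\<^bsub>M\<^esub> e)"
      by (rule M.M.finsum_cong') (use that cc E in \<open>auto simp: M.smult_assoc1 subset_iff\<close>)
    finally show "a \<odot>\<^bsub>M\<^esub> x = (\<Oplus>\<^bsub>M\<^esub>e\<in>E. (a \<otimes>\<^bsub>A\<^esub> c x e) \<odot>\<^bsub>M\<^esub> e)" .
  qed (use cc that in auto)
  have \<delta>: "c e' e = (if e = e' then \<one>\<^bsub>A\<^esub> else \<zero>\<^bsub>A\<^esub>)" if "e \<in> E" "e' \<in> E" for e e'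
  proof (rule uniq[of "\<lambda>e. if e = e' then \<one>\<^bsub>A\<^esub> else \<zero>\<^bsub>A\<^esub>"])
    have "(\<Oplus>\<^bsub>M\<^esub>e\<in>E. (if e = e' then \<one>\<^bsub>A\<^esub> else \<zero>\<^bsub>A\<^esub>) \<odot>\<^bsub>M\<^esub> e)
        = (\<Oplus>\<^bsub>M\<^esub>e\<in>E. if e' = e then e else \<zero>\<^bsub>M\<^esub>)"
      by (rule M.M.finsum_cong') (use E in auto)
    also have "\<dots> = e'" by (rule M.M.finsum_singleton[OF that(2) E(2)]) (use E in auto)
    finally show "e' = (\<Oplus>\<^bsub>M\<^esub>e\<in>E. (if e = e' then \<one>\<^bsub>A\<^esub> else \<zero>\<^bsub>A\<^esub>) \<odot>\<^bsub>M\<^esub> e)" ..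
  qed (use that in auto)
  have "dual_basis A M E (\<lambda>e. e) (\<lambda>e x. c x e)"
    unfolding dual_basis_def functionals_def
    using E \<delta> c(2) by (intro conjI ballI) (auto simp: lin_def cc add smult)
  then show ?thesis by blast
qed

section \<open>Coordinates on B \<otimes> M with values in B\<close>

lemma dual_basis_tensor_eq:
  assumes B: "module A B" and M: "module A M" and db: "dual_basis A M J e \<xi>"
    and S: "S \<in> carrier (tensor_product A B M)" and T: "T \<in> carrier (tensor_product A B M)"
    and eq: "\<And>j. j \<in> J \<Longrightarrow> teval B (\<xi> j) S = teval B (\<xi> j) T"
  shows "S = T"
proof -
  interpret T: module A "tensor_product A B M" by (rule tensor_module[OF B M])
  interpret B: module A B by fact
  have "S \<ominus>\<^bsub>tensor_product A B M\<^esub> T = \<zero>\<^bsub>tensor_product A B M\<^esub>"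
  proof (rule dual_basis_tensor_zero[OF B M db])
    fix j assume j: "j \<in> J"
    note l = teval_lin[OF B M dual_basisD(3)[OF db j]]
    show "teval B (\<xi> j) (S \<ominus>\<^bsub>tensor_product A B M\<^esub> T) = \<zero>\<^bsub>B\<^esub>"
      using lin_minus[OF l tensor_module[OF B M] B S T] eq[OF j] lin_closed[OF l T]
      by (simp add: a_minus_def B.M.r_neg)
  qed (use S T in simp)
  moreover have "S = (S \<ominus>\<^bsub>tensor_product A B M\<^esub> T) \<oplus>\<^bsub>tensor_product A B M\<^esub> T"
    using S T by (simp add: a_minus_def T.M.a_assoc T.M.l_neg)
  ultimately show ?thesis using T by simp
qed

text \<open>The sum of the c_j \<otimes> e_j has the prescribed coordinates. Together with
  \<open>dual_basis_tensor_eq\<close> this identifies B \<otimes> M with the families in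
  \<open>B\<close> indexed by \<open>J\<close>.\<close>

lemma dual_basis_tensor_exists:
  assumes B: "module A B" and M: "module A M" and db: "dual_basis A M J e \<xi>"
    and c: "c \<in> J \<rightarrow> carrier B"
  shows "\<exists>S\<in>carrier (tensor_product A B M). \<forall>j\<in>J. teval B (\<xi> j) S = c j"
proof -
  interpret T: module A "tensor_product A B M" by (rule tensor_module[OF B M])
  interpret B: module A B by fact
  note e = dual_basisD(2)[OF db] and fin = dual_basisD(1)[OF db]
  define S where "S = (\<Oplus>\<^bsub>tensor_product A B M\<^esub>j\<in>J. pure_tensor A B M (c j) (e j))"
  have cl: "(\<lambda>j. pure_tensor A B M (c j) (e j)) \<in> J \<rightarrow> carrier (tensor_product A B M)"
    using c e by (auto intro!: pure_closed[OF B M])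
  have "S \<in> carrier (tensor_product A B M)" unfolding S_def using cl by (rule T.M.finsum_closed)
  moreover have "teval B (\<xi> j) S = c j" if j: "j \<in> J" for j
  proof -
    note \<xi> = dual_basisD(3)[OF db j]
    have "teval B (\<xi> j) S = (\<Oplus>\<^bsub>B\<^esub>i\<in>J. teval B (\<xi> j) (pure_tensor A B M (c i) (e i)))"
      unfolding S_def by (rule lin_finsum[OF teval_lin[OF B M \<xi>] tensor_module[OF B M] B fin cl])
    also have "\<dots> = (\<Oplus>\<^bsub>B\<^esub>i\<in>J. if j = i then c i else \<zero>\<^bsub>B\<^esub>)"
    proof (rule B.M.finsum_cong')
      fix i assume i: "i \<in> J"
      then have "c i \<in> carrier B" using c by auto
      then show "teval B (\<xi> j) (pure_tensor A B M (c i) (e i)) = (if j = i then c i else \<zero>\<^bsub>B\<^esub>)"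
        by (simp add: teval_pure[OF B M \<xi> _ e[OF i]] dual_basisD(4)[OF db j i])
    qed (use c in auto)
    also have "\<dots> = c j" by (rule B.M.finsum_singleton[OF j fin c])
    finally show ?thesis .
  qed
  ultimately show ?thesis by blast
qed


section \<open>Bilinear maps on tensor products\<close>

text \<open>\<open>(x \<otimes> y, x' \<otimes> y') \<mapsto> \<beta> x x' \<otimes> \<beta>' y y'\<close>\<close>

definition tbil where
  "tbil A M N \<beta> \<beta>' S T = tensor_lift (tensor_group A M N) (\<lambda>(x, y).
     tensor_lift (tensor_group A M N) (\<lambda>(x', y'). pure_tensor A M N (\<beta> x x') (\<beta>' y y')) T) S"

text \<open>\<open>f \<otimes> id\<close> on \<open>B \<otimes>\<^sub>A M\<close>\<close>

definition tmapl where
  "tmapl A B M f = tensor_lift (tensor_group A B M) (\<lambda>(b, x). pure_tensor A B M (f b) x)"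

lemma tmapl:
  assumes B: "module A B" and M: "module A M" and f: "lin A B B f"
  shows tmapl_lin: "lin A (tensor_product A B M) (tensor_product A B M) (tmapl A B M f)"
    and tmapl_pure: "\<lbrakk>b \<in> carrier B; x \<in> carrier M\<rbrakk> \<Longrightarrow>
      tmapl A B M f (pure_tensor A B M b x) = pure_tensor A B M (f b) x"
proof -
  have b: "bilinear A B M (tensor_product A B M) (\<lambda>b x. pure_tensor A B M (f b) x)"
    by (simp add: bilinear_def lin_def linD[OF f] bilinearD[OF pure_bilinear[OF B M]])
  show "lin A (tensor_product A B M) (tensor_product A B M) (tmapl A B M f)"
    unfolding tmapl_def tensor_lift_add_monoid by (rule tlift_lin[OF B M tensor_module[OF B M] b])
  show "\<lbrakk>b \<in> carrier B; x \<in> carrier M\<rbrakk> \<Longrightarrow>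
      tmapl A B M f (pure_tensor A B M b x) = pure_tensor A B M (f b) x" for b x
    unfolding tmapl_def tensor_lift_add_monoid
    by (rule tlift_pure[OF B M tensor_abelian_group[OF B M] bilinear_balanced[OF b]])
qed

context
  fixes A :: "('a, 'x) ring_scheme" and M1 :: "('a, 'm1, 'x1) module_scheme"
    and N1 :: "('a, 'n1, 'y1) module_scheme" and M2 :: "('a, 'm2, 'x2) module_scheme"
    and N2 :: "('a, 'n2, 'y2) module_scheme" and M :: "('a, 'm, 'x3) module_scheme"
    and N :: "('a, 'n, 'y3) module_scheme" and \<beta> \<beta>'
  assumes M1: "module A M1" and N1: "module A N1" and M2: "module A M2" and N2: "module A N2"
    and M: "module A M" and N: "module A N"
    and \<beta>: "bilinear A M1 M2 M \<beta>" and \<beta>': "bilinear A N1 N2 N \<beta>'"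
begin

lemma tbil_inner:
  assumes "x \<in> carrier M1" "y \<in> carrier N1"
  shows "bilinear A M2 N2 (tensor_product A M N) (\<lambda>x' y'. pure_tensor A M N (\<beta> x x') (\<beta>' y y'))"
  using assms
  by (simp add: bilinear_def lin_def bilinearD[OF \<beta>] bilinearD[OF \<beta>'] bilinearD[OF pure_bilinear[OF M N]])

lemma tbil_inner_lin:
  assumes "x \<in> carrier M1" "y \<in> carrier N1"
  shows "lin A (tensor_product A M2 N2) (tensor_product A M N)
    (tensor_lift (tensor_group A M N) (\<lambda>(x', y'). pure_tensor A M N (\<beta> x x') (\<beta>' y y')))"
  unfolding tensor_lift_add_monoid
  by (rule tlift_lin[OF M2 N2 tensor_module[OF M N] tbil_inner[OF assms]])

lemma tbil_inner_pure:
  assumes "x \<in> carrier M1" "y \<in> carrier N1" "x' \<in> carrier M2" "y' \<in> carrier N2"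
  shows "tensor_lift (tensor_group A M N) (\<lambda>(x', y'). pure_tensor A M N (\<beta> x x') (\<beta>' y y'))
    (pure_tensor A M2 N2 x' y') = pure_tensor A M N (\<beta> x x') (\<beta>' y y')"
  unfolding tensor_lift_add_monoid
  by (rule tlift_pure[OF M2 N2 tensor_abelian_group[OF M N] bilinear_balanced[OF tbil_inner[OF assms(1,2)]] assms(3,4)])

text \<open>For fixed x and y the inner lift is linear in its argument, so every identity in x or y
  is one between linear maps of \<open>T\<close> and may be checked at pure
  \<open>T\<close>.\<close>

lemma tbil_outer:
  assumes T: "T \<in> carrier (tensor_product A M2 N2)"
  shows "bilinear A M1 N1 (tensor_product A M N)
    (\<lambda>x y. tensor_lift (tensor_group A M N) (\<lambda>(x', y'). pure_tensor A M N (\<beta> x x') (\<beta>' y y')) T)"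
proof -
  interpret M1: module A M1 by (rule M1)
  interpret N1: module A N1 by (rule N1)
  let ?T = "tensor_product A M N"
  note TM = tensor_module[OF M N]
  define L where "L x y = tensor_lift (tensor_group A M N) (\<lambda>(x', y'). pure_tensor A M N (\<beta> x x') (\<beta>' y y'))" for x y
  note Ll = tbil_inner_lin[folded L_def] and Lp = tbil_inner_pure[folded L_def]
  note eq = tensor_lin_eq[OF M2 N2 TM _ _ _ T]
  note p = bilinearD[OF pure_bilinear[OF M N]]
  have a: "L x (y \<oplus>\<^bsub>N1\<^esub> y') T = L x y T \<oplus>\<^bsub>?T\<^esub> L x y' T"
    if "x \<in> carrier M1" "y \<in> carrier N1" "y' \<in> carrier N1" for x y y'
    by (rule eq[OF Ll lin_plus[OF TM Ll Ll]])
      (use that in \<open>simp_all add: Lp bilinearD[OF \<beta>] bilinearD[OF \<beta>'] p\<close>)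
  have b: "L x (a \<odot>\<^bsub>N1\<^esub> y) T = a \<odot>\<^bsub>?T\<^esub> L x y T"
    if "x \<in> carrier M1" "y \<in> carrier N1" "a \<in> carrier A" for x y a
    by (rule eq[OF Ll lin_scale[OF TM Ll]])
      (use that in \<open>simp_all add: Lp bilinearD[OF \<beta>] bilinearD[OF \<beta>'] p\<close>)
  have c: "L (x \<oplus>\<^bsub>M1\<^esub> x') y T = L x y T \<oplus>\<^bsub>?T\<^esub> L x' y T"
    if "x \<in> carrier M1" "x' \<in> carrier M1" "y \<in> carrier N1" for x y x'
    by (rule eq[OF Ll lin_plus[OF TM Ll Ll]])
      (use that in \<open>simp_all add: Lp bilinearD[OF \<beta>] bilinearD[OF \<beta>'] p\<close>)
  have d: "L (a \<odot>\<^bsub>M1\<^esub> x) y T = a \<odot>\<^bsub>?T\<^esub> L x y T"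
    if "x \<in> carrier M1" "y \<in> carrier N1" "a \<in> carrier A" for x y a
    by (rule eq[OF Ll lin_scale[OF TM Ll]])
      (use that in \<open>simp_all add: Lp bilinearD[OF \<beta>] bilinearD[OF \<beta>'] p\<close>)
  have "bilinear A M1 N1 ?T (\<lambda>x y. L x y T)"
    unfolding bilinear_def lin_def using T by (simp add: a b c d Ll[THEN lin_closed])
  then show ?thesis by (simp add: L_def)
qed

lemma tbil_pure_left:
  assumes T: "T \<in> carrier (tensor_product A M2 N2)" and "x \<in> carrier M1" "y \<in> carrier N1"
  shows "tbil A M N \<beta> \<beta>' (pure_tensor A M1 N1 x y) T =
    tensor_lift (tensor_group A M N) (\<lambda>(x', y'). pure_tensor A M N (\<beta> x x') (\<beta>' y y')) T"
  unfolding tbil_def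
  by (subst (1) tensor_lift_add_monoid,
    rule tlift_pure[OF M1 N1 tensor_abelian_group[OF M N] bilinear_balanced[OF tbil_outer[OF T]] assms(2,3)])

lemma tbil_pure:
  assumes "x \<in> carrier M1" "y \<in> carrier N1" "x' \<in> carrier M2" "y' \<in> carrier N2"
  shows "tbil A M N \<beta> \<beta>' (pure_tensor A M1 N1 x y) (pure_tensor A M2 N2 x' y') =
    pure_tensor A M N (\<beta> x x') (\<beta>' y y')"
  using assms by (simp add: tbil_pure_left pure_closed[OF M2 N2] tbil_inner_pure)

text \<open>Linearity in \<open>S\<close> is that of the outer lift. For linearity in
  \<open>T\<close>, both sides are linear in \<open>S\<close>, so \<open>S\<close> may be taken
  pure, and there \<open>tbil\<close> is the inner lift.\<close>

lemma tbil_bilinear: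
  "bilinear A (tensor_product A M1 N1) (tensor_product A M2 N2) (tensor_product A M N) (tbil A M N \<beta> \<beta>')"
proof -
  let ?T1 = "tensor_product A M1 N1"
  let ?T2 = "tensor_product A M2 N2"
  let ?T = "tensor_product A M N"
  note TM = tensor_module[OF M N]
  interpret T: module A ?T by (rule TM)
  interpret T2: module A ?T2 by (rule tensor_module[OF M2 N2])
  have left: "lin A ?T1 ?T (\<lambda>S. tbil A M N \<beta> \<beta>' S T)" if T: "T \<in> carrier ?T2" for T
    unfolding tbil_def
    by (subst (1) tensor_lift_add_monoid, rule tlift_lin[OF M1 N1 TM tbil_outer[OF T]])
  have eq: "f S = g S" if "S \<in> carrier ?T1" "lin A ?T1 ?T f" "lin A ?T1 ?T g"
    "\<And>x y. \<lbrakk>x \<in> carrier M1; y \<in> carrier N1\<rbrakk> \<Longrightarrow> f (pure_tensor A M1 N1 x y) = g (pure_tensor A M1 N1 x y)" for f g S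
    by (rule tensor_lin_eq[OF M1 N1 TM that(2,3,4,1)])
  have add: "tbil A M N \<beta> \<beta>' S (T \<oplus>\<^bsub>?T2\<^esub> T') = tbil A M N \<beta> \<beta>' S T \<oplus>\<^bsub>?T\<^esub> tbil A M N \<beta> \<beta>' S T'"
    if "S \<in> carrier ?T1" "T \<in> carrier ?T2" "T' \<in> carrier ?T2" for S T T'
    by (rule eq[OF that(1) left lin_plus[OF TM left left]])
      (use that in \<open>simp_all add: tbil_pure_left lin_add[OF tbil_inner_lin]\<close>)
  have smult: "tbil A M N \<beta> \<beta>' S (a \<odot>\<^bsub>?T2\<^esub> T) = a \<odot>\<^bsub>?T\<^esub> tbil A M N \<beta> \<beta>' S T"
    if "S \<in> carrier ?T1" "T \<in> carrier ?T2" "a \<in> carrier A" for S T a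
    by (rule eq[OF that(1) left lin_scale[OF TM left]])
      (use that in \<open>simp_all add: tbil_pure_left lin_smult[OF tbil_inner_lin]\<close>)
  show ?thesis
    unfolding bilinear_def
    using left add smult lin_closed[OF left] by (auto simp: lin_def)
qed

end

lemma tbil_eqI:
  assumes M: "module A M1" "module A N1" "module A M2" "module A N2" and Y: "module A Y"
    and f: "bilinear A (tensor_product A M1 N1) (tensor_product A M2 N2) Y f"
    and g: "bilinear A (tensor_product A M1 N1) (tensor_product A M2 N2) Y g"
    and eq: "\<And>x y x' y'. \<lbrakk>x \<in> carrier M1; y \<in> carrier N1; x' \<in> carrier M2; y' \<in> carrier N2\<rbrakk> \<Longrightarrow>
      f (pure_tensor A M1 N1 x y) (pure_tensor A M2 N2 x' y') = g (pure_tensor A M1 N1 x y) (pure_tensor A M2 N2 x' y')"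
    and S: "S \<in> carrier (tensor_product A M1 N1)" and T: "T \<in> carrier (tensor_product A M2 N2)"
  shows "f S T = g S T"
proof (rule tensor_lin_eq[OF M(1,2) Y, where f = "\<lambda>S. f S T" and g = "\<lambda>S. g S T"])
  fix x y assume xy: "x \<in> carrier M1" "y \<in> carrier N1"
  note p = pure_closed[OF M(1,2) xy]
  show "f (pure_tensor A M1 N1 x y) T = g (pure_tensor A M1 N1 x y) T"
    by (rule tensor_lin_eq[OF M(3,4) Y bilinear_right[OF f p] bilinear_right[OF g p] eq[OF xy] T])
qed (use bilinear_left[OF f T] bilinear_left[OF g T] S in simp_all)


section \<open>Restriction of scalars\<close>

locale algebra_module = algebra?: assoc_algebra A \<Lambda> + lmod?: left_module \<Lambda> P
  for A :: "'a ring" and \<Lambda> :: "('a, 'l) module" and P :: "('l, 'p) module"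
begin

abbreviation P0 where "P0 \<equiv> restrict_scalars \<Lambda> P"

lemma P0_simps [simp]:
  "carrier P0 = carrier P" "ring.zero P0 = ring.zero P" "ring.add P0 = ring.add P"
  "a \<odot>\<^bsub>P0\<^esub> p = (a \<odot>\<^bsub>\<Lambda>\<^esub> \<one>\<^bsub>\<Lambda>\<^esub>) \<odot>\<^bsub>P\<^esub> p"
  by (simp_all add: restrict_scalars_def)

lemma \<Lambda>_module: "module A \<Lambda>"
  by (rule module_axioms)

lemma A_cring: "cring A"
  using \<Lambda>_module by (simp add: module_def)

lemma P_abelian_group: "abelian_group P"
  by (rule lmod.M.abelian_group_axioms)

text \<open>The image of \<open>A\<close> in \<Lambda> is central; hence \<Lambda> acts on
  \<open>P0\<close> by \<open>A\<close>-linear maps.\<close>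

lemma scalar_central:
  assumes "a \<in> carrier A" "x \<in> carrier \<Lambda>"
  shows "(a \<odot>\<^bsub>\<Lambda>\<^esub> \<one>\<^bsub>\<Lambda>\<^esub>) \<otimes>\<^bsub>\<Lambda>\<^esub> x = a \<odot>\<^bsub>\<Lambda>\<^esub> x" "x \<otimes>\<^bsub>\<Lambda>\<^esub> (a \<odot>\<^bsub>\<Lambda>\<^esub> \<one>\<^bsub>\<Lambda>\<^esub>) = a \<odot>\<^bsub>\<Lambda>\<^esub> x"
  using assms by (simp_all add: smult_mult_left smult_mult_right)

lemma P0_module: "module A P0"
proof (rule moduleI[OF A_cring])
  show "abelian_group P0" by (rule abelian_group_cong[OF P_abelian_group]) simp_all
qed (simp_all add: lmod.smult_closed lmod.smult_l_distr lmod.smult_r_distr lmod.smult_one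
    algebra.smult_l_distr algebra.smult_assoc1 lmod.smult_assoc[symmetric] scalar_central(1))

lemma act_bilinear: "bilinear A \<Lambda> P0 P0 (\<lambda>x p. x \<odot>\<^bsub>P\<^esub> p)"
  unfolding bilinear_def lin_def
  by (simp add: lmod.smult_closed lmod.smult_l_distr lmod.smult_r_distr lmod.smult_assoc[symmetric] scalar_central)

end

lemma mult_bilinear: "assoc_algebra A B \<Longrightarrow> bilinear A B B B (monoid.mult B)"
proof -
  assume "assoc_algebra A B"
  then interpret assoc_algebra A B .
  show ?thesis
    unfolding bilinear_def lin_def
    by (simp add: smult_mult_left smult_mult_right M.l_distr M.r_distr)
qed

lemma mult_bilinear_op: "assoc_algebra A B \<Longrightarrow> bilinear A B B B (\<lambda>x y. y \<otimes>\<^bsub>B\<^esub> x)"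
  using mult_bilinear[of A B] by (simp add: bilinear_def)

text \<open>Recognizing the action on \<open>PB\<close> as a \<open>tbil\<close> makes its
  bilinearity and its values on pure tensors instances of the general facts.\<close>

lemma extend_module_simps:
  "carrier (extend_module A B \<Lambda> P) = carrier (tensor_product A B (restrict_scalars \<Lambda> P))"
  "ring.zero (extend_module A B \<Lambda> P) = ring.zero (tensor_product A B (restrict_scalars \<Lambda> P))"
  "ring.add (extend_module A B \<Lambda> P) = ring.add (tensor_product A B (restrict_scalars \<Lambda> P))"
  "smult (extend_module A B \<Lambda> P) = tbil A B (restrict_scalars \<Lambda> P) (monoid.mult B) (smult P)"
  by (simp_all add: extend_module_def Let_def tbil_def[abs_def])

lemma tmapl_id:
  assumes B: "module A B" and M: "module A M" and f: "\<And>b. b \<in> carrier B \<Longrightarrow> f b = b"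
    and T: "T \<in> carrier (tensor_product A B M)"
  shows "tmapl A B M f T = T"
proof -
  have l: "lin A B B f" by (rule lin_cong[OF lin_id f B])
  show ?thesis
    by (rule tensor_lin_eq[OF B M tensor_module[OF B M] tmapl_lin[OF B M l] lin_id _ T])
      (simp add: tmapl_pure[OF B M l] f)
qed

section \<open>Systems of linear maps as systems of functionals\<close>

lemma dual_basis_functional_zero:
  assumes M: "module A M" and db: "dual_basis A M J e \<xi>" and x: "x \<in> carrier M"
    and "\<And>j. j \<in> J \<Longrightarrow> \<xi> j x = \<zero>\<^bsub>A\<^esub>"
  shows "x = \<zero>\<^bsub>M\<^esub>"
proof -
  interpret M: module A M by fact
  have "x = (\<Oplus>\<^bsub>M\<^esub>j\<in>J. \<xi> j x \<odot>\<^bsub>M\<^esub> e j)" by (rule dual_basisD(5)[OF db x])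
  also have "\<dots> = (\<Oplus>\<^bsub>M\<^esub>j\<in>J. \<zero>\<^bsub>M\<^esub>)"
    by (rule M.M.finsum_cong') (use assms(4) dual_basisD(2)[OF db] in auto)
  finally show ?thesis by simp
qed

text \<open>The joint kernel of linear maps \<open>f\<close> in \<open>fs\<close>, described by functionals: the coordinates of the \<open>f x\<close>.\<close>

definition coordinate_functionals where
  "coordinate_functionals D \<eta> fs = {\<lambda>x. \<eta> j (f x) |j f. j \<in> D \<and> f \<in> fs}"

context
  fixes A :: "('a, 'x) ring_scheme" and M :: "('a, 'm, 'y) module_scheme" and N :: "('a, 'n, 'z) module_scheme"
    and D e \<eta> fs
  assumes M: "module A M" and N: "module A N" and db: "dual_basis A N D e \<eta>"
    and fs: "\<And>f. f \<in> fs \<Longrightarrow> lin A M N f"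
begin

lemma coordinate_functionals_subset: "coordinate_functionals D \<eta> fs \<subseteq> functionals A M"
  using lin_compose[OF fs dual_basisD(3)[OF db]]
  by (auto simp: coordinate_functionals_def functionals_def)

lemma coordinate_functionals_kernel:
  "x \<in> common_kernel A M (coordinate_functionals D \<eta> fs) \<longleftrightarrow>
    x \<in> carrier M \<and> (\<forall>f\<in>fs. f x = \<zero>\<^bsub>N\<^esub>)"
proof -
  interpret N: module A N by (rule N)
  have z: "\<eta> j \<zero>\<^bsub>N\<^esub> = \<zero>\<^bsub>A\<^esub>" if "j \<in> D" for j
    using lin_zero[OF dual_basisD(3)[OF db that] N module_self[OF N.R.is_cring]] by simp
  have "f x = \<zero>\<^bsub>N\<^esub> \<longleftrightarrow> (\<forall>j\<in>D. \<eta> j (f x) = \<zero>\<^bsub>A\<^esub>)" if "f \<in> fs" "x \<in> carrier M" for f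
    using dual_basis_functional_zero[OF N db lin_closed[OF fs[OF that(1)] that(2)]] z by auto
  then show ?thesis by (auto simp: common_kernel_def coordinate_functionals_def)
qed

text \<open>Taking coordinates commutes with base change, by \<open>teval_tmap\<close>, and the base
  changed coordinates detect zero in B \<otimes> N.\<close>

lemma coordinate_functionals_solutions:
  assumes B: "module A B"
  shows "T \<in> tensor_solutions A B M (coordinate_functionals D \<eta> fs) \<longleftrightarrow>
    T \<in> carrier (tensor_product A B M) \<and> (\<forall>f\<in>fs. tmap A B N f T = \<zero>\<^bsub>tensor_product A B N\<^esub>)"
proof -
  have z: "teval B (\<eta> j) \<zero>\<^bsub>tensor_product A B N\<^esub> = \<zero>\<^bsub>B\<^esub>" if "j \<in> D" for j
    by (rule lin_zero[OF teval_lin[OF B N dual_basisD(3)[OF db that]] tensor_module[OF B N] B])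
  have "tmap A B N f T = \<zero>\<^bsub>tensor_product A B N\<^esub> \<longleftrightarrow> (\<forall>j\<in>D. teval B (\<lambda>x. \<eta> j (f x)) T = \<zero>\<^bsub>B\<^esub>)"
    if f: "f \<in> fs" and T: "T \<in> carrier (tensor_product A B M)" for f
    using teval_tmap[OF B M N fs[OF f] dual_basisD(3)[OF db] T]
      dual_basis_tensor_zero[OF B N db lin_closed[OF tmap_lin[OF B M N fs[OF f]] T]] z
    by auto
  then show ?thesis by (auto simp: tensor_solutions_def coordinate_functionals_def)
qed

end

section \<open>Annihilators\<close>

text \<open>\<open>Phi\<close> is the base change of the inclusion of the annihilator. The formula
  names only the target; the source B \<otimes> Ann enters through the argument.\<close>

lemma Phi_tmap: "Phi A B \<Lambda> = tmap A B \<Lambda> (\<lambda>x. x)"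
  by (simp add: Phi_def tmap_def tensor_lift_add_monoid)

context algebra_module
begin

definition actions where "actions = (\<lambda>p x. x \<odot>\<^bsub>P\<^esub> p) ` carrier P"

lemma actions_lin: "f \<in> actions \<Longrightarrow> lin A \<Lambda> P0 f"
  using bilinear_left[OF act_bilinear] by (auto simp: actions_def)

lemma annihilator_kernel:
  assumes "dual_basis A P0 D e \<eta>"
  shows "annihilator \<Lambda> P = common_kernel A \<Lambda> (coordinate_functionals D \<eta> actions)"
  using coordinate_functionals_kernel[OF \<Lambda>_module P0_module assms actions_lin]
  by (auto simp: annihilator_def actions_def)

end

section \<open>The extended module and its annihilator\<close>

locale algebra_module_extension = algebra_module A \<Lambda> P
  for A :: "'a ring" and \<Lambda> :: "('a, 'l) module" and P :: "('l, 'p) module" +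
  fixes B :: "('a, 'b) module"
  assumes B: "assoc_algebra A B"
begin

lemma B_module: "module A B"
  using B by (rule assoc_algebra.axioms)

abbreviation "PB \<equiv> extend_module A B \<Lambda> P"

lemma extended_act_bilinear:
  "bilinear A (tensor_product A B \<Lambda>) (tensor_product A B P0) (tensor_product A B P0) (smult PB)"
  unfolding extend_module_simps
  by (rule tbil_bilinear[OF B_module \<Lambda>_module B_module P0_module B_module P0_module mult_bilinear[OF B] act_bilinear])

lemma extended_act_pure:
  assumes "b \<in> carrier B" "x \<in> carrier \<Lambda>" "b' \<in> carrier B" "p \<in> carrier P"
  shows "pure_tensor A B \<Lambda> b x \<odot>\<^bsub>PB\<^esub> pure_tensor A B P0 b' p = pure_tensor A B P0 (b \<otimes>\<^bsub>B\<^esub> b') (x \<odot>\<^bsub>P\<^esub> p)"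
  unfolding extend_module_simps
  by (rule tbil_pure[OF B_module \<Lambda>_module B_module P0_module B_module P0_module mult_bilinear[OF B] act_bilinear])
    (use assms in simp_all)

text \<open>Acting on b' \<otimes> p separates into evaluation at \<open>p\<close> in the right
  factor and right multiplication by b' in the left one, so the case b' = 1 governs all
  others.\<close>

lemma extended_act_pure_right:
  assumes S: "S \<in> carrier (tensor_product A B \<Lambda>)" and b': "b' \<in> carrier B" and p: "p \<in> carrier P"
  shows "S \<odot>\<^bsub>PB\<^esub> pure_tensor A B P0 b' p =
    tmapl A B P0 (\<lambda>b. b \<otimes>\<^bsub>B\<^esub> b') (tmap A B P0 (\<lambda>x. x \<odot>\<^bsub>P\<^esub> p) S)"
proof -
  note mr = bilinear_left[OF mult_bilinear[OF B] b']
  have p': "p \<in> carrier P0" using p by simp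
  note ar = bilinear_left[OF act_bilinear p']
  note pc = pure_closed[OF B_module P0_module b' p']
  show ?thesis
  proof (rule tensor_lin_eq[OF B_module \<Lambda>_module tensor_module[OF B_module P0_module]
        bilinear_left[OF extended_act_bilinear pc]
        lin_compose[OF tmap_lin[OF B_module \<Lambda>_module P0_module ar] tmapl_lin[OF B_module P0_module mr]] _ S])
    fix b x assume bx: "b \<in> carrier B" "x \<in> carrier \<Lambda>"
    then show "pure_tensor A B \<Lambda> b x \<odot>\<^bsub>PB\<^esub> pure_tensor A B P0 b' p =
        tmapl A B P0 (\<lambda>b. b \<otimes>\<^bsub>B\<^esub> b') (tmap A B P0 (\<lambda>x. x \<odot>\<^bsub>P\<^esub> p) (pure_tensor A B \<Lambda> b x))"
      using lin_closed[OF ar bx(2)] b' p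
      by (simp add: extended_act_pure tmap_pure[OF B_module \<Lambda>_module P0_module ar] tmapl_pure[OF B_module P0_module mr])
  qed
qed

text \<open>\<open>S\<close> kills \<open>PB\<close> exactly when it kills all 1 \<otimes> p, since
  S(b' \<otimes> p) arises from S(1 \<otimes> p) by right multiplication with b'. The remaining
  conditions are the base changed maps x \<mapsto> x p.\<close>

lemma extended_annihilator:
  assumes db: "dual_basis A P0 D e \<eta>"
  shows "annihilator (tensor_product A B \<Lambda>) PB =
    tensor_solutions A B \<Lambda> (coordinate_functionals D \<eta> actions)"
proof (rule Set.set_eqI)
  interpret B: assoc_algebra A B by (rule B)
  interpret T: module A "tensor_product A B P0" by (rule tensor_module[OF B_module P0_module])
  fix S
  have "(\<forall>T\<in>carrier PB. S \<odot>\<^bsub>PB\<^esub> T = \<zero>\<^bsub>PB\<^esub>) \<longleftrightarrow>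
      (\<forall>p\<in>carrier P. tmap A B P0 (\<lambda>x. x \<odot>\<^bsub>P\<^esub> p) S = \<zero>\<^bsub>PB\<^esub>)" (is "?l \<longleftrightarrow> ?r")
    if S: "S \<in> carrier (tensor_product A B \<Lambda>)"
  proof
    assume l: ?l
    show ?r
    proof
      fix p assume p: "p \<in> carrier P"
      then have p': "p \<in> carrier P0" by simp
      note ar = bilinear_left[OF act_bilinear p']
      have "\<zero>\<^bsub>PB\<^esub> = S \<odot>\<^bsub>PB\<^esub> pure_tensor A B P0 \<one>\<^bsub>B\<^esub> p"
        using l pure_closed[OF B_module P0_module B.M.one_closed p'] by (simp add: extend_module_simps(1))
      also have "\<dots> = tmap A B P0 (\<lambda>x. x \<odot>\<^bsub>P\<^esub> p) S"
        unfolding extended_act_pure_right[OF S B.M.one_closed p]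
        by (rule tmapl_id[OF B_module P0_module _ lin_closed[OF tmap_lin[OF B_module \<Lambda>_module P0_module ar] S]]) simp
      finally show "tmap A B P0 (\<lambda>x. x \<odot>\<^bsub>P\<^esub> p) S = \<zero>\<^bsub>PB\<^esub>" ..
    qed
  next
    assume r: ?r
    show ?l
    proof
      fix T assume "T \<in> carrier PB"
      then have T: "T \<in> carrier (tensor_product A B P0)" by (simp add: extend_module_simps)
      show "S \<odot>\<^bsub>PB\<^esub> T = \<zero>\<^bsub>PB\<^esub>"
        unfolding extend_module_simps(2)
      proof (rule tensor_lin_eq[OF B_module P0_module tensor_module[OF B_module P0_module]
            bilinear_right[OF extended_act_bilinear S] lin_const_zero[OF tensor_module[OF B_module P0_module]] _ T])
        fix b' p assume bp: "b' \<in> carrier B" "p \<in> carrier P0"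
        then have "S \<odot>\<^bsub>PB\<^esub> pure_tensor A B P0 b' p = tmapl A B P0 (\<lambda>b. b \<otimes>\<^bsub>B\<^esub> b') \<zero>\<^bsub>tensor_product A B P0\<^esub>"
          using r by (simp add: extended_act_pure_right[OF S] extend_module_simps(2))
        also have "\<dots> = \<zero>\<^bsub>tensor_product A B P0\<^esub>"
          by (rule lin_zero[OF tmapl_lin[OF B_module P0_module bilinear_left[OF mult_bilinear[OF B] bp(1)]]
                tensor_module[OF B_module P0_module] tensor_module[OF B_module P0_module]])
        finally show "S \<odot>\<^bsub>PB\<^esub> pure_tensor A B P0 b' p = \<zero>\<^bsub>tensor_product A B P0\<^esub>" .
      qed
    qed
  qed
  moreover have "S \<in> tensor_solutions A B \<Lambda> (coordinate_functionals D \<eta> actions) \<longleftrightarrow>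
      S \<in> carrier (tensor_product A B \<Lambda>) \<and> (\<forall>p\<in>carrier P. tmap A B P0 (\<lambda>x. x \<odot>\<^bsub>P\<^esub> p) S = \<zero>\<^bsub>PB\<^esub>)"
    using coordinate_functionals_solutions[OF \<Lambda>_module P0_module db actions_lin B_module, where T = S]
    unfolding extend_module_simps(2) actions_def by simp
  ultimately show "S \<in> annihilator (tensor_product A B \<Lambda>) PB \<longleftrightarrow>
      S \<in> tensor_solutions A B \<Lambda> (coordinate_functionals D \<eta> actions)"
    unfolding annihilator_def mem_Collect_eq by (simp only: cong: conj_cong)
qed

end

section \<open>Base change of annihilators\<close>

context algebra_module
begin

lemma algebra_via_extended:
  assumes "field F" "h \<in> ring_hom A F" "a_kernel A F h = m"
  shows "algebra_module_extension A \<Lambda> P (algebra_via h F)" "residue_module A m (algebra_via h F)"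
  unfolding algebra_module_extension_def algebra_module_extension_axioms_def
  using algebra_module_axioms algebra_via_assoc_algebra[OF A_cring assms(1,2)] algebra_via_residue_module[OF A_cring assms(1,2)] assms(3)
  by simp_all

text \<open>Both sides of the hypothesis over \<open>F\<close> translate literally: the image of
  \<open>Phi\<close> is the span of the kernel of \<open>R\<close>, and the annihilator is the
  solution set. This feeds \<open>global_splitting\<close>, and \<open>splitting_base_change\<close>
  reads the translation backwards for \<open>B\<close>.\<close>

theorem annihilator_base_change:
  assumes free: "free_of_finite_rank A \<Lambda>" "free_of_finite_rank A P0"
    and hyp: "\<forall>\<mm>. maximalideal \<mm> A \<longrightarrow>
        (\<exists>(F :: 'f ring) h. field F \<and> h \<in> ring_hom A F \<and> a_kernel A F h = \<mm> \<and>
          (let FA = algebra_via h F in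
            Phi A FA \<Lambda> ` carrier (tensor_product A FA (Ann_module \<Lambda> P)) =
              annihilator (tensor_product A FA \<Lambda>) (extend_module A FA \<Lambda> P)))"
    and B: "assoc_algebra A (B :: ('a, 'b) module)"
  shows "Phi A B \<Lambda> \<in> left_module_iso B (base_change A B (Ann_module \<Lambda> P))
    ((base_change A B \<Lambda>)\<lparr>carrier := annihilator (tensor_product A B \<Lambda>) (extend_module A B \<Lambda> P)\<rparr>)"
proof -
  obtain J \<xi> where db\<Lambda>: "dual_basis A \<Lambda> J (\<lambda>e. e) \<xi>" using free_dual_basis[OF \<Lambda>_module free(1)] by (elim exE)
  obtain D \<eta> where db: "dual_basis A P0 D (\<lambda>e. e) \<eta>" using free_dual_basis[OF P0_module free(2)] by (elim exE)
  define R where "R = coordinate_functionals D \<eta> actions"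
  have R: "R \<subseteq> functionals A \<Lambda>"
    unfolding R_def by (rule coordinate_functionals_subset[OF \<Lambda>_module P0_module db actions_lin])
  have K: "Ann_module \<Lambda> P = \<Lambda>\<lparr>carrier := common_kernel A \<Lambda> R\<rparr>"
    by (simp add: Ann_module_def R_def annihilator_kernel[OF db])
  interpret B: algebra_module_extension A \<Lambda> P B
    by (intro algebra_module_extension.intro algebra_module_extension_axioms.intro algebra_module_axioms B)
  note Bm = B.B_module
  have loc: "\<exists>B :: ('a, 'f) module. module A B \<and> residue_module A m B \<and>
      tensor_solutions A B \<Lambda> R \<subseteq> tspan A B \<Lambda> (common_kernel A \<Lambda> R)" if m: "maximalideal m A" for m
  proof -
    obtain F :: "'f ring" and h where F: "field F" "h \<in> ring_hom A F" "a_kernel A F h = m"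
      and eq: "Phi A (algebra_via h F) \<Lambda> ` carrier (tensor_product A (algebra_via h F) (Ann_module \<Lambda> P)) =
        annihilator (tensor_product A (algebra_via h F) \<Lambda>) (extend_module A (algebra_via h F) \<Lambda> P)"
      using hyp m by (auto simp: Let_def)
    interpret FA: algebra_module_extension A \<Lambda> P "algebra_via h F"
      by (rule algebra_via_extended[OF F])
    have "tensor_solutions A (algebra_via h F) \<Lambda> R = tspan A (algebra_via h F) \<Lambda> (common_kernel A \<Lambda> R)"
      using eq FA.extended_annihilator[OF db] unfolding K Phi_tmap tspan_def R_def by simp
    then show ?thesis using FA.B_module algebra_via_extended(2)[OF F] by blast
  qed
  have "\<exists>\<gamma>\<in>factoring R \<Lambda>. \<forall>\<phi>\<in>R. \<forall>x\<in>carrier \<Lambda>. \<phi> (\<gamma> x) = \<phi> x"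
    by (rule global_splitting[OF \<Lambda>_module db\<Lambda> R loc])
  then obtain \<gamma> where \<gamma>: "\<gamma> \<in> factoring R \<Lambda>" "\<forall>\<phi>\<in>R. \<forall>x\<in>carrier \<Lambda>. \<phi> (\<gamma> x) = \<phi> x"
    by (elim bexE)
  have inj: "inj_on (Phi A B \<Lambda>) (carrier (tensor_product A B (Ann_module \<Lambda> P)))"
    and img: "Phi A B \<Lambda> ` carrier (tensor_product A B (Ann_module \<Lambda> P)) =
      annihilator (tensor_product A B \<Lambda>) (extend_module A B \<Lambda> P)"
    using splitting_base_change[OF \<Lambda>_module Bm R \<gamma>(1)] \<gamma>(2) B.extended_annihilator[OF db]
    unfolding K Phi_tmap tspan_def R_def by simp_all
  note sub = common_kernel_submodule[OF \<Lambda>_module R]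
  have Km: "module A (Ann_module \<Lambda> P)" unfolding K by (rule submodule_module[OF \<Lambda>_module sub])
  have incl: "lin A (Ann_module \<Lambda> P) \<Lambda> (\<lambda>x. x)" unfolding K by (rule lin_inclusion[OF sub])
  have l: "lin A (tensor_product A B (Ann_module \<Lambda> P)) (tensor_product A B \<Lambda>) (Phi A B \<Lambda>)"
    unfolding Phi_tmap by (rule tmap_lin[OF Bm Km \<Lambda>_module incl])
  have smult: "smult (base_change A B N) b = tmapl A B N (\<lambda>b'. b \<otimes>\<^bsub>B\<^esub> b')" for N :: "('a, 'l) module" and b
    by (simp add: base_change_def tmapl_def)
  \<comment> \<open>\<open>B\<close>-linearity: left multiplication acts on the left factor and the
    inclusion on the right one, so they commute.\<close>
  have "Phi A B \<Lambda> (tmapl A B (Ann_module \<Lambda> P) (\<lambda>b'. b \<otimes>\<^bsub>B\<^esub> b') T)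
      = tmapl A B \<Lambda> (\<lambda>b'. b \<otimes>\<^bsub>B\<^esub> b') (Phi A B \<Lambda> T)"
    if b: "b \<in> carrier B" and T: "T \<in> carrier (tensor_product A B (Ann_module \<Lambda> P))" for b T
  proof -
    note ml = bilinear_right[OF mult_bilinear[OF B] b]
    show ?thesis
      unfolding Phi_tmap
      by (rule tensor_lin_eq[OF Bm Km tensor_module[OF Bm \<Lambda>_module]
            lin_compose[OF tmapl_lin[OF Bm Km ml] tmap_lin[OF Bm Km \<Lambda>_module incl]]
            lin_compose[OF tmap_lin[OF Bm Km \<Lambda>_module incl] tmapl_lin[OF Bm \<Lambda>_module ml]] _ T])
        (simp add: tmapl_pure[OF Bm Km ml] tmapl_pure[OF Bm \<Lambda>_module ml] tmap_pure[OF Bm Km \<Lambda>_module incl]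
          lin_closed[OF ml] lin_closed[OF incl])
  qed
  then show ?thesis
    using inj img linD[OF l]
    by (simp add: left_module_iso_def iso_def bij_betw_def hom_def smult)
      (simp add: base_change_def Pi_iff image_subset_iff[symmetric])
qed

end


section \<open>Endomorphism modules\<close>

lemma End_algebra_simps [simp]:
  "ring.zero (End_algebra L Q) = (\<lambda>p\<in>carrier Q. \<zero>\<^bsub>Q\<^esub>)"
  "ring.add (End_algebra L Q) = (\<lambda>f g. \<lambda>p\<in>carrier Q. f p \<oplus>\<^bsub>Q\<^esub> g p)"
  "monoid.mult (End_algebra L Q) = compose (carrier Q)"
  "monoid.one (End_algebra L Q) = (\<lambda>p\<in>carrier Q. p)"
  "smult (End_algebra L Q) = (\<lambda>a f. \<lambda>p\<in>carrier Q. (a \<odot>\<^bsub>L\<^esub> \<one>\<^bsub>L\<^esub>) \<odot>\<^bsub>Q\<^esub> f p)"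
  by (simp_all add: End_algebra_def)

lemma End_algebra_carrier:
  "f \<in> carrier (End_algebra L Q) \<longleftrightarrow> f \<in> extensional (carrier Q) \<and> f \<in> carrier Q \<rightarrow> carrier Q \<and>
    (\<forall>p\<in>carrier Q. \<forall>q\<in>carrier Q. f (p \<oplus>\<^bsub>Q\<^esub> q) = f p \<oplus>\<^bsub>Q\<^esub> f q) \<and>
    (\<forall>x\<in>carrier L. \<forall>p\<in>carrier Q. f (x \<odot>\<^bsub>Q\<^esub> p) = x \<odot>\<^bsub>Q\<^esub> f p)"
  by (auto simp: End_algebra_def PiE_def)

lemma End_algebra_abelian_group:
  assumes Q: "abelian_group Q"
    and closed: "\<And>x p. \<lbrakk>x \<in> carrier L; p \<in> carrier Q\<rbrakk> \<Longrightarrow> x \<odot>\<^bsub>Q\<^esub> p \<in> carrier Q"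
    and distr: "\<And>x p q. \<lbrakk>x \<in> carrier L; p \<in> carrier Q; q \<in> carrier Q\<rbrakk>
      \<Longrightarrow> x \<odot>\<^bsub>Q\<^esub> (p \<oplus>\<^bsub>Q\<^esub> q) = x \<odot>\<^bsub>Q\<^esub> p \<oplus>\<^bsub>Q\<^esub> x \<odot>\<^bsub>Q\<^esub> q"
  shows "abelian_group (End_algebra L Q)"
proof -
  interpret Q: abelian_group Q by fact
  have zero: "x \<odot>\<^bsub>Q\<^esub> \<zero>\<^bsub>Q\<^esub> = \<zero>\<^bsub>Q\<^esub>" if "x \<in> carrier L" for x
    by (rule add_zero[OF Q Q]) (use that closed distr in auto)
  have neg: "x \<odot>\<^bsub>Q\<^esub> (\<ominus>\<^bsub>Q\<^esub> p) = \<ominus>\<^bsub>Q\<^esub> (x \<odot>\<^bsub>Q\<^esub> p)" if "x \<in> carrier L" "p \<in> carrier Q" for x p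
  proof -
    have "x \<odot>\<^bsub>Q\<^esub> (\<ominus>\<^bsub>Q\<^esub> p) \<oplus>\<^bsub>Q\<^esub> x \<odot>\<^bsub>Q\<^esub> p = \<zero>\<^bsub>Q\<^esub>"
      using that by (simp add: distr[symmetric] Q.l_neg zero)
    then show ?thesis using that closed by (metis Q.a_inv_closed Q.minus_equality)
  qed
  note E = End_algebra_carrier[THEN iffD1]
  have fD: "f p \<in> carrier Q" if "f \<in> carrier (End_algebra L Q)" "p \<in> carrier Q" for f p
    using E[OF that(1)] that(2) by auto
  have fa: "f (p \<oplus>\<^bsub>Q\<^esub> q) = f p \<oplus>\<^bsub>Q\<^esub> f q" if "f \<in> carrier (End_algebra L Q)" "p \<in> carrier Q" "q \<in> carrier Q" for f p q
    using E[OF that(1)] that(2,3) by auto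
  have fs: "f (x \<odot>\<^bsub>Q\<^esub> p) = x \<odot>\<^bsub>Q\<^esub> f p" if "f \<in> carrier (End_algebra L Q)" "x \<in> carrier L" "p \<in> carrier Q" for f x p
    using E[OF that(1)] that(2,3) by auto
  have fe: "f \<in> extensional (carrier Q)" if "f \<in> carrier (End_algebra L Q)" for f
    using E[OF that(1)] by auto
  show ?thesis
  proof (rule abelian_groupI)
    fix f g h assume fgh: "f \<in> carrier (End_algebra L Q)" "g \<in> carrier (End_algebra L Q)"
    note [simp] = fD[OF fgh(1)] fD[OF fgh(2)]
    show "f \<oplus>\<^bsub>End_algebra L Q\<^esub> g \<in> carrier (End_algebra L Q)"
      unfolding End_algebra_carrier
      using fgh by (auto simp: closed distr fa fs Q.a_ac)
    show "f \<oplus>\<^bsub>End_algebra L Q\<^esub> g = g \<oplus>\<^bsub>End_algebra L Q\<^esub> f"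
      by (auto simp: Q.a_comm)
    assume "h \<in> carrier (End_algebra L Q)"
    note [simp] = fD[OF this]
    show "(f \<oplus>\<^bsub>End_algebra L Q\<^esub> g) \<oplus>\<^bsub>End_algebra L Q\<^esub> h = f \<oplus>\<^bsub>End_algebra L Q\<^esub> (g \<oplus>\<^bsub>End_algebra L Q\<^esub> h)"
      by (auto simp: Q.a_assoc)
  next
    show "\<zero>\<^bsub>End_algebra L Q\<^esub> \<in> carrier (End_algebra L Q)"
      unfolding End_algebra_carrier by (auto simp: closed zero)
    fix f assume f: "f \<in> carrier (End_algebra L Q)"
    note [simp] = fD[OF f]
    show "\<zero>\<^bsub>End_algebra L Q\<^esub> \<oplus>\<^bsub>End_algebra L Q\<^esub> f = f"
      by (rule extensionalityI[of _ "carrier Q"]) (simp_all add: fe[OF f])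
    show "\<exists>g\<in>carrier (End_algebra L Q). g \<oplus>\<^bsub>End_algebra L Q\<^esub> f = \<zero>\<^bsub>End_algebra L Q\<^esub>"
    proof
      show "(\<lambda>p\<in>carrier Q. \<ominus>\<^bsub>Q\<^esub> f p) \<in> carrier (End_algebra L Q)"
        unfolding End_algebra_carrier
        using f by (auto simp: closed neg fa fs Q.minus_add Q.a_comm)
      show "(\<lambda>p\<in>carrier Q. \<ominus>\<^bsub>Q\<^esub> f p) \<oplus>\<^bsub>End_algebra L Q\<^esub> f = \<zero>\<^bsub>End_algebra L Q\<^esub>"
        by (auto simp: Q.l_neg)
    qed
  qed
qed

lemma (in abelian_group) diff_eq_zero_iff:
  assumes "x \<in> carrier G" "y \<in> carrier G"
  shows "x \<ominus> y = \<zero> \<longleftrightarrow> x = y"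
proof
  assume "x \<ominus> y = \<zero>"
  moreover have "x = (x \<ominus> y) \<oplus> y" using assms by (simp add: a_minus_def a_assoc l_neg)
  ultimately show "x = y" using assms by simp
qed (use assms in \<open>simp add: a_minus_def r_neg\<close>)

lemma bilinear_comp:
  assumes "bilinear A M N L \<beta>" "lin A L L' g"
  shows "bilinear A M N L' (\<lambda>x y. g (\<beta> x y))"
  unfolding bilinear_def
  by (intro conjI ballI lin_compose[OF bilinear_right[OF assms(1)] assms(2)]
      lin_compose[OF bilinear_left[OF assms(1)] assms(2)])

lemma bilinear_comp_right:
  assumes "bilinear A M N L \<beta>" "lin A N' N g"
  shows "bilinear A M N' L (\<lambda>x y. \<beta> x (g y))"
  unfolding bilinear_def
  by (intro conjI ballI lin_compose[OF assms(2) bilinear_right[OF assms(1)]]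
      bilinear_left[OF assms(1)] lin_closed[OF assms(2)])

lemma bilinear_comp_left:
  assumes "bilinear A M N L \<beta>" "lin A M' M g"
  shows "bilinear A M' N L (\<lambda>x y. \<beta> (g x) y)"
  unfolding bilinear_def
  by (intro conjI ballI lin_compose[OF assms(2) bilinear_left[OF assms(1)]]
      bilinear_right[OF assms(1)] lin_closed[OF assms(2)])

section \<open>The A-linear endomorphisms of P and the equations for \<Lambda>-linearity\<close>

context algebra_module
begin

text \<open>End_A(P), built by enlarging the carrier of \<open>End_algebra \<Lambda> P\<close>.
  Conversely End_\<Lambda>(P) is then \<open>EA\<close> with a smaller carrier, the exact shape in
  which submodules are handled here.\<close>

definition EA where
  "EA = (End_algebra \<Lambda> P)\<lparr>carrier := {f \<in> extensional (carrier P). lin A P0 P0 f}\<rparr>"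

abbreviation "E\<Lambda> \<equiv> End_algebra \<Lambda> P"

lemma EA_simps [simp]:
  "ring.zero EA = (\<lambda>p\<in>carrier P. \<zero>\<^bsub>P\<^esub>)"
  "ring.add EA = (\<lambda>f g. \<lambda>p\<in>carrier P. f p \<oplus>\<^bsub>P\<^esub> g p)"
  "smult EA = (\<lambda>a f. \<lambda>p\<in>carrier P. (a \<odot>\<^bsub>\<Lambda>\<^esub> \<one>\<^bsub>\<Lambda>\<^esub>) \<odot>\<^bsub>P\<^esub> f p)"
  by (simp_all add: EA_def)

lemma EA_carrier: "f \<in> carrier EA \<longleftrightarrow> f \<in> extensional (carrier P) \<and> lin A P0 P0 f"
  by (simp add: EA_def)

lemma EA_lin: "f \<in> carrier EA \<Longrightarrow> lin A P0 P0 f"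
  by (simp add: EA_carrier)

lemma EA_closed: "\<lbrakk>f \<in> carrier EA; p \<in> carrier P\<rbrakk> \<Longrightarrow> f p \<in> carrier P"
  using lin_closed[OF EA_lin] by simp

lemma EA_eqI:
  assumes "f \<in> carrier EA" "g \<in> carrier EA" "\<And>p. p \<in> carrier P \<Longrightarrow> f p = g p"
  shows "f = g"
  using assms by (intro extensionalityI[of _ "carrier P"]) (simp_all add: EA_carrier)

lemma EA_restrict: "lin A P0 P0 f \<Longrightarrow> (\<lambda>p\<in>carrier P. f p) \<in> carrier EA"
  by (simp add: EA_carrier) (erule lin_cong, simp, rule P0_module)

lemma EA_module: "module A EA"
proof (rule moduleI[OF A_cring])
  interpret P0: module A P0 by (rule P0_module)
  \<comment> \<open>The additive group of \<open>EA\<close> is that of the endomorphisms of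
    \<open>P0\<close> over the ring \<open>A\<close> itself.\<close>
  have "abelian_group (End_algebra (self_module A) P0)"
    by (rule End_algebra_abelian_group[OF P0.abelian_group_axioms])
      (simp_all del: P0_simps add: P0.smult_r_distr)
  then show "abelian_group EA"
    by (rule abelian_group_cong) (auto simp: EA_carrier End_algebra_carrier lin_def)
  fix a f assume a: "a \<in> carrier A" and f: "f \<in> carrier EA"
  show "a \<odot>\<^bsub>EA\<^esub> f \<in> carrier EA"
    using EA_restrict[OF lin_scale[OF P0_module EA_lin[OF f] a]] by simp
qed (auto simp: EA_closed lmod.smult_closed lmod.smult_l_distr lmod.smult_r_distr
    algebra.smult_l_distr algebra.smult_assoc1 lmod.smult_assoc[symmetric] scalar_central(1) lmod.smult_one
    fun_eq_iff EA_carrier extensional_def)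

lemma eval_bilinear: "bilinear A EA P0 P0 (\<lambda>\<alpha> p. \<alpha> p)"
  unfolding bilinear_def using EA_lin by (auto simp: lin_def EA_closed)

text \<open>The value at \<open>p\<close> of the commutator of \<alpha> with the action of
  \<open>x\<close>. Evaluating at \<open>p\<close> makes it a linear map from \<open>EA\<close> to
  the free module \<open>P0\<close>.\<close>

definition commutator where
  "commutator x p = (\<lambda>\<alpha>. \<alpha> (x \<odot>\<^bsub>P\<^esub> p) \<ominus>\<^bsub>P0\<^esub> x \<odot>\<^bsub>P\<^esub> \<alpha> p)"

definition commutators where
  "commutators = (\<lambda>(x, p). commutator x p) ` (carrier \<Lambda> \<times> carrier P)"

lemma eval_lin: "p \<in> carrier P \<Longrightarrow> lin A EA P0 (\<lambda>\<alpha>. \<alpha> p)"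
  using bilinear_left[OF eval_bilinear] by simp

lemma act_lin: "x \<in> carrier \<Lambda> \<Longrightarrow> lin A P0 P0 (\<lambda>p. x \<odot>\<^bsub>P\<^esub> p)"
  using bilinear_right[OF act_bilinear] by simp

lemma commutator_lin:
  assumes "x \<in> carrier \<Lambda>" "p \<in> carrier P" shows "lin A EA P0 (commutator x p)"
  unfolding commutator_def
  using assms by (intro lin_diff[OF P0_module] eval_lin lin_compose[OF eval_lin act_lin] lmod.smult_closed)

lemma commutators_lin: "f \<in> commutators \<Longrightarrow> lin A EA P0 f"
  using commutator_lin by (auto simp: commutators_def)

lemma endomorphism_kernel:
  assumes db: "dual_basis A P0 D e \<eta>"
  shows "carrier E\<Lambda> = common_kernel A EA (coordinate_functionals D \<eta> commutators)"
proof (rule Set.set_eqI)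
  interpret P0: module A P0 by (rule P0_module)
  fix f
  have *: "commutator x p f = \<zero>\<^bsub>P0\<^esub> \<longleftrightarrow> f (x \<odot>\<^bsub>P\<^esub> p) = x \<odot>\<^bsub>P\<^esub> f p"
    if "f \<in> carrier EA" "x \<in> carrier \<Lambda>" "p \<in> carrier P" for x p
    unfolding commutator_def
    by (rule P0.M.diff_eq_zero_iff) (use that in \<open>simp_all add: EA_closed lmod.smult_closed\<close>)
  have "f \<in> carrier E\<Lambda> \<longleftrightarrow> f \<in> carrier EA \<and> (\<forall>x\<in>carrier \<Lambda>. \<forall>p\<in>carrier P. f (x \<odot>\<^bsub>P\<^esub> p) = x \<odot>\<^bsub>P\<^esub> f p)"
    unfolding End_algebra_carrier EA_carrier by (auto simp: lin_def)
  also have "\<dots> \<longleftrightarrow> f \<in> carrier EA \<and> (\<forall>g\<in>commutators. g f = \<zero>\<^bsub>P0\<^esub>)"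
    using * by (auto simp: commutators_def)
  also have "\<dots> \<longleftrightarrow> f \<in> common_kernel A EA (coordinate_functionals D \<eta> commutators)"
    by (rule coordinate_functionals_kernel[OF EA_module P0_module db commutators_lin, symmetric])
  finally show "f \<in> carrier E\<Lambda> \<longleftrightarrow> f \<in> common_kernel A EA (coordinate_functionals D \<eta> commutators)" .
qed

text \<open>The matrix units p \<mapsto> \<eta>_i(p) e_j and the matrix entries \<alpha> \<mapsto>
  \<eta>_j(\<alpha>(e_i)).\<close>

lemma EA_dual_basis:
  assumes db: "dual_basis A P0 D e \<eta>"
  shows "dual_basis A EA (D \<times> D) (\<lambda>(i, j). \<lambda>p\<in>carrier P. \<eta> i p \<odot>\<^bsub>P0\<^esub> e j) (\<lambda>(i, j) \<alpha>. \<eta> j (\<alpha> (e i)))"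
proof -
  interpret P0: module A P0 by (rule P0_module)
  interpret EA: module A EA by (rule EA_module)
  note \<eta> = dual_basisD(3)[OF db] and e = dual_basisD(2)[OF db]
  have e': "e j \<in> carrier P" if "j \<in> D" for j using e[OF that] by simp
  have unit: "(\<lambda>p\<in>carrier P. \<eta> i p \<odot>\<^bsub>P0\<^esub> z) \<in> carrier EA" if "i \<in> D" "z \<in> carrier P" for i z
    using lin_times[OF P0_module \<eta>[OF that(1)]] that(2) by (intro EA_restrict) simp
  show ?thesis
  proof (rule dual_basisI[OF EA_module])
    show "finite (D \<times> D)" using dual_basisD(1)[OF db] by simp
    show "(\<lambda>(i, j). \<lambda>p\<in>carrier P. \<eta> i p \<odot>\<^bsub>P0\<^esub> e j) \<in> D \<times> D \<rightarrow> carrier EA"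
      using unit e' by auto
    show "(\<lambda>(i, j) \<alpha>. \<eta> j (\<alpha> (e i))) ` (D \<times> D) \<subseteq> functionals A EA"
      using lin_compose[OF eval_lin[OF e'] \<eta>] by (auto simp: functionals_def)
    show "(case u of (i, j) \<Rightarrow> \<lambda>\<alpha>. \<eta> j (\<alpha> (e i))) (case v of (i, j) \<Rightarrow> \<lambda>p\<in>carrier P. \<eta> i p \<odot>\<^bsub>P0\<^esub> e j)
        = (if u = v then \<one>\<^bsub>A\<^esub> else \<zero>\<^bsub>A\<^esub>)" if uv: "u \<in> D \<times> D" "v \<in> D \<times> D" for u v
    proof -
      obtain i j k l where u: "u = (i, j)" "v = (k, l)" and D: "i \<in> D" "j \<in> D" "k \<in> D" "l \<in> D"
        using uv by auto
      have "\<eta> j (\<eta> k (e i) \<odot>\<^bsub>P0\<^esub> e l) = \<eta> k (e i) \<otimes>\<^bsub>A\<^esub> \<eta> j (e l)"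
        using lin_smult[OF \<eta>[OF D(2)] _ e[OF D(4)]] lin_closed[OF \<eta>[OF D(3)] e[OF D(1)]] by simp
      also have "\<dots> = (if u = v then \<one>\<^bsub>A\<^esub> else \<zero>\<^bsub>A\<^esub>)"
        using D by (auto simp: u dual_basisD(4)[OF db])
      finally show ?thesis using e'[OF D(1)] by (simp add: u del: P0_simps(4))
    qed
    fix S \<alpha>
    assume S: "S \<subseteq> carrier EA" "\<zero>\<^bsub>EA\<^esub> \<in> S" "\<And>x y. \<lbrakk>x \<in> S; y \<in> S\<rbrakk> \<Longrightarrow> x \<oplus>\<^bsub>EA\<^esub> y \<in> S"
      "\<And>a x. \<lbrakk>a \<in> carrier A; x \<in> S\<rbrakk> \<Longrightarrow> a \<odot>\<^bsub>EA\<^esub> x \<in> S"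
      "\<And>u. u \<in> D \<times> D \<Longrightarrow> (case u of (i, j) \<Rightarrow> \<lambda>p\<in>carrier P. \<eta> i p \<odot>\<^bsub>P0\<^esub> e j) \<in> S"
      and \<alpha>: "\<alpha> \<in> carrier EA"
    \<comment> \<open>For fixed \<open>i\<close>, the \<open>z\<close> for which p \<mapsto>
      \<eta>_i(p) z lies in \<open>S\<close> are closed under addition and scalars and include the
      basis, so they are all of \<open>P0\<close>.\<close>
    have row: "(\<lambda>p\<in>carrier P. \<eta> i p \<odot>\<^bsub>P0\<^esub> z) \<in> S" if i: "i \<in> D" and z: "z \<in> carrier P0" for i z
    proof -
      have \<eta>A: "\<eta> i p \<in> carrier A" if "p \<in> carrier P" for p
        using lin_closed[OF \<eta>[OF i]] that by simp
      have "z \<in> {z \<in> carrier P0. (\<lambda>p\<in>carrier P. \<eta> i p \<odot>\<^bsub>P0\<^esub> z) \<in> S}"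
      proof (rule dual_basis_span[OF P0_module db _ _ _ _ _ z])
        have "(\<lambda>p\<in>carrier P. \<eta> i p \<odot>\<^bsub>P0\<^esub> \<zero>\<^bsub>P0\<^esub>) = \<zero>\<^bsub>EA\<^esub>"
          using P0.smult_r_null[OF \<eta>A] by (auto simp del: P0_simps(4))
        then show "\<zero>\<^bsub>P0\<^esub> \<in> {z \<in> carrier P0. (\<lambda>p\<in>carrier P. \<eta> i p \<odot>\<^bsub>P0\<^esub> z) \<in> S}"
          using S(2) P0.M.zero_closed by (simp del: P0_simps EA_simps)
        show "x \<oplus>\<^bsub>P0\<^esub> y \<in> {z \<in> carrier P0. (\<lambda>p\<in>carrier P. \<eta> i p \<odot>\<^bsub>P0\<^esub> z) \<in> S}"
          if "x \<in> {z \<in> carrier P0. (\<lambda>p\<in>carrier P. \<eta> i p \<odot>\<^bsub>P0\<^esub> z) \<in> S}"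
            "y \<in> {z \<in> carrier P0. (\<lambda>p\<in>carrier P. \<eta> i p \<odot>\<^bsub>P0\<^esub> z) \<in> S}" for x y
        proof -
          have "(\<lambda>p\<in>carrier P. \<eta> i p \<odot>\<^bsub>P0\<^esub> (x \<oplus>\<^bsub>P0\<^esub> y)) =
              (\<lambda>p\<in>carrier P. \<eta> i p \<odot>\<^bsub>P0\<^esub> x) \<oplus>\<^bsub>EA\<^esub> (\<lambda>p\<in>carrier P. \<eta> i p \<odot>\<^bsub>P0\<^esub> y)"
            using that P0.smult_r_distr[OF \<eta>A] by (auto simp: fun_eq_iff simp del: P0_simps(4))
          then show ?thesis using that S(3) P0.M.a_closed by (simp del: P0_simps EA_simps)
        qed
        show "a \<odot>\<^bsub>P0\<^esub> x \<in> {z \<in> carrier P0. (\<lambda>p\<in>carrier P. \<eta> i p \<odot>\<^bsub>P0\<^esub> z) \<in> S}"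
          if "a \<in> carrier A" "x \<in> {z \<in> carrier P0. (\<lambda>p\<in>carrier P. \<eta> i p \<odot>\<^bsub>P0\<^esub> z) \<in> S}" for a x
        proof -
          have "\<eta> i p \<odot>\<^bsub>P0\<^esub> (a \<odot>\<^bsub>P0\<^esub> x) = a \<odot>\<^bsub>P0\<^esub> (\<eta> i p \<odot>\<^bsub>P0\<^esub> x)" if "p \<in> carrier P" for p
            using that \<open>a \<in> carrier A\<close> \<open>x \<in> _\<close> \<eta>A[OF that]
            by (simp del: P0_simps add: P0.smult_assoc1[symmetric] comm_monoid.m_comm[OF cring.axioms(2)[OF A_cring]])
          then have "(\<lambda>p\<in>carrier P. \<eta> i p \<odot>\<^bsub>P0\<^esub> (a \<odot>\<^bsub>P0\<^esub> x)) = a \<odot>\<^bsub>EA\<^esub> (\<lambda>p\<in>carrier P. \<eta> i p \<odot>\<^bsub>P0\<^esub> x)"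
            by (auto simp: fun_eq_iff)
          then show ?thesis using that S(4) P0.smult_closed by (simp del: P0_simps EA_simps)
        qed
        show "e j \<in> {z \<in> carrier P0. (\<lambda>p\<in>carrier P. \<eta> i p \<odot>\<^bsub>P0\<^esub> z) \<in> S}" if "j \<in> D" for j
          using S(5)[of "(i, j)"] i that e by (simp del: P0_simps)
      qed auto
      then show ?thesis by simp
    qed
    \<comment> \<open>\<alpha> is the sum of the maps p \<mapsto> \<eta>_i(p) \<alpha>(e_i), as both
      sides agree on the basis.\<close>
    define rows where "rows = (\<lambda>i. \<lambda>p\<in>carrier P. \<eta> i p \<odot>\<^bsub>P0\<^esub> \<alpha> (e i))"
    have rows: "rows i \<in> S" if "i \<in> D" for i
      unfolding rows_def using row[OF that] EA_closed[OF \<alpha> e'[OF that]] by simp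
    then have rowsE: "rows \<in> D \<rightarrow> carrier EA" using S(1) by auto
    have sum: "finsum EA rows D \<in> S"
      by (rule finsum_in_subset[OF EA.abelian_group_axioms dual_basisD(1)[OF db] S(1-3) rows])
    have "\<alpha> = finsum EA rows D"
    proof (rule EA_eqI[OF \<alpha>])
      show s: "finsum EA rows D \<in> carrier EA" using sum S(1) by auto
      fix p assume "p \<in> carrier P"
      then have p: "p \<in> carrier P0" by simp
      show "\<alpha> p = finsum EA rows D p"
      proof (rule dual_basis_lin_eq[OF P0_module P0_module db EA_lin[OF \<alpha>] EA_lin[OF s] _ p])
        fix k assume k: "k \<in> D"
        have "finsum EA rows D (e k) = (\<Oplus>\<^bsub>P0\<^esub>i\<in>D. rows i (e k))"
          by (rule lin_finsum[OF eval_lin[OF e'[OF k]] EA_module P0_module dual_basisD(1)[OF db] rowsE])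
        also have "\<dots> = (\<Oplus>\<^bsub>P0\<^esub>i\<in>D. if k = i then \<alpha> (e i) else \<zero>\<^bsub>P0\<^esub>)"
        proof (rule P0.M.finsum_cong')
          fix i assume i: "i \<in> D"
          have "\<alpha> (e i) \<in> carrier P0" using EA_closed[OF \<alpha> e'[OF i]] by simp
          then show "rows i (e k) = (if k = i then \<alpha> (e i) else \<zero>\<^bsub>P0\<^esub>)"
            unfolding rows_def using e'[OF k] dual_basisD(4)[OF db i k]
            by (simp del: P0_simps)
        qed (use EA_closed[OF \<alpha> e'] in auto)
        also have "\<dots> = \<alpha> (e k)"
          by (rule P0.M.finsum_singleton[OF k dual_basisD(1)[OF db]]) (use EA_closed[OF \<alpha> e'] in auto)
        finally show "\<alpha> (e k) = finsum EA rows D (e k)" ..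
      qed
    qed
    then show "\<alpha> \<in> S" using sum by simp
  qed
qed

end


section \<open>Endomorphisms after base change\<close>

lemma tensor_product_one: "\<one>\<^bsub>tensor_product A M N\<^esub> = pure_tensor A M N \<one>\<^bsub>M\<^esub> \<one>\<^bsub>N\<^esub>"
  by (simp add: tensor_product_def Let_def)

text \<open>The relations involve only addition and scalars, so passing to the opposite algebra
  leaves the tensor product unchanged as a module and affects only its product.\<close>

lemma opposite_tensor_group: "tensor_group A (opposite B) N = tensor_group A B N"
  by (simp add: tensor_group_def tensor_kernel_def tensor_relations_def opposite_def)

lemma opposite_pure_tensor: "pure_tensor A (opposite B) N = pure_tensor A B N"
  by (intro ext) (simp add: pure_tensor_def tensor_kernel_def tensor_relations_def opposite_def)

lemma opposite_tensor_product:
  "carrier (tensor_product A (opposite B) N) = carrier (tensor_product A B N)"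
  "ring.add (tensor_product A (opposite B) N) = ring.add (tensor_product A B N)"
  "smult (tensor_product A (opposite B) N) = smult (tensor_product A B N)"
  "\<one>\<^bsub>tensor_product A (opposite B) N\<^esub> = pure_tensor A B N \<one>\<^bsub>B\<^esub> \<one>\<^bsub>N\<^esub>"
  "monoid.mult (tensor_product A (opposite B) N) = tbil A B N (\<lambda>x y. y \<otimes>\<^bsub>B\<^esub> x) (monoid.mult N)"
  unfolding tensor_product_def Let_def tbil_def[abs_def]
  by (simp_all add: opposite_tensor_group opposite_pure_tensor) (simp_all add: opposite_def)

lemma tmapl_tmap:
  assumes B: "module A B" and M: "module A M" and f: "lin A B B f" and g: "lin A M M g"
    and T: "T \<in> carrier (tensor_product A B M)"
  shows "tmapl A B M f (tmap A B M g T) = tmap A B M g (tmapl A B M f T)"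
  by (rule tensor_lin_eq[OF B M tensor_module[OF B M] lin_compose[OF tmap_lin[OF B M M g] tmapl_lin[OF B M f]]
        lin_compose[OF tmapl_lin[OF B M f] tmap_lin[OF B M M g]] _ T])
    (simp add: tmap_pure[OF B M M g] tmapl_pure[OF B M f] linD[OF f] linD[OF g])

lemma tmapl_comp:
  assumes B: "module A B" and M: "module A M" and f: "lin A B B f" and g: "lin A B B g" and h: "lin A B B h"
    and fg: "\<And>b. b \<in> carrier B \<Longrightarrow> f (g b) = h b" and T: "T \<in> carrier (tensor_product A B M)"
  shows "tmapl A B M f (tmapl A B M g T) = tmapl A B M h T"
  by (rule tensor_lin_eq[OF B M tensor_module[OF B M] lin_compose[OF tmapl_lin[OF B M g] tmapl_lin[OF B M f]]
        tmapl_lin[OF B M h] _ T])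
    (simp add: tmapl_pure[OF B M f] tmapl_pure[OF B M g] tmapl_pure[OF B M h] linD[OF g] fg)

context algebra_module_extension
begin

interpretation B: assoc_algebra A B by (rule B)

abbreviation "TP \<equiv> tensor_product A B P0"
abbreviation "TE \<equiv> tensor_product A B EA"
abbreviation "T\<Lambda> \<equiv> tensor_product A B \<Lambda>"
abbreviation "EB \<equiv> End_algebra T\<Lambda> PB"

lemmas TP_module = tensor_module[OF B_module P0_module]
lemmas left_mult_lin = bilinear_right[OF mult_bilinear[OF B]]

text \<open>Extends \<open>Psi\<close> from End_\<Lambda>(P) to all of End_A(P), with uncut
  functions as values; being a \<open>tbil\<close>, it is bilinear without further work.\<close>

definition psi where
  "psi = tbil A B P0 (\<lambda>b b'. b' \<otimes>\<^bsub>B\<^esub> b) (\<lambda>\<alpha> p. \<alpha> p)"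

lemma psi_bilinear: "bilinear A TE TP TP psi"
  unfolding psi_def
  by (rule tbil_bilinear[OF B_module EA_module B_module P0_module B_module P0_module mult_bilinear_op[OF B] eval_bilinear])

lemma psi_pure:
  assumes "b \<in> carrier B" "\<alpha> \<in> carrier EA" "b' \<in> carrier B" "p \<in> carrier P"
  shows "psi (pure_tensor A B EA b \<alpha>) (pure_tensor A B P0 b' p) = pure_tensor A B P0 (b' \<otimes>\<^bsub>B\<^esub> b) (\<alpha> p)"
  unfolding psi_def
  by (rule tbil_pure[OF B_module EA_module B_module P0_module B_module P0_module mult_bilinear_op[OF B] eval_bilinear])
    (use assms in simp_all)

lemma psi_pure_right:
  assumes S: "S \<in> carrier TE" and b': "b' \<in> carrier B" and p: "p \<in> carrier P"
  shows "psi S (pure_tensor A B P0 b' p) = tmapl A B P0 (\<lambda>b. b' \<otimes>\<^bsub>B\<^esub> b) (tmap A B P0 (\<lambda>\<alpha>. \<alpha> p) S)"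
proof -
  note ev = eval_lin[OF p]
  have p': "p \<in> carrier P0" using p by simp
  show ?thesis
    by (rule tensor_lin_eq[OF B_module EA_module TP_module bilinear_left[OF psi_bilinear pure_closed[OF B_module P0_module b' p']]
          lin_compose[OF tmap_lin[OF B_module EA_module P0_module ev] tmapl_lin[OF B_module P0_module left_mult_lin[OF b']]] _ S])
      (use b' p in \<open>simp add: psi_pure tmap_pure[OF B_module EA_module P0_module ev]
        tmapl_pure[OF B_module P0_module left_mult_lin[OF b']] EA_closed\<close>)
qed

lemma psi_one:
  assumes S: "S \<in> carrier TE" and p: "p \<in> carrier P"
  shows "psi S (pure_tensor A B P0 \<one>\<^bsub>B\<^esub> p) = tmap A B P0 (\<lambda>\<alpha>. \<alpha> p) S"
  unfolding psi_pure_right[OF S B.M.one_closed p]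
  by (rule tmapl_id[OF B_module P0_module _ lin_closed[OF tmap_lin[OF B_module EA_module P0_module eval_lin[OF p]] S]]) simp

lemma act_pure_left:
  assumes b: "b \<in> carrier B" and x: "x \<in> carrier \<Lambda>" and T: "T \<in> carrier TP"
  shows "pure_tensor A B \<Lambda> b x \<odot>\<^bsub>PB\<^esub> T = tmapl A B P0 (\<lambda>b'. b \<otimes>\<^bsub>B\<^esub> b') (tmap A B P0 (\<lambda>p. x \<odot>\<^bsub>P\<^esub> p) T)"
proof -
  note al = act_lin[OF x]
  show ?thesis
    by (rule tensor_lin_eq[OF B_module P0_module TP_module
          bilinear_right[OF extended_act_bilinear pure_closed[OF B_module \<Lambda>_module b x]]
          lin_compose[OF tmap_lin[OF B_module P0_module P0_module al] tmapl_lin[OF B_module P0_module left_mult_lin[OF b]]] _ T])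
      (use b x in \<open>simp add: extended_act_pure tmap_pure[OF B_module P0_module P0_module al]
        tmapl_pure[OF B_module P0_module left_mult_lin[OF b]] lmod.smult_closed\<close>)
qed

lemma act_one_left:
  assumes x: "x \<in> carrier \<Lambda>" and T: "T \<in> carrier TP"
  shows "pure_tensor A B \<Lambda> \<one>\<^bsub>B\<^esub> x \<odot>\<^bsub>PB\<^esub> T = tmap A B P0 (\<lambda>p. x \<odot>\<^bsub>P\<^esub> p) T"
  unfolding act_pure_left[OF B.M.one_closed x T]
  by (rule tmapl_id[OF B_module P0_module _ lin_closed[OF tmap_lin[OF B_module P0_module P0_module act_lin[OF x]] T]]) simp

lemma act_scalar_left:
  assumes b: "b \<in> carrier B" and T: "T \<in> carrier TP"
  shows "pure_tensor A B \<Lambda> b \<one>\<^bsub>\<Lambda>\<^esub> \<odot>\<^bsub>PB\<^esub> T = tmapl A B P0 (\<lambda>b'. b \<otimes>\<^bsub>B\<^esub> b') T"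
proof -
  have "tmap A B P0 (\<lambda>p. \<one>\<^bsub>\<Lambda>\<^esub> \<odot>\<^bsub>P\<^esub> p) T = tmap A B P0 (\<lambda>p. p) T"
    by (rule tmap_cong[OF B_module P0_module P0_module lin_id _ T]) (simp add: lmod.smult_one)
  then show ?thesis
    using act_pure_left[OF b _ T, of "\<one>\<^bsub>\<Lambda>\<^esub>"] by (simp add: tmap_id[OF B_module P0_module T])
qed

text \<open>Scalars of \<open>A\<close> passing through B \<otimes> \<Lambda> act as the
  \<open>A\<close>-module structure of B \<otimes> P. Hence maps linear over B \<otimes> \<Lambda>
  are \<open>A\<close>-linear, and the scalar multiplication of \<open>EB\<close> is the expected
  one.\<close>

lemma act_scalar:
  assumes a: "a \<in> carrier A" and T: "T \<in> carrier TP"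
  shows "(a \<odot>\<^bsub>T\<Lambda>\<^esub> \<one>\<^bsub>T\<Lambda>\<^esub>) \<odot>\<^bsub>PB\<^esub> T = a \<odot>\<^bsub>TP\<^esub> T"
proof -
  have "(a \<odot>\<^bsub>T\<Lambda>\<^esub> \<one>\<^bsub>T\<Lambda>\<^esub>) \<odot>\<^bsub>PB\<^esub> T = a \<odot>\<^bsub>TP\<^esub> (\<one>\<^bsub>T\<Lambda>\<^esub> \<odot>\<^bsub>PB\<^esub> T)"
    unfolding tensor_product_one
    by (rule bilinear_smult_left[OF extended_act_bilinear a pure_closed[OF B_module \<Lambda>_module] T]) simp_all
  also have "\<one>\<^bsub>T\<Lambda>\<^esub> \<odot>\<^bsub>PB\<^esub> T = T"
    unfolding tensor_product_one act_scalar_left[OF B.M.one_closed T]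
    by (rule tmapl_id[OF B_module P0_module _ T]) simp
  finally show ?thesis .
qed

text \<open>\<open>S\<close> defines a map P \<rightarrow> B \<otimes> P by evaluation at
  \<open>p\<close>; after the base changed commutator is split into a difference, the equations say
  that this map respects the action of \<Lambda>.\<close>

lemma endomorphism_solutions:
  assumes db: "dual_basis A P0 D e \<eta>"
  shows "S \<in> tensor_solutions A B EA (coordinate_functionals D \<eta> commutators) \<longleftrightarrow> S \<in> carrier TE \<and>
    (\<forall>x\<in>carrier \<Lambda>. \<forall>p\<in>carrier P. tmap A B P0 (\<lambda>\<alpha>. \<alpha> (x \<odot>\<^bsub>P\<^esub> p)) S =
      tmap A B P0 (\<lambda>p. x \<odot>\<^bsub>P\<^esub> p) (tmap A B P0 (\<lambda>\<alpha>. \<alpha> p) S))"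
proof -
  interpret TP: module A TP by (rule TP_module)
  have *: "tmap A B P0 (commutator x p) S = \<zero>\<^bsub>TP\<^esub> \<longleftrightarrow> tmap A B P0 (\<lambda>\<alpha>. \<alpha> (x \<odot>\<^bsub>P\<^esub> p)) S =
      tmap A B P0 (\<lambda>p. x \<odot>\<^bsub>P\<^esub> p) (tmap A B P0 (\<lambda>\<alpha>. \<alpha> p) S)"
    if S: "S \<in> carrier TE" and x: "x \<in> carrier \<Lambda>" and p: "p \<in> carrier P" for x p
  proof -
    note e1 = eval_lin[OF lmod.smult_closed[OF x p]] and e2 = lin_compose[OF eval_lin[OF p] act_lin[OF x]]
    have "tmap A B P0 (commutator x p) S =
        tmap A B P0 (\<lambda>\<alpha>. \<alpha> (x \<odot>\<^bsub>P\<^esub> p)) S \<ominus>\<^bsub>TP\<^esub> tmap A B P0 (\<lambda>\<alpha>. x \<odot>\<^bsub>P\<^esub> \<alpha> p) S"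
      unfolding commutator_def by (rule tmap_diff[OF B_module EA_module P0_module e1 e2 S])
    also have "tmap A B P0 (\<lambda>\<alpha>. x \<odot>\<^bsub>P\<^esub> \<alpha> p) S = tmap A B P0 (\<lambda>p. x \<odot>\<^bsub>P\<^esub> p) (tmap A B P0 (\<lambda>\<alpha>. \<alpha> p) S)"
      by (rule tmap_tmap[OF B_module EA_module P0_module P0_module eval_lin[OF p] act_lin[OF x] S, symmetric])
    finally show ?thesis
      using TP.M.diff_eq_zero_iff[OF lin_closed[OF tmap_lin[OF B_module EA_module P0_module e1] S]
          lin_closed[OF tmap_lin[OF B_module P0_module P0_module act_lin[OF x]]
            lin_closed[OF tmap_lin[OF B_module EA_module P0_module eval_lin[OF p]] S]]] by simp
  qed
  have "S \<in> tensor_solutions A B EA (coordinate_functionals D \<eta> commutators) \<longleftrightarrow> S \<in> carrier TE \<and>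
      (\<forall>x\<in>carrier \<Lambda>. \<forall>p\<in>carrier P. tmap A B P0 (commutator x p) S = \<zero>\<^bsub>TP\<^esub>)"
    using coordinate_functionals_solutions[OF EA_module P0_module db commutators_lin B_module, where T = S]
    unfolding commutators_def by simp
  then show ?thesis using * by (simp cong: conj_cong ball_cong)
qed

text \<open>On pure tensors, \<open>x\<close> acts on the right factor, while b and b' multiply the
  left factor from the left. These operations commute, associativity in \<open>B\<close> merges b
  and b', and the equations for \<open>S\<close> move \<open>x\<close> past the evaluation.\<close>

lemma psi_commutes:
  assumes db: "dual_basis A P0 D e \<eta>"
    and S: "S \<in> tensor_solutions A B EA (coordinate_functionals D \<eta> commutators)"
    and U: "U \<in> carrier T\<Lambda>" and T: "T \<in> carrier TP"
  shows "psi S (U \<odot>\<^bsub>PB\<^esub> T) = U \<odot>\<^bsub>PB\<^esub> psi S T"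
proof -
  have Sc: "S \<in> carrier TE"
    and eq: "\<And>x p. \<lbrakk>x \<in> carrier \<Lambda>; p \<in> carrier P\<rbrakk> \<Longrightarrow> tmap A B P0 (\<lambda>\<alpha>. \<alpha> (x \<odot>\<^bsub>P\<^esub> p)) S =
      tmap A B P0 (\<lambda>p. x \<odot>\<^bsub>P\<^esub> p) (tmap A B P0 (\<lambda>\<alpha>. \<alpha> p) S)"
    using S unfolding endomorphism_solutions[OF db] by simp_all
  note pl = bilinear_right[OF psi_bilinear Sc]
  show ?thesis
  proof (rule tbil_eqI[OF B_module \<Lambda>_module B_module P0_module TP_module bilinear_comp[OF extended_act_bilinear pl]
        bilinear_comp_right[OF extended_act_bilinear pl] _ U T])
    fix b x b' p assume b: "b \<in> carrier B" and x: "x \<in> carrier \<Lambda>" and b': "b' \<in> carrier B" and "p \<in> carrier P0"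
    then have p: "p \<in> carrier P" by simp
    define Y where "Y = tmap A B P0 (\<lambda>\<alpha>. \<alpha> p) S"
    have Y: "Y \<in> carrier TP" unfolding Y_def by (rule lin_closed[OF tmap_lin[OF B_module EA_module P0_module eval_lin[OF p]] Sc])
    have LY: "tmap A B P0 (\<lambda>p. x \<odot>\<^bsub>P\<^esub> p) Y \<in> carrier TP"
      by (rule lin_closed[OF tmap_lin[OF B_module P0_module P0_module act_lin[OF x]] Y])
    have "psi S (pure_tensor A B \<Lambda> b x \<odot>\<^bsub>PB\<^esub> pure_tensor A B P0 b' p)
        = tmapl A B P0 (\<lambda>c. (b \<otimes>\<^bsub>B\<^esub> b') \<otimes>\<^bsub>B\<^esub> c) (tmap A B P0 (\<lambda>p. x \<odot>\<^bsub>P\<^esub> p) Y)"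
      using b x b' p eq[OF x p]
      by (simp add: extended_act_pure psi_pure_right[OF Sc] lmod.smult_closed Y_def)
    also have "\<dots> = tmapl A B P0 (\<lambda>c. b \<otimes>\<^bsub>B\<^esub> c) (tmapl A B P0 (\<lambda>c. b' \<otimes>\<^bsub>B\<^esub> c) (tmap A B P0 (\<lambda>p. x \<odot>\<^bsub>P\<^esub> p) Y))"
      by (rule tmapl_comp[OF B_module P0_module left_mult_lin[OF b] left_mult_lin[OF b'] left_mult_lin[OF B.M.m_closed[OF b b']] _ LY, symmetric])
        (use b b' in \<open>simp add: B.M.m_assoc\<close>)
    also have "\<dots> = tmapl A B P0 (\<lambda>c. b \<otimes>\<^bsub>B\<^esub> c) (tmap A B P0 (\<lambda>p. x \<odot>\<^bsub>P\<^esub> p) (tmapl A B P0 (\<lambda>c. b' \<otimes>\<^bsub>B\<^esub> c) Y))"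
      by (simp add: tmapl_tmap[OF B_module P0_module left_mult_lin[OF b'] act_lin[OF x] Y])
    also have "\<dots> = pure_tensor A B \<Lambda> b x \<odot>\<^bsub>PB\<^esub> psi S (pure_tensor A B P0 b' p)"
      unfolding psi_pure_right[OF Sc b' p] Y_def[symmetric]
      by (rule act_pure_left[OF b x lin_closed[OF tmapl_lin[OF B_module P0_module left_mult_lin[OF b']] Y], symmetric])
    finally show "psi S (pure_tensor A B \<Lambda> b x \<odot>\<^bsub>PB\<^esub> pure_tensor A B P0 b' p)
        = pure_tensor A B \<Lambda> b x \<odot>\<^bsub>PB\<^esub> psi S (pure_tensor A B P0 b' p)" .
  qed
qed

text \<open>The values at 1 \<otimes> e_i already contain all matrix entries of
  \<open>S\<close>.\<close>

lemma psi_injective: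
  assumes db: "dual_basis A P0 D e \<eta>" and S: "S \<in> carrier TE" "S' \<in> carrier TE"
    and eq: "\<And>T. T \<in> carrier TP \<Longrightarrow> psi S T = psi S' T"
  shows "S = S'"
proof (rule dual_basis_tensor_eq[OF B_module EA_module EA_dual_basis[OF db] S])
  fix u assume "u \<in> D \<times> D"
  then obtain i j where u: "u = (i, j)" and ij: "i \<in> D" "j \<in> D" by auto
  have e: "e i \<in> carrier P0" "e i \<in> carrier P" using dual_basisD(2)[OF db ij(1)] by simp_all
  have "teval B (\<lambda>\<alpha>. \<eta> j (\<alpha> (e i))) V = teval B (\<eta> j) (psi V (pure_tensor A B P0 \<one>\<^bsub>B\<^esub> (e i)))"
    if "V \<in> carrier TE" for V
    unfolding psi_one[OF that e(2)]
    by (rule teval_tmap[OF B_module EA_module P0_module eval_lin[OF e(2)] dual_basisD(3)[OF db ij(2)] that, symmetric])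
  then show "teval B (case u of (i, j) \<Rightarrow> \<lambda>\<alpha>. \<eta> j (\<alpha> (e i))) S = teval B (case u of (i, j) \<Rightarrow> \<lambda>\<alpha>. \<eta> j (\<alpha> (e i))) S'"
    using S eq[OF pure_closed[OF B_module P0_module B.M.one_closed e(1)]] by (simp add: u)
qed

lemma EB_carrier:
  "f \<in> carrier EB \<longleftrightarrow> f \<in> extensional (carrier TP) \<and> f \<in> carrier TP \<rightarrow> carrier TP \<and>
    (\<forall>T\<in>carrier TP. \<forall>T'\<in>carrier TP. f (T \<oplus>\<^bsub>TP\<^esub> T') = f T \<oplus>\<^bsub>TP\<^esub> f T') \<and>
    (\<forall>U\<in>carrier T\<Lambda>. \<forall>T\<in>carrier TP. f (U \<odot>\<^bsub>PB\<^esub> T) = U \<odot>\<^bsub>PB\<^esub> f T)"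
  unfolding End_algebra_carrier extend_module_simps(1,3) ..

lemma EB_abelian_group: "abelian_group EB"
proof (rule End_algebra_abelian_group)
  show "abelian_group PB"
    by (rule abelian_group_cong[OF tensor_abelian_group[OF B_module P0_module]]) (simp_all add: extend_module_simps)
qed (simp_all only: extend_module_simps(1,3) bilinearD[OF extended_act_bilinear])

text \<open>The matrix of \<open>S\<close> is read off from \<theta>(1 \<otimes> e_i). Agreement
  spreads from the basis to all 1 \<otimes> p by \<open>A\<close>-linearity and then to all
  tensors.\<close>

lemma psi_surjective:
  assumes db: "dual_basis A P0 D e \<eta>" and \<theta>: "\<theta> \<in> carrier EB"
  shows "\<exists>S\<in>tensor_solutions A B EA (coordinate_functionals D \<eta> commutators). \<forall>T\<in>carrier TP. psi S T = \<theta> T"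
proof -
  note \<theta>' = \<theta>[unfolded EB_carrier]
  have \<theta>c: "\<theta> T \<in> carrier TP" if "T \<in> carrier TP" for T using \<theta>' that by auto
  have \<theta>s: "\<theta> (U \<odot>\<^bsub>PB\<^esub> T) = U \<odot>\<^bsub>PB\<^esub> \<theta> T" if "U \<in> carrier T\<Lambda>" "T \<in> carrier TP" for U T
    using \<theta>' that by blast
  interpret T\<Lambda>: module A T\<Lambda> by (rule tensor_module[OF B_module \<Lambda>_module])
  have one: "\<one>\<^bsub>T\<Lambda>\<^esub> \<in> carrier T\<Lambda>"
    unfolding tensor_product_one by (rule pure_closed[OF B_module \<Lambda>_module]) simp_all
  have \<theta>l: "lin A TP TP \<theta>"
  proof (rule linI)
    show "\<theta> (T \<oplus>\<^bsub>TP\<^esub> T') = \<theta> T \<oplus>\<^bsub>TP\<^esub> \<theta> T'" if "T \<in> carrier TP" "T' \<in> carrier TP" for T T'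
      using \<theta>' that by blast
    show "\<theta> (a \<odot>\<^bsub>TP\<^esub> T) = a \<odot>\<^bsub>TP\<^esub> \<theta> T" if "a \<in> carrier A" "T \<in> carrier TP" for a T
      using \<theta>s[OF T\<Lambda>.smult_closed[OF that(1) one] that(2)] that
      by (simp add: act_scalar \<theta>c)
  qed (rule \<theta>c)
  define u where "u p = pure_tensor A B P0 \<one>\<^bsub>B\<^esub> p" for p
  have ul: "lin A P0 TP u"
    unfolding u_def by (rule bilinear_right[OF pure_bilinear[OF B_module P0_module] B.M.one_closed])
  note uc = lin_closed[OF ul, simplified]
  have e: "e i \<in> carrier P" if "i \<in> D" for i using dual_basisD(2)[OF db that] by simp
  note tl = teval_lin[OF B_module P0_module dual_basisD(3)[OF db]]
  have "(\<lambda>(i, j). teval B (\<eta> j) (\<theta> (u (e i)))) \<in> D \<times> D \<rightarrow> carrier B"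
    using lin_closed[OF tl \<theta>c[OF uc[OF e]]] by auto
  from dual_basis_tensor_exists[OF B_module EA_module EA_dual_basis[OF db] this]
  obtain S where S: "S \<in> carrier TE"
    and "\<forall>k\<in>D \<times> D. teval B (case k of (i, j) \<Rightarrow> \<lambda>\<alpha>. \<eta> j (\<alpha> (e i))) S
      = (case k of (i, j) \<Rightarrow> teval B (\<eta> j) (\<theta> (u (e i))))"
    by (elim bexE)
  then have coord: "teval B (\<lambda>\<alpha>. \<eta> j (\<alpha> (e i))) S = teval B (\<eta> j) (\<theta> (u (e i)))" if "i \<in> D" "j \<in> D" for i j
    using that by fastforce
  note pl = bilinear_right[OF psi_bilinear S]
  have basis: "psi S (u (e i)) = \<theta> (u (e i))" if i: "i \<in> D" for i
  proof (rule dual_basis_tensor_eq[OF B_module P0_module db lin_closed[OF pl uc[OF e[OF i]]] \<theta>c[OF uc[OF e[OF i]]]])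
    fix j assume j: "j \<in> D"
    show "teval B (\<eta> j) (psi S (u (e i))) = teval B (\<eta> j) (\<theta> (u (e i)))"
      unfolding u_def psi_one[OF S e[OF i]]
      using teval_tmap[OF B_module EA_module P0_module eval_lin[OF e[OF i]] dual_basisD(3)[OF db j] S]
        coord[OF i j] by (simp add: u_def)
  qed
  have unit: "psi S (u p) = \<theta> (u p)" if p: "p \<in> carrier P" for p
    by (rule dual_basis_lin_eq[OF P0_module TP_module db lin_compose[OF ul pl] lin_compose[OF ul \<theta>l] basis])
      (use p in simp_all)
  \<comment> \<open>Here b \<otimes> p = (b \<otimes> 1)(1 \<otimes> p), and linearity over B
    \<otimes> \<Lambda> includes linearity for b \<otimes> 1.\<close>
  have eq: "psi S T = \<theta> T" if T: "T \<in> carrier TP" for T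
  proof (rule tensor_lin_eq[OF B_module P0_module TP_module pl \<theta>l _ T])
    fix b p assume b: "b \<in> carrier B" and "p \<in> carrier P0"
    then have p: "p \<in> carrier P" by simp
    have b1: "pure_tensor A B \<Lambda> b \<one>\<^bsub>\<Lambda>\<^esub> \<in> carrier T\<Lambda>" by (rule pure_closed[OF B_module \<Lambda>_module b]) simp
    have "psi S (pure_tensor A B P0 b p) = tmapl A B P0 (\<lambda>c. b \<otimes>\<^bsub>B\<^esub> c) (psi S (u p))"
      by (simp add: psi_pure_right[OF S b p] psi_one[OF S p] u_def)
    also have "\<dots> = pure_tensor A B \<Lambda> b \<one>\<^bsub>\<Lambda>\<^esub> \<odot>\<^bsub>PB\<^esub> \<theta> (u p)"
      by (simp add: act_scalar_left[OF b \<theta>c[OF uc[OF p]]] unit[OF p])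
    also have "\<dots> = \<theta> (pure_tensor A B \<Lambda> b \<one>\<^bsub>\<Lambda>\<^esub> \<odot>\<^bsub>PB\<^esub> u p)"
      by (rule \<theta>s[OF b1 uc[OF p], symmetric])
    also have "pure_tensor A B \<Lambda> b \<one>\<^bsub>\<Lambda>\<^esub> \<odot>\<^bsub>PB\<^esub> u p = pure_tensor A B P0 b p"
      using b p by (simp add: u_def extended_act_pure lmod.smult_one)
    finally show "psi S (pure_tensor A B P0 b p) = \<theta> (pure_tensor A B P0 b p)" .
  qed
  \<comment> \<open>Linearity of \<theta> for 1 \<otimes> x, evaluated at 1 \<otimes> p, gives the
    commutator equations.\<close>
  have "tmap A B P0 (\<lambda>\<alpha>. \<alpha> (x \<odot>\<^bsub>P\<^esub> p)) S = tmap A B P0 (\<lambda>p. x \<odot>\<^bsub>P\<^esub> p) (tmap A B P0 (\<lambda>\<alpha>. \<alpha> p) S)"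
    if x: "x \<in> carrier \<Lambda>" and p: "p \<in> carrier P" for x p
  proof -
    have x1: "pure_tensor A B \<Lambda> \<one>\<^bsub>B\<^esub> x \<in> carrier T\<Lambda>" by (rule pure_closed[OF B_module \<Lambda>_module B.M.one_closed x])
    have "tmap A B P0 (\<lambda>\<alpha>. \<alpha> (x \<odot>\<^bsub>P\<^esub> p)) S = \<theta> (u (x \<odot>\<^bsub>P\<^esub> p))"
      using psi_one[OF S lmod.smult_closed[OF x p]] unit[OF lmod.smult_closed[OF x p]] by (simp add: u_def)
    also have "u (x \<odot>\<^bsub>P\<^esub> p) = pure_tensor A B \<Lambda> \<one>\<^bsub>B\<^esub> x \<odot>\<^bsub>PB\<^esub> u p"
      using x p by (simp add: u_def extended_act_pure)
    also have "\<theta> \<dots> = pure_tensor A B \<Lambda> \<one>\<^bsub>B\<^esub> x \<odot>\<^bsub>PB\<^esub> \<theta> (u p)" by (rule \<theta>s[OF x1 uc[OF p]])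
    also have "\<dots> = tmap A B P0 (\<lambda>p. x \<odot>\<^bsub>P\<^esub> p) (\<theta> (u p))" by (rule act_one_left[OF x \<theta>c[OF uc[OF p]]])
    also have "\<theta> (u p) = tmap A B P0 (\<lambda>\<alpha>. \<alpha> p) S"
      using psi_one[OF S p] unit[OF p] by (simp add: u_def)
    finally show ?thesis .
  qed
  then have "S \<in> tensor_solutions A B EA (coordinate_functionals D \<eta> commutators)"
    unfolding endomorphism_solutions[OF db] using S by blast
  then show ?thesis using eq by blast
qed

definition psi_restricted where "psi_restricted S = (\<lambda>T\<in>carrier TP. psi S T)"

lemma psi_restricted_closed:
  assumes db: "dual_basis A P0 D e \<eta>"
    and S: "S \<in> tensor_solutions A B EA (coordinate_functionals D \<eta> commutators)"
  shows "psi_restricted S \<in> carrier EB"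
proof -
  interpret TP: module A TP by (rule TP_module)
  have Sc: "S \<in> carrier TE" using S by (simp add: tensor_solutions_def)
  note pl = linD[OF bilinear_right[OF psi_bilinear Sc]]
  show ?thesis
    unfolding EB_carrier psi_restricted_def
    using psi_commutes[OF db S] bilinear_closed[OF extended_act_bilinear] pl by auto
qed

text \<open>The solution set describes the endomorphisms of \<open>PB\<close> for every
  \<open>B\<close>, before any splitting is known; it can therefore be used over \<open>F\<close> to
  produce the splitting and over \<open>B\<close> to exploit it.\<close>

lemma psi_restricted_bij:
  assumes db: "dual_basis A P0 D e \<eta>"
  shows "bij_betw psi_restricted (tensor_solutions A B EA (coordinate_functionals D \<eta> commutators)) (carrier EB)"
  unfolding bij_betw_def
proof
  let ?S = "tensor_solutions A B EA (coordinate_functionals D \<eta> commutators)"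
  show "inj_on psi_restricted ?S"
  proof (rule inj_onI)
    fix S S' assume S: "S \<in> ?S" "S' \<in> ?S" and eq: "psi_restricted S = psi_restricted S'"
    have "psi S T = psi S' T" if "T \<in> carrier TP" for T
      using fun_cong[OF eq, of T] that by (simp add: psi_restricted_def)
    then show "S = S'"
      using S by (intro psi_injective[OF db]) (simp_all add: tensor_solutions_def)
  qed
  show "psi_restricted ` ?S = carrier EB"
  proof
    show "psi_restricted ` ?S \<subseteq> carrier EB" using psi_restricted_closed[OF db] by blast
    show "carrier EB \<subseteq> psi_restricted ` ?S"
    proof
      fix \<theta> assume \<theta>: "\<theta> \<in> carrier EB"
      obtain S where S: "S \<in> ?S" "\<forall>T\<in>carrier TP. psi S T = \<theta> T" using psi_surjective[OF db \<theta>] by (elim bexE)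
      have "\<theta> = psi_restricted S"
        by (rule extensionalityI[of _ "carrier TP"])
          (use \<theta> S(2) in \<open>simp_all add: EB_carrier psi_restricted_def\<close>)
      then show "\<theta> \<in> psi_restricted ` ?S" using S(1) by blast
    qed
  qed
qed

end

section \<open>Psi as a homomorphism of algebras\<close>

context algebra_module
begin

lemma E\<Lambda>_eq: "E\<Lambda> = EA\<lparr>carrier := carrier E\<Lambda>\<rparr>"
  by (simp add: EA_def)

lemma E\<Lambda>_submodule:
  assumes "free_of_finite_rank A P0"
  shows "submodule (carrier E\<Lambda>) A EA"
proof -
  obtain D \<eta> where db: "dual_basis A P0 D (\<lambda>e. e) \<eta>" using free_dual_basis[OF P0_module assms] by (elim exE)
  show ?thesis
    unfolding endomorphism_kernel[OF db]
    by (rule common_kernel_submodule[OF EA_module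
          coordinate_functionals_subset[OF EA_module P0_module db commutators_lin]])
qed

lemma compose_bilinear: "bilinear A E\<Lambda> E\<Lambda> E\<Lambda> (compose (carrier P))"
proof -
  have E: "f p \<in> carrier P" "f (p \<oplus>\<^bsub>P\<^esub> q) = f p \<oplus>\<^bsub>P\<^esub> f q" "x \<in> carrier \<Lambda> \<Longrightarrow> f (x \<odot>\<^bsub>P\<^esub> p) = x \<odot>\<^bsub>P\<^esub> f p"
    if "f \<in> carrier E\<Lambda>" "p \<in> carrier P" "q \<in> carrier P" for f p q x
    using that by (auto simp: End_algebra_carrier)
  have "compose (carrier P) f g \<in> carrier E\<Lambda>" if "f \<in> carrier E\<Lambda>" "g \<in> carrier E\<Lambda>" for f g
    unfolding End_algebra_carrier
    using that by (auto simp: compose_def E lmod.smult_closed)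
  then show ?thesis
    unfolding bilinear_def lin_def by (auto simp: compose_def E lmod.smult_closed fun_eq_iff)
qed

end

context algebra_module_extension
begin

interpretation B: assoc_algebra A B by (rule B)

lemma psi_restricted_add:
  assumes "S \<in> carrier TE" "S' \<in> carrier TE"
  shows "psi_restricted (S \<oplus>\<^bsub>TE\<^esub> S') = psi_restricted S \<oplus>\<^bsub>EB\<^esub> psi_restricted S'"
  unfolding psi_restricted_def End_algebra_simps extend_module_simps
  by (intro restrict_ext) (simp add: bilinear_add_left[OF psi_bilinear assms])

lemma psi_restricted_smult:
  assumes "a \<in> carrier A" "S \<in> carrier TE"
  shows "psi_restricted (a \<odot>\<^bsub>TE\<^esub> S) = a \<odot>\<^bsub>EB\<^esub> psi_restricted S"
  unfolding psi_restricted_def End_algebra_simps extend_module_simps(1)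
  by (intro restrict_ext)
    (simp add: bilinear_smult_left[OF psi_bilinear assms] act_scalar[OF assms(1)] bilinear_closed[OF psi_bilinear assms(2)])

text \<open>Both sides are additive and agree on pure tensors. The universal property behind
  \<open>Psi\<close> applies once the underlying map is known to be balanced with values in
  \<open>EB\<close>.\<close>

lemma Psi_eq:
  assumes free: "free_of_finite_rank A P0" and U: "U \<in> carrier (tensor_product A B E\<Lambda>)"
  shows "Psi A B \<Lambda> P U = psi_restricted (tmap A B EA (\<lambda>x. x) U)"
proof -
  obtain D \<eta> where db: "dual_basis A P0 D (\<lambda>e. e) \<eta>" using free_dual_basis[OF P0_module free] by (elim exE)
  let ?R = "coordinate_functionals D \<eta> commutators"
  note R = coordinate_functionals_subset[OF EA_module P0_module db commutators_lin]
  note sub = E\<Lambda>_submodule[OF free]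
  have Em: "module A E\<Lambda>" using submodule_module[OF EA_module sub] by (simp add: E\<Lambda>_eq[symmetric])
  have incl: "lin A E\<Lambda> EA (\<lambda>x. x)" using lin_inclusion[OF sub] by (simp add: E\<Lambda>_eq[symmetric])
  have sol: "tmap A B EA (\<lambda>x. x) U \<in> tensor_solutions A B EA ?R" if "U \<in> carrier (tensor_product A B E\<Lambda>)" for U
  proof -
    have "tmap A B EA (\<lambda>x. x) U \<in> tspan A B EA (common_kernel A EA ?R)"
      unfolding tspan_def endomorphism_kernel[OF db, symmetric] E\<Lambda>_eq[symmetric] using that by simp
    then show ?thesis using tspan_subset_solutions[OF EA_module B_module R] by blast
  qed
  have tl: "lin A (tensor_product A B E\<Lambda>) TE (tmap A B EA (\<lambda>x. x))"
    by (rule tmap_lin[OF B_module Em EA_module incl])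
  define \<phi> where "\<phi> = (\<lambda>b \<alpha>. \<lambda>T\<in>carrier PB.
    tensor_lift (tensor_group A B P0) (\<lambda>(b', p). pure_tensor A B P0 (b' \<otimes>\<^bsub>B\<^esub> b) (\<alpha> p)) T)"
  have \<phi>: "\<phi> b \<alpha> = psi_restricted (pure_tensor A B EA b \<alpha>)" if "b \<in> carrier B" "\<alpha> \<in> carrier EA" for b \<alpha>
    unfolding \<phi>_def psi_restricted_def extend_module_simps(1) psi_def
    by (intro restrict_ext)
      (simp add: tbil_pure_left[OF B_module EA_module B_module P0_module B_module P0_module mult_bilinear_op[OF B] eval_bilinear] that)
  note p = bilinearD[OF pure_bilinear[OF B_module EA_module]]
  have EAE: "\<alpha> \<in> carrier EA" if "\<alpha> \<in> carrier E\<Lambda>" for \<alpha> using lin_closed[OF incl that] .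
  \<comment> \<open>Membership in \<open>EB\<close> is where the \<Lambda>-linearity of \<alpha>
    enters: it makes b \<otimes> \<alpha> a solution. The other conditions are inherited from the
    tensor product with \<open>EA\<close>.\<close>
  have bal: "balanced A B E\<Lambda> EB \<phi>"
    unfolding balanced_def
  proof (intro conjI ballI)
    fix b \<alpha> assume b: "b \<in> carrier B" and \<alpha>: "\<alpha> \<in> carrier E\<Lambda>"
    have "pure_tensor A B EA b \<alpha> = tmap A B EA (\<lambda>x. x) (pure_tensor A B E\<Lambda> b \<alpha>)"
      by (rule tmap_pure[OF B_module Em EA_module incl b \<alpha>, symmetric])
    then have "pure_tensor A B EA b \<alpha> \<in> tensor_solutions A B EA ?R"
      using sol[OF pure_closed[OF B_module Em b \<alpha>]] by simp
    then show "\<phi> b \<alpha> \<in> carrier EB"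
      unfolding \<phi>[OF b EAE[OF \<alpha>]] by (rule psi_restricted_closed[OF db])
  next
    fix b b' \<alpha> assume b: "b \<in> carrier B" "b' \<in> carrier B" and E: "\<alpha> \<in> carrier E\<Lambda>"
    note \<alpha> = EAE[OF E]
    show "\<phi> (b \<oplus>\<^bsub>B\<^esub> b') \<alpha> = \<phi> b \<alpha> \<oplus>\<^bsub>EB\<^esub> \<phi> b' \<alpha>"
      unfolding \<phi>[OF B.M.a_closed[OF b] \<alpha>] \<phi>[OF b(1) \<alpha>] \<phi>[OF b(2) \<alpha>] p(4)[OF b \<alpha>]
      by (rule psi_restricted_add[OF p(3)[OF b(1) \<alpha>] p(3)[OF b(2) \<alpha>]])
  next
    fix b \<alpha> \<alpha>' assume b: "b \<in> carrier B" and E: "\<alpha> \<in> carrier E\<Lambda>" "\<alpha>' \<in> carrier E\<Lambda>"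
    interpret E: module A E\<Lambda> by (rule Em)
    have eq: "pure_tensor A B EA b (\<alpha> \<oplus>\<^bsub>E\<Lambda>\<^esub> \<alpha>') = pure_tensor A B EA b \<alpha> \<oplus>\<^bsub>TE\<^esub> pure_tensor A B EA b \<alpha>'"
      using p(5)[OF b EAE[OF E(1)] EAE[OF E(2)]] by simp
    show "\<phi> b (\<alpha> \<oplus>\<^bsub>E\<Lambda>\<^esub> \<alpha>') = \<phi> b \<alpha> \<oplus>\<^bsub>EB\<^esub> \<phi> b \<alpha>'"
      unfolding \<phi>[OF b EAE[OF E.M.a_closed[OF E]]] \<phi>[OF b EAE[OF E(1)]] \<phi>[OF b EAE[OF E(2)]] eq
      by (rule psi_restricted_add[OF p(3)[OF b EAE[OF E(1)]] p(3)[OF b EAE[OF E(2)]]])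
  next
    fix a b \<alpha> assume a: "a \<in> carrier A" and b: "b \<in> carrier B" and E: "\<alpha> \<in> carrier E\<Lambda>"
    interpret E: module A E\<Lambda> by (rule Em)
    have eq: "pure_tensor A B EA (a \<odot>\<^bsub>B\<^esub> b) \<alpha> = pure_tensor A B EA b (a \<odot>\<^bsub>E\<Lambda>\<^esub> \<alpha>)"
      using pure_balanced[OF B_module EA_module a b EAE[OF E]] by simp
    show "\<phi> (a \<odot>\<^bsub>B\<^esub> b) \<alpha> = \<phi> b (a \<odot>\<^bsub>E\<Lambda>\<^esub> \<alpha>)"
      unfolding \<phi>[OF B.smult_closed[OF a b] EAE[OF E]] \<phi>[OF b EAE[OF E.smult_closed[OF a E]]] eq ..
  qed
  have Psi: "Psi A B \<Lambda> P = tensor_lift (add_monoid EB) (case_prod \<phi>)"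
    by (simp add: Psi_def Let_def \<phi>_def)
  show ?thesis
    unfolding Psi
  proof (rule tensor_hom_eq[OF B_module Em EB_abelian_group, where g = "\<lambda>U. psi_restricted (tmap A B EA (\<lambda>x. x) U)"])
    note l = tlift[OF B_module Em EB_abelian_group bal]
    show "tensor_lift (add_monoid EB) (case_prod \<phi>) T \<in> carrier EB" if "T \<in> carrier (tensor_product A B E\<Lambda>)" for T
      using that by (rule l)
    show "tensor_lift (add_monoid EB) (case_prod \<phi>) (S \<oplus>\<^bsub>tensor_product A B E\<Lambda>\<^esub> T) =
        tensor_lift (add_monoid EB) (case_prod \<phi>) S \<oplus>\<^bsub>EB\<^esub> tensor_lift (add_monoid EB) (case_prod \<phi>) T"
      if "S \<in> carrier (tensor_product A B E\<Lambda>)" "T \<in> carrier (tensor_product A B E\<Lambda>)" for S T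
      using that by (rule l)
    show "psi_restricted (tmap A B EA (\<lambda>x. x) T) \<in> carrier EB" if "T \<in> carrier (tensor_product A B E\<Lambda>)" for T
      by (rule psi_restricted_closed[OF db sol[OF that]])
    show "psi_restricted (tmap A B EA (\<lambda>x. x) (S \<oplus>\<^bsub>tensor_product A B E\<Lambda>\<^esub> T)) =
        psi_restricted (tmap A B EA (\<lambda>x. x) S) \<oplus>\<^bsub>EB\<^esub> psi_restricted (tmap A B EA (\<lambda>x. x) T)"
      if "S \<in> carrier (tensor_product A B E\<Lambda>)" "T \<in> carrier (tensor_product A B E\<Lambda>)" for S T
      unfolding lin_add[OF tl that] by (rule psi_restricted_add[OF lin_closed[OF tl that(1)] lin_closed[OF tl that(2)]])
    show "tensor_lift (add_monoid EB) (case_prod \<phi>) (pure_tensor A B E\<Lambda> b \<alpha>) =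
        psi_restricted (tmap A B EA (\<lambda>x. x) (pure_tensor A B E\<Lambda> b \<alpha>))"
      if "b \<in> carrier B" "\<alpha> \<in> carrier E\<Lambda>" for b \<alpha>
      unfolding l(3)[OF that] tmap_pure[OF B_module Em EA_module incl that] by (rule \<phi>[OF that(1) EAE[OF that(2)]])
  qed (rule U)
qed

text \<open>On pure tensors, c \<otimes> \<beta> followed by b \<otimes> \<alpha> sends b' \<otimes>
  p to b' c b \<otimes> \<alpha>(\<beta>(p)). Composition thus multiplies the left factors in
  reverse order, which accounts for the opposite algebra.\<close>

lemma psi_mult:
  assumes free: "free_of_finite_rank A P0"
    and U: "U \<in> carrier (tensor_product A B E\<Lambda>)" and V: "V \<in> carrier (tensor_product A B E\<Lambda>)"
    and T: "T \<in> carrier TP"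
  shows "psi (tmap A B EA (\<lambda>x. x) (tbil A B E\<Lambda> (\<lambda>x y. y \<otimes>\<^bsub>B\<^esub> x) (compose (carrier P)) U V)) T
    = psi (tmap A B EA (\<lambda>x. x) U) (psi (tmap A B EA (\<lambda>x. x) V) T)"
proof -
  note sub = E\<Lambda>_submodule[OF free]
  have Em: "module A E\<Lambda>" using submodule_module[OF EA_module sub] by (simp add: E\<Lambda>_eq[symmetric])
  have incl: "lin A E\<Lambda> EA (\<lambda>x. x)" using lin_inclusion[OF sub] by (simp add: E\<Lambda>_eq[symmetric])
  have tl: "lin A (tensor_product A B E\<Lambda>) TE (tmap A B EA (\<lambda>x. x))"
    by (rule tmap_lin[OF B_module Em EA_module incl])
  note mb = tbil_bilinear[OF B_module Em B_module Em B_module Em mult_bilinear_op[OF B] compose_bilinear]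
  note pb = bilinear_comp_left[OF psi_bilinear tl]
  have left: "bilinear A (tensor_product A B E\<Lambda>) (tensor_product A B E\<Lambda>) TP (\<lambda>U V.
      psi (tmap A B EA (\<lambda>x. x) (tbil A B E\<Lambda> (\<lambda>x y. y \<otimes>\<^bsub>B\<^esub> x) (compose (carrier P)) U V)) T)"
    by (rule bilinear_comp[OF mb bilinear_left[OF pb T]])
  have right: "bilinear A (tensor_product A B E\<Lambda>) (tensor_product A B E\<Lambda>) TP (\<lambda>U V.
      psi (tmap A B EA (\<lambda>x. x) U) (psi (tmap A B EA (\<lambda>x. x) V) T))"
    by (rule bilinear_comp_right[OF pb bilinear_left[OF pb T]])
  show ?thesis
  proof (rule tbil_eqI[OF B_module Em B_module Em TP_module left right _ U V])
    fix b \<alpha> c \<beta> assume b: "b \<in> carrier B" "c \<in> carrier B" and E: "\<alpha> \<in> carrier E\<Lambda>" "\<beta> \<in> carrier E\<Lambda>"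
    note EA = lin_closed[OF incl E(1)] lin_closed[OF incl E(2)]
    note cE = bilinear_closed[OF compose_bilinear E] and cb = B.M.m_closed[OF b(2,1)]
    note cEA = lin_closed[OF incl cE]
    note pc = pure_closed[OF B_module EA_module]
    have "psi (pure_tensor A B EA (c \<otimes>\<^bsub>B\<^esub> b) (compose (carrier P) \<alpha> \<beta>)) T
        = psi (pure_tensor A B EA b \<alpha>) (psi (pure_tensor A B EA c \<beta>) T)"
    proof (rule tensor_lin_eq[OF B_module P0_module TP_module bilinear_right[OF psi_bilinear pc[OF cb cEA]]
          lin_compose[OF bilinear_right[OF psi_bilinear pc[OF b(2) EA(2)]] bilinear_right[OF psi_bilinear pc[OF b(1) EA(1)]]] _ T])
      fix b' p assume b': "b' \<in> carrier B" and "p \<in> carrier P0"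
      then have p: "p \<in> carrier P" by simp
      show "psi (pure_tensor A B EA (c \<otimes>\<^bsub>B\<^esub> b) (compose (carrier P) \<alpha> \<beta>)) (pure_tensor A B P0 b' p)
          = psi (pure_tensor A B EA b \<alpha>) (psi (pure_tensor A B EA c \<beta>) (pure_tensor A B P0 b' p))"
        using b b' p EA EA_closed[OF EA(2) p]
        by (simp add: psi_pure[OF cb cEA b' p] psi_pure B.M.m_assoc compose_eq)
    qed
    then show "psi (tmap A B EA (\<lambda>x. x) (tbil A B E\<Lambda> (\<lambda>x y. y \<otimes>\<^bsub>B\<^esub> x) (compose (carrier P))
          (pure_tensor A B E\<Lambda> b \<alpha>) (pure_tensor A B E\<Lambda> c \<beta>))) T
        = psi (tmap A B EA (\<lambda>x. x) (pure_tensor A B E\<Lambda> b \<alpha>)) (psi (tmap A B EA (\<lambda>x. x) (pure_tensor A B E\<Lambda> c \<beta>)) T)"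
      unfolding tbil_pure[OF B_module Em B_module Em B_module Em mult_bilinear_op[OF B] compose_bilinear b(1) E(1) b(2) E(2)]
        tmap_pure[OF B_module Em EA_module incl cb cE] tmap_pure[OF B_module Em EA_module incl b(1) E(1)]
        tmap_pure[OF B_module Em EA_module incl b(2) E(2)] .
  qed
qed

lemma Psi_algebra_iso:
  assumes free: "free_of_finite_rank A P0"
    and bij: "bij_betw (Psi A B \<Lambda> P) (carrier (tensor_product A B E\<Lambda>)) (carrier EB)"
  shows "Psi A B \<Lambda> P \<in> algebra_iso A (tensor_product A (opposite B) E\<Lambda>) EB"
proof -
  let ?T = "tensor_product A B E\<Lambda>"
  note sub = E\<Lambda>_submodule[OF free]
  have Em: "module A E\<Lambda>" using submodule_module[OF EA_module sub] by (simp add: E\<Lambda>_eq[symmetric])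
  have incl: "lin A E\<Lambda> EA (\<lambda>x. x)" using lin_inclusion[OF sub] by (simp add: E\<Lambda>_eq[symmetric])
  have tl: "lin A ?T TE (tmap A B EA (\<lambda>x. x))"
    by (rule tmap_lin[OF B_module Em EA_module incl])
  interpret T: module A ?T by (rule tensor_module[OF B_module Em])
  note Psi = Psi_eq[OF free]
  note mb = tbil_bilinear[OF B_module Em B_module Em B_module Em mult_bilinear_op[OF B] compose_bilinear]
  have one: "(\<lambda>p\<in>carrier P. p) \<in> carrier E\<Lambda>"
    by (auto simp: End_algebra_carrier lmod.smult_closed)
  have "Psi A B \<Lambda> P (tbil A B E\<Lambda> (\<lambda>x y. y \<otimes>\<^bsub>B\<^esub> x) (compose (carrier P)) U V)
      = compose (carrier TP) (Psi A B \<Lambda> P U) (Psi A B \<Lambda> P V)"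
    if U: "U \<in> carrier ?T" and V: "V \<in> carrier ?T" for U V
    unfolding Psi[OF U] Psi[OF V] Psi[OF bilinear_closed[OF mb U V]] psi_restricted_def compose_def
    by (intro restrict_ext)
      (simp add: psi_mult[OF free U V, unfolded compose_def] bilinear_closed[OF psi_bilinear lin_closed[OF tl V]])
  moreover have "Psi A B \<Lambda> P (U \<oplus>\<^bsub>?T\<^esub> V) = Psi A B \<Lambda> P U \<oplus>\<^bsub>EB\<^esub> Psi A B \<Lambda> P V"
    if U: "U \<in> carrier ?T" and V: "V \<in> carrier ?T" for U V
    unfolding Psi[OF U] Psi[OF V] Psi[OF T.M.a_closed[OF U V]] lin_add[OF tl U V]
    by (rule psi_restricted_add[OF lin_closed[OF tl U] lin_closed[OF tl V]])
  moreover have "Psi A B \<Lambda> P (a \<odot>\<^bsub>?T\<^esub> U) = a \<odot>\<^bsub>EB\<^esub> Psi A B \<Lambda> P U"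
    if a: "a \<in> carrier A" and U: "U \<in> carrier ?T" for a U
    unfolding Psi[OF U] Psi[OF T.smult_closed[OF a U]] lin_smult[OF tl a U]
    by (rule psi_restricted_smult[OF a lin_closed[OF tl U]])
  moreover have "Psi A B \<Lambda> P (pure_tensor A B E\<Lambda> \<one>\<^bsub>B\<^esub> (\<lambda>p\<in>carrier P. p)) = (\<lambda>T\<in>carrier TP. T)"
  proof -
    note oneEA = lin_closed[OF incl one]
    have "psi (pure_tensor A B EA \<one>\<^bsub>B\<^esub> (\<lambda>p\<in>carrier P. p)) T = T" if "T \<in> carrier TP" for T
      by (rule tensor_lin_eq[OF B_module P0_module TP_module
            bilinear_right[OF psi_bilinear pure_closed[OF B_module EA_module B.M.one_closed oneEA]] lin_id _ that])
        (simp add: psi_pure oneEA)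
    then show ?thesis
      unfolding Psi[OF pure_closed[OF B_module Em B.M.one_closed one]] tmap_pure[OF B_module Em EA_module incl B.M.one_closed one]
        psi_restricted_def by (intro restrict_ext) simp
  qed
  ultimately show ?thesis
    using bij bij_betw_imp_funcset[OF bij]
    unfolding algebra_iso_def ring_iso_def ring_hom_def mem_Collect_eq opposite_tensor_product
      End_algebra_simps(3,4) extend_module_simps(1)
    by (intro conjI ballI allI impI; (elim conjE)?; simp only:)
qed

end

section \<open>Base change of endomorphism algebras\<close>

context algebra_module
begin

text \<open>On B \<otimes> End_\<Lambda>(P), \<open>Psi\<close> is the base change of the inclusion
  into \<open>EA\<close> followed by the bijection from solutions to endomorphisms. Bijectivity thus
  rests on the first map, to which the splitting applies.\<close>

theorem endomorphism_base_change:
  assumes free: "free_of_finite_rank A P0"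
    and hyp: "\<forall>\<mm>. maximalideal \<mm> A \<longrightarrow>
        (\<exists>(F :: 'f ring) h. field F \<and> h \<in> ring_hom A F \<and> a_kernel A F h = \<mm> \<and>
          (let FA = algebra_via h F in
            Psi A FA \<Lambda> P ` carrier (tensor_product A FA (End_algebra \<Lambda> P)) =
              carrier (End_algebra (tensor_product A FA \<Lambda>) (extend_module A FA \<Lambda> P))))"
    and B: "assoc_algebra A (B :: ('a, 'b) module)"
  shows "Psi A B \<Lambda> P \<in> algebra_iso A (tensor_product A (opposite B) (End_algebra \<Lambda> P))
    (End_algebra (tensor_product A B \<Lambda>) (extend_module A B \<Lambda> P))"
proof -
  obtain D \<eta> where db: "dual_basis A P0 D (\<lambda>e. e) \<eta>" using free_dual_basis[OF P0_module free] by (elim exE)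
  define R where "R = coordinate_functionals D \<eta> commutators"
  have R: "R \<subseteq> functionals A EA"
    unfolding R_def by (rule coordinate_functionals_subset[OF EA_module P0_module db commutators_lin])
  have K: "EA\<lparr>carrier := common_kernel A EA R\<rparr> = E\<Lambda>"
    unfolding R_def endomorphism_kernel[OF db, symmetric] by (rule E\<Lambda>_eq[symmetric])
  interpret B: algebra_module_extension A \<Lambda> P B
    by (intro algebra_module_extension.intro algebra_module_extension_axioms.intro algebra_module_axioms B)
  have loc: "\<exists>B :: ('a, 'f) module. module A B \<and> residue_module A m B \<and>
      tensor_solutions A B EA R \<subseteq> tspan A B EA (common_kernel A EA R)" if m: "maximalideal m A" for m
  proof -
    obtain F :: "'f ring" and h where F: "field F" "h \<in> ring_hom A F" "a_kernel A F h = m"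
      and eq: "Psi A (algebra_via h F) \<Lambda> P ` carrier (tensor_product A (algebra_via h F) E\<Lambda>) =
        carrier (End_algebra (tensor_product A (algebra_via h F) \<Lambda>) (extend_module A (algebra_via h F) \<Lambda> P))"
      using hyp m by (auto simp: Let_def)
    interpret FA: algebra_module_extension A \<Lambda> P "algebra_via h F"
      by (rule algebra_via_extended[OF F])
    let ?F = "algebra_via h F"
    \<comment> \<open>Surjectivity of \<open>Psi\<close> over \<open>F\<close> gives a preimage
      \<open>U\<close> of the endomorphism attached to \<open>S\<close>; injectivity of
      \<open>psi_restricted\<close> on solutions then shows that \<open>S\<close> is the image of
      \<open>U\<close>.\<close>
    have "S \<in> tspan A ?F EA (common_kernel A EA R)" if S: "S \<in> tensor_solutions A ?F EA R" for S
    proof -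
      have "FA.psi_restricted S \<in> Psi A ?F \<Lambda> P ` carrier (tensor_product A ?F E\<Lambda>)"
        unfolding eq using FA.psi_restricted_closed[OF db] S unfolding R_def .
      then obtain U where U: "U \<in> carrier (tensor_product A ?F E\<Lambda>)" "FA.psi_restricted S = Psi A ?F \<Lambda> P U"
        by blast
      have span: "tmap A ?F EA (\<lambda>x. x) U \<in> tspan A ?F EA (common_kernel A EA R)"
        unfolding tspan_def K using U(1) by (rule imageI)
      moreover have "S = tmap A ?F EA (\<lambda>x. x) U"
        by (rule inj_onD[OF bij_betw_imp_inj_on[OF FA.psi_restricted_bij[OF db, folded R_def]]])
          (use S U FA.Psi_eq[OF free U(1)] tspan_subset_solutions[OF EA_module FA.B_module R] span in auto)
      ultimately show ?thesis by simp
    qed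
    then show ?thesis using FA.B_module algebra_via_extended(2)[OF F] by blast
  qed
  have "\<exists>\<gamma>\<in>factoring R EA. \<forall>\<phi>\<in>R. \<forall>x\<in>carrier EA. \<phi> (\<gamma> x) = \<phi> x"
    by (rule global_splitting[OF EA_module EA_dual_basis[OF db] R loc])
  then obtain \<gamma> where \<gamma>: "\<gamma> \<in> factoring R EA" "\<forall>\<phi>\<in>R. \<forall>x\<in>carrier EA. \<phi> (\<gamma> x) = \<phi> x"
    by (elim bexE)
  have "bij_betw (tmap A B EA (\<lambda>x. x)) (carrier (tensor_product A B E\<Lambda>)) (tensor_solutions A B EA R)"
    using splitting_base_change[OF EA_module B.B_module R \<gamma>(1)] \<gamma>(2)
    unfolding K tspan_def bij_betw_def by simp
  then have "bij_betw (B.psi_restricted \<circ> tmap A B EA (\<lambda>x. x)) (carrier (tensor_product A B E\<Lambda>)) (carrier B.EB)"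
    by (rule bij_betw_trans) (rule B.psi_restricted_bij[OF db, folded R_def])
  then have "bij_betw (Psi A B \<Lambda> P) (carrier (tensor_product A B E\<Lambda>)) (carrier B.EB)"
    by (rule bij_betw_cong[THEN iffD1, rotated]) (simp add: B.Psi_eq[OF free])
  then show ?thesis by (rule B.Psi_algebra_iso[OF free])
qed

end

theorem corollary2p13:
  fixes A :: "'a ring" and \<Lambda> :: "('a, 'l) module" and P :: "('l, 'p) module"
  assumes "dedekind_domain A \<or> field A"
    and "assoc_algebra A \<Lambda>" and "free_of_finite_rank A \<Lambda>"
    and "left_module \<Lambda> P" and "free_of_finite_rank A (restrict_scalars \<Lambda> P)"
  shows
    "((\<forall>\<mm>. maximalideal \<mm> A \<longrightarrow>
        (\<exists>(F :: 'f ring) h. field F \<and> h \<in> ring_hom A F \<and> a_kernel A F h = \<mm> \<and>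
          (let FA = algebra_via h F in
            Phi A FA \<Lambda> ` carrier (tensor_product A FA (Ann_module \<Lambda> P)) =
              annihilator (tensor_product A FA \<Lambda>) (extend_module A FA \<Lambda> P))))
     \<longrightarrow>
     (\<forall>B :: ('a, 'b) module. assoc_algebra A B \<longrightarrow>
        Phi A B \<Lambda> \<in> left_module_iso B
          (base_change A B (Ann_module \<Lambda> P))
          ((base_change A B \<Lambda>)
             \<lparr>carrier := annihilator (tensor_product A B \<Lambda>) (extend_module A B \<Lambda> P)\<rparr>)))
     \<and>
     ((\<forall>\<mm>. maximalideal \<mm> A \<longrightarrow>
        (\<exists>(F :: 'f ring) h. field F \<and> h \<in> ring_hom A F \<and> a_kernel A F h = \<mm> \<and>
          (let FA = algebra_via h F in
            Psi A FA \<Lambda> P ` carrier (tensor_product A FA (End_algebra \<Lambda> P)) =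
              carrier (End_algebra (tensor_product A FA \<Lambda>) (extend_module A FA \<Lambda> P)))))
     \<longrightarrow>
     (\<forall>B :: ('a, 'b) module. assoc_algebra A B \<longrightarrow>
        Psi A B \<Lambda> P \<in> algebra_iso A
          (tensor_product A (opposite B) (End_algebra \<Lambda> P))
          (End_algebra (tensor_product A B \<Lambda>) (extend_module A B \<Lambda> P))))"
proof -
  interpret algebra_module A \<Lambda> P by (intro algebra_module.intro assms)
  show ?thesis
    by (rule conjI; rule impI; intro allI impI;
        erule (1) annihilator_base_change[OF assms(3,5)] endomorphism_base_change[OF assms(5)])
qed

end
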